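(* Fix $T>0$. Let $\phi\in C^\infty_{\mathrm{poly}}(\mathbb{R}^d)$ be globally Lipschitz continuous and let $\mathcal{P}=\phi(\mathbf{X}(T))$. Suppose that (a) $\mathbf{X}_n$ and $\mathbf{Y}_n$ are weak order-$\alpha$ approximations to $\mathbf{X}(t)$ for some $\alpha>1/2$; (b) $\mathbf{Z}_n=[\mathbf{X}_n,\mathbf{Y}_n]$ is a second-order weak approximation to the solution $\mathbf{Z}_h(t)=[\mathbf{X}_h(t),\mathbf{Y}_h(t)]$ of the modified equation; (c) $\mathbf{f}$ and $G$ are globally Lipschitz continuous, and there exists $C_1>0$ such that, for all $h>0$ sufficiently small and all $s\in[0,T]$, $$\mathbb{E}\bigl[\|\mathbf{f}_1(\mathbf{X}_h(s))\|^2\bigr],\ \mathbb{E}\bigl[\|G_1(\mathbf{X}_h(s))\|_{\mathrm F}^2\bigr],\ \mathbb{E}\bigl[\|\mathbf{f}_2(\mathbf{Y}_h(s))\|^2\bigr],\ \mathbb{E}\bigl[\|G_2(\mathbf{Y}_h(s))\|_{\mathrm F}^2\bigr]\le C_1 .$$ For each level $\ell\ge1$, let $[\mathcal{P}_\ell^{(i)},\mathcal{P}_{\ell-1}^{(i)}]$, $i=1,\dots,N_\ell$, be i.i.d. samples of $[\phi(\mathbf{X}_M),\phi(\mathbf{Y}_M)]$ computed with $h=h_\ell$ and $Mh=T$ (and, for $\ell=0$, let $\mathcal{P}_0^{(i)}$ be i.i.d. samples of $\phi(\mathbf{X}_M)$ with $h=h_0$, $Mh=T$). Then, provided the time steps $h_\ell$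 are sufficiently small, there exist positive constants $c_1,c_2$, independent of $\ell$ and of the sample numbers $N_\ell$, such that for all $\ell\ge0$: (i) $\bigl|\mathbb{E}[\widehat{\mathcal{P}}_\ell-\mathcal{P}]\bigr|\le c_1h_\ell^\alpha$; (ii) $\mathbb{E}[\widehat{Y}_{\ell,N_\ell}]=\mathbb{E}[\widehat{\mathcal{P}}_0]$ if $\ell=0$, and $\mathbb{E}[\widehat{Y}_{\ell,N_\ell}]=\mathbb{E}[\widehat{\mathcal{P}}_\ell-\widehat{\mathcal{P}}_{\ell-1}]$ if $\ell>0$; (iii) $\operatorname{Var}[\widehat{Y}_{\ell,N_\ell}]\le c_2N_\ell^{-1}h_\ell^2$.
   Context: SDE. Let $\mathbf{f}\colon\mathbb{R}^d\to\mathbb{R}^d$, $G\colon\mathbb{R}^d\to\mathbb{R}^{d\times m}$, $\mathbf{X}_0\in\mathbb{R}^d$, and let $\mathbf{W}(t)$ be a vector of $m$ i.i.d. standard Brownian motions. All SDEs are Ito SDEs, assumed to have well-defined solutions; $\|\cdot\|_{\mathrm F}$ is the Frobenius norm. Doubled-up system for $\mathbf{Z}=[\mathbf{X},\mathbf{Y}]\in\mathbb{R}^{2d}$: $$d\mathbf{X}=\mathbf{f}(\mathbf{X})\,dt+G(\mathbf{X})\,d\mathbf{W}(t),\quad \mathbf{X}(0)=\mathbf{X}_0,\qquad d\mathbf{Y}=\mathbf{f}(\mathbf{Y})\,dt+G(\mathbf{Y})\,d\mathbf{W}(t),\quad \mathbf{Y}(0)=\mathbf{X}_0,$$ so that $\mathbf{X}(t)=\mathbf{Y}(t)$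 almost surely. For a time step $h>0$, $\mathbf{X}(t_n)$ and $\mathbf{Y}(t_n)$, $t_n=nh$, are approximated by (possibly different) numerical integrators giving random variables $\mathbf{X}_n,\mathbf{Y}_n$ on a common probability space, and $\mathbf{Z}_n=[\mathbf{X}_n,\mathbf{Y}_n]$. Modified equation, for given $\mathbf{f}_1,\mathbf{f}_2\colon\mathbb{R}^d\to\mathbb{R}^d$ and $G_1,G_2\colon\mathbb{R}^d\to\mathbb{R}^{d\times m}$ and $h>0$: $$d\mathbf{X}_h=\bigl[\mathbf{f}(\mathbf{X}_h)+h\mathbf{f}_1(\mathbf{X}_h)\bigr]dt+\bigl[G(\mathbf{X}_h)+hG_1(\mathbf{X}_h)\bigr]d\mathbf{W}(t),\quad \mathbf{X}_h(0)=\mathbf{X}_0,$$ $$d\mathbf{Y}_h=\bigl[\mathbf{f}(\mathbf{Y}_h)+h\mathbf{f}_2(\mathbf{Y}_h)\bigr]dt+\bigl[G(\mathbf{Y}_h)+hG_2(\mathbf{Y}_h)\bigr]d\mathbf{W}(t),\quad \mathbf{Y}_h(0)=\mathbf{X}_0,$$ driven by the same $\mathbf{W}$ as the doubled-up system. Test functions. $C^\infty_{\mathrm{poly}}(\mathbb{R}^k)$ is the set of infinitely differentiable functions $\mathbb{R}^k\to\mathbb{R}$ all of whose derivatives (including the function itself) are polynomially bounded. Weak approximation. Random variables $\mathbf{U}_n$ (depending on $h$) with values in $\mathbb{R}^k$ are a weak order-$\alpha$ approximation to a process $\mathbf{U}(t)$ (which may itself depend on $h$, as for $\mathbf{Z}_h$)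 if for all $\varphi\in C^\infty_{\mathrm{poly}}(\mathbb{R}^k)$ and $T>0$ there exists $K>0$ such that, for $h$ sufficiently small, $|\mathbb{E}[\varphi(\mathbf{U}(T))]-\mathbb{E}[\varphi(\mathbf{U}_M)]|\le Kh^\alpha$ where $Mh=T$ (in particular these expectations are finite). Second-order weak means $\alpha=2$. Multilevel setting. $M_\ell=M_02^\ell$ with $M_0\in\mathbb{N}$ fixed, $h_\ell=T/M_\ell$, $N_\ell\in\mathbb{N}$ is the number of samples on level $\ell$. $\widehat{\mathcal{P}}_\ell=\frac1{N_\ell}\sum_{i=1}^{N_\ell}\mathcal{P}_\ell^{(i)}$ is the Monte Carlo estimator on level $\ell$, $\widehat{Y}_{0,N_0}=\widehat{\mathcal{P}}_0$, and for $\ell\ge1$, $\widehat{Y}_{\ell,N_\ell}=\frac1{N_\ell}\sum_{i=1}^{N_\ell}Y_\ell^{(i)}$ with $Y_\ell^{(i)}=\mathcal{P}_\ell^{(i)}-\mathcal{P}_{\ell-1}^{(i)}$. As always in this setting, the approximation belonging to a given level has the same distribution wherever it appears: for $\ell\ge1$, $\phi(\mathbf{Y}_M)$ computed with $h=h_\ell$ has the same distribution as $\phi(\mathbf{X}_M)$ computed with $h=h_{\ell-1}$. The constants may depend on $M_0$, $T$, $\phi$. *)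

theory Defs
  imports "HOL-Probability.Probability"
begin

section \<open>Test functions\<close>

text \<open>Iterated partial derivatives along a word of basis vectors.  Since \<open>frechet_derivative\<close>
  is arbitrary where the function is not differentiable, differentiability of every iterated
  derivative is required separately in the next definition.\<close>

fun partial_deriv :: "'k::euclidean_space list \<Rightarrow> ('k \<Rightarrow> real) \<Rightarrow> 'k \<Rightarrow> real" where
  "partial_deriv [] \<phi> = \<phi>"
| "partial_deriv (b # bs) \<phi> = (\<lambda>x. frechet_derivative (partial_deriv bs \<phi>) (at x) b)"

definition C_inf_poly :: "('k::euclidean_space \<Rightarrow> real) set" where
  "C_inf_poly = {\<phi>. \<forall>bs \<in> lists Basis.
     (\<forall>x. partial_deriv bs \<phi> differentiable (at x)) \<and>
     (\<exists>C p. \<forall>x. \<bar>partial_deriv bs \<phi> x\<bar> \<le> C * (1 + norm x ^ (p::nat)))}"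

definition globally_lipschitz :: "('x::metric_space \<Rightarrow> 'y::metric_space) \<Rightarrow> bool" where
  "globally_lipschitz g \<longleftrightarrow> (\<exists>L. L-lipschitz_on UNIV g)"


section \<open>Brownian motion\<close>

definition standard_brownian_motion :: "'a measure \<Rightarrow> (real \<Rightarrow> 'a \<Rightarrow> real) \<Rightarrow> bool" where
  "standard_brownian_motion M B \<longleftrightarrow>
     (\<forall>t\<ge>0. B t \<in> borel_measurable M) \<and>
     (AE \<omega> in M. B 0 \<omega> = 0) \<and>
     (AE \<omega> in M. continuous_on {0..} (\<lambda>t. B t \<omega>)) \<and>
     (\<forall>s t. 0 \<le> s \<and> s < t \<longrightarrow>
        distributed M lborel (\<lambda>\<omega>. B t \<omega> - B s \<omega>) (normal_density 0 (sqrt (t - s)))) \<and>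
     (\<forall>(n::nat) \<tau>. 0 \<le> \<tau> 0 \<and> (\<forall>i<n. \<tau> i < \<tau> (Suc i)) \<longrightarrow>
        prob_space.indep_vars M (\<lambda>_. borel) (\<lambda>i \<omega>. B (\<tau> (Suc i)) \<omega> - B (\<tau> i) \<omega>) {..<n})"

text \<open>A vector of i.i.d. standard Brownian motions; the components are independent as processes,
  that is, as random elements of the product space over the time axis.\<close>

definition brownian_vector :: "'a measure \<Rightarrow> (real \<Rightarrow> 'a \<Rightarrow> real ^ 'm) \<Rightarrow> bool" where
  "brownian_vector M W \<longleftrightarrow>
     (\<forall>j. standard_brownian_motion M (\<lambda>t \<omega>. W t \<omega> $ j)) \<and>
     prob_space.indep_vars M (\<lambda>_. PiM {0..} (\<lambda>_. borel))
       (\<lambda>j \<omega>. restrict (\<lambda>t. W t \<omega> $ j) {0..}) UNIV"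

text \<open>The filtration is any one for which \<open>W\<close> is a Brownian motion: \<open>W\<close> is adapted and its future
  increments are independent of the past.  The usual conditions are not imposed.\<close>

definition brownian_filtration ::
    "'a measure \<Rightarrow> (real \<Rightarrow> 'a measure) \<Rightarrow> (real \<Rightarrow> 'a \<Rightarrow> real ^ 'm) \<Rightarrow> bool" where
  "brownian_filtration M F W \<longleftrightarrow>
     filtration (space M) F \<and>
     (\<forall>t\<ge>0. subalgebra M (F t)) \<and>
     (\<forall>t\<ge>0. W t \<in> borel_measurable (F t)) \<and>
     (\<forall>s t. 0 \<le> s \<and> s < t \<longrightarrow>
        prob_space.indep_set M (sets (F s))
          {(\<lambda>\<omega>. W t \<omega> - W s \<omega>) -` A \<inter> space M | A. A \<in> sets borel})"


section \<open>Ito integral and stochastic differential equations\<close>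

definition measurable_adapted ::
    "'a measure \<Rightarrow> (real \<Rightarrow> 'a measure) \<Rightarrow> (real \<Rightarrow> 'a \<Rightarrow> 'b::topological_space) \<Rightarrow> bool" where
  "measurable_adapted M F H \<longleftrightarrow>
     (\<lambda>(t, \<omega>). H t \<omega>) \<in> borel_measurable (restrict_space borel {0..} \<Otimes>\<^sub>M M) \<and>
     (\<forall>t\<ge>0. H t \<in> borel_measurable (F t))"

definition tendsto_in_prob ::
    "'a measure \<Rightarrow> (nat \<Rightarrow> 'a \<Rightarrow> 'b::real_normed_vector) \<Rightarrow> ('a \<Rightarrow> 'b) \<Rightarrow> bool" where
  "tendsto_in_prob M V V' \<longleftrightarrow>
     (\<forall>\<epsilon>>0. (\<lambda>k. measure M {\<omega> \<in> space M. norm (V k \<omega> - V' \<omega>) > \<epsilon>}) \<longlonglongrightarrow> 0)"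

text \<open>A simple integrand on \<open>[0, T]\<close> is given by a partition \<open>0 = \<tau> 0 < \<dots> < \<tau> n = T\<close> and
  bounded values \<open>\<xi> i\<close> on \<open>(\<tau> i, \<tau> (i + 1)]\<close> that are known at time \<open>\<tau> i\<close>.\<close>

definition simple_integrand :: "'a measure \<Rightarrow> (real \<Rightarrow> 'a measure) \<Rightarrow> real \<Rightarrow>
    nat \<Rightarrow> (nat \<Rightarrow> real) \<Rightarrow> (nat \<Rightarrow> 'a \<Rightarrow> real ^ 'm ^ 'd) \<Rightarrow> bool" where
  "simple_integrand M F T n \<tau> \<xi> \<longleftrightarrow>
     \<tau> 0 = 0 \<and> \<tau> n = T \<and> (\<forall>i<n. \<tau> i < \<tau> (Suc i)) \<and>
     (\<forall>i<n. \<xi> i \<in> borel_measurable (F (\<tau> i)) \<and> bounded (\<xi> i ` space M))"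

definition simple_process ::
    "nat \<Rightarrow> (nat \<Rightarrow> real) \<Rightarrow> (nat \<Rightarrow> 'a \<Rightarrow> real ^ 'm ^ 'd) \<Rightarrow> real \<Rightarrow> 'a \<Rightarrow> real ^ 'm ^ 'd" where
  "simple_process n \<tau> \<xi> s \<omega> = (\<Sum>i<n. indicator {\<tau> i <.. \<tau> (Suc i)} s *\<^sub>R \<xi> i \<omega>)"

definition simple_integral :: "(real \<Rightarrow> 'a \<Rightarrow> real ^ 'm) \<Rightarrow>
    nat \<Rightarrow> (nat \<Rightarrow> real) \<Rightarrow> (nat \<Rightarrow> 'a \<Rightarrow> real ^ 'm ^ 'd) \<Rightarrow> 'a \<Rightarrow> real ^ 'd" where
  "simple_integral W n \<tau> \<xi> \<omega> = (\<Sum>i<n. \<xi> i \<omega> *v (W (\<tau> (Suc i)) \<omega> - W (\<tau> i) \<omega>))"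

text \<open>\<open>has_ito_integral M F W H T I\<close>: the random vector \<open>I\<close> is (a version of) the Ito integral of
  \<open>H\<close> with respect to \<open>W\<close> over \<open>[0, T]\<close>, for measurable adapted \<open>H\<close> with almost surely square
  integrable paths, defined by approximation with simple integrands in probability.
  On matrices \<open>real ^ 'm ^ 'd\<close> the library's \<open>norm\<close> is the Frobenius norm.\<close>

definition has_ito_integral :: "'a measure \<Rightarrow> (real \<Rightarrow> 'a measure) \<Rightarrow> (real \<Rightarrow> 'a \<Rightarrow> real ^ 'm) \<Rightarrow>
    (real \<Rightarrow> 'a \<Rightarrow> real ^ 'm ^ 'd) \<Rightarrow> real \<Rightarrow> ('a \<Rightarrow> real ^ 'd) \<Rightarrow> bool" where
  "has_ito_integral M F W H T I \<longleftrightarrow>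
     measurable_adapted M F H \<and>
     (AE \<omega> in M. set_integrable lborel {0..T} (\<lambda>s. (norm (H s \<omega>))\<^sup>2)) \<and>
     I \<in> borel_measurable M \<and>
     (\<exists>n \<tau> \<xi>. (\<forall>k. simple_integrand M F T (n k) (\<tau> k) (\<xi> k)) \<and>
        tendsto_in_prob M
          (\<lambda>k \<omega>. LINT s:{0..T}|lborel. (norm (simple_process (n k) (\<tau> k) (\<xi> k) s \<omega> - H s \<omega>))\<^sup>2)
          (\<lambda>_. 0) \<and>
        tendsto_in_prob M (\<lambda>k. simple_integral W (n k) (\<tau> k) (\<xi> k)) I)"

definition sde_solution :: "'a measure \<Rightarrow> (real \<Rightarrow> 'a measure) \<Rightarrow> (real \<Rightarrow> 'a \<Rightarrow> real ^ 'm) \<Rightarrow>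
    (real ^ 'd \<Rightarrow> real ^ 'd) \<Rightarrow> (real ^ 'd \<Rightarrow> real ^ 'm ^ 'd) \<Rightarrow> real ^ 'd \<Rightarrow>
    (real \<Rightarrow> 'a \<Rightarrow> real ^ 'd) \<Rightarrow> bool" where
  "sde_solution M F W b \<sigma> x\<^sub>0 X \<longleftrightarrow>
     measurable_adapted M F X \<and>
     (AE \<omega> in M. continuous_on {0..} (\<lambda>t. X t \<omega>)) \<and>
     (AE \<omega> in M. X 0 \<omega> = x\<^sub>0) \<and>
     measurable_adapted M F (\<lambda>t \<omega>. b (X t \<omega>)) \<and>
     (\<forall>t\<ge>0. AE \<omega> in M. set_integrable lborel {0..t} (\<lambda>s. b (X s \<omega>))) \<and>
     (\<forall>t\<ge>0. \<exists>I. has_ito_integral M F W (\<lambda>s \<omega>. \<sigma> (X s \<omega>)) t I \<and>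
        (AE \<omega> in M. X t \<omega> = x\<^sub>0 + (LINT s:{0..t}|lborel. b (X s \<omega>)) + I \<omega>))"


section \<open>Weak approximation\<close>

text \<open>\<open>U\<^sub>n h n\<close> is the \<open>n\<close>-th iterate with time step \<open>h\<close>, a random variable on \<open>Q h\<close>; \<open>U h t\<close> is the
  approximated process, which may depend on \<open>h\<close>, on \<open>M\<close>.\<close>

definition weak_approximation :: "real \<Rightarrow> (real \<Rightarrow> 'b measure) \<Rightarrow>
    (real \<Rightarrow> nat \<Rightarrow> 'b \<Rightarrow> 'k::euclidean_space) \<Rightarrow> 'a measure \<Rightarrow> (real \<Rightarrow> real \<Rightarrow> 'a \<Rightarrow> 'k) \<Rightarrow> bool" where
  "weak_approximation \<alpha> Q U\<^sub>n M U \<longleftrightarrow>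
     (\<forall>\<phi> \<in> C_inf_poly. \<forall>T>0. \<exists>K>0. \<forall>\<^sub>F h in at_right 0. \<forall>m::nat. real m * h = T \<longrightarrow>
        integrable M (\<lambda>\<omega>. \<phi> (U h T \<omega>)) \<and>
        integrable (Q h) (\<lambda>\<omega>. \<phi> (U\<^sub>n h m \<omega>)) \<and>
        \<bar>(LINT \<omega>|M. \<phi> (U h T \<omega>)) - (LINT \<omega>|Q h. \<phi> (U\<^sub>n h m \<omega>))\<bar> \<le> K * h powr \<alpha>)"


section \<open>Multilevel Monte Carlo\<close>

definition level_steps :: "nat \<Rightarrow> nat \<Rightarrow> nat" where
  "level_steps M\<^sub>0 l = M\<^sub>0 * 2 ^ l"

definition level_h :: "real \<Rightarrow> nat \<Rightarrow> nat \<Rightarrow> real" where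
  "level_h T M\<^sub>0 l = T / real (level_steps M\<^sub>0 l)"

definition iid_samples ::
    "'a measure \<Rightarrow> nat \<Rightarrow> (nat \<Rightarrow> 'a \<Rightarrow> 'v::topological_space) \<Rightarrow> 'v measure \<Rightarrow> bool" where
  "iid_samples M N V D \<longleftrightarrow>
     prob_space.indep_vars M (\<lambda>_. borel) V {1..N} \<and> (\<forall>i\<in>{1..N}. distr M borel (V i) = D)"

definition sample_mean :: "nat \<Rightarrow> (nat \<Rightarrow> 'a \<Rightarrow> real) \<Rightarrow> 'a \<Rightarrow> real" where
  "sample_mean N V \<omega> = (\<Sum>i=1..N. V i \<omega>) / real N"

text \<open>On level \<open>l\<close>, \<open>Pf l i\<close> is the \<open>i\<close>-th sample of the approximation with step \<open>level_h T M\<^sub>0 l\<close>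
  and, for \<open>l \<ge> 1\<close>, \<open>Pc l i\<close> is the coarser sample (step \<open>level_h T M\<^sub>0 (l - 1)\<close>) coupled to it.\<close>

definition level_estimator ::
    "(nat \<Rightarrow> nat) \<Rightarrow> (nat \<Rightarrow> nat \<Rightarrow> 'a \<Rightarrow> real) \<Rightarrow> nat \<Rightarrow> 'a \<Rightarrow> real" where
  "level_estimator N Pf l = sample_mean (N l) (Pf l)"

definition correction_estimator :: "(nat \<Rightarrow> nat) \<Rightarrow> (nat \<Rightarrow> nat \<Rightarrow> 'a \<Rightarrow> real) \<Rightarrow>
    (nat \<Rightarrow> nat \<Rightarrow> 'a \<Rightarrow> real) \<Rightarrow> nat \<Rightarrow> 'a \<Rightarrow> real" where
  "correction_estimator N Pf Pc l =
     (if l = 0 then level_estimator N Pf 0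
      else sample_mean (N l) (\<lambda>i \<omega>. Pf l i \<omega> - Pc l i \<omega>))"

end

theory Submission
  imports Defs
begin

text \<open>The variance of the correction on a level is at most \<open>1 / N\<close> times the expectation of
  \<open>(\<phi> x - \<phi> y)\<^sup>2\<close> at the pair of coupled iterates.  This is itself a test function on the product
  space, so (b) replaces the iterates by the modified equation at the cost of \<open>O(h\<^sup>2)\<close>, and as \<open>\<phi>\<close> is
  Lipschitz it remains to see that \<open>E |X\<^sub>h(T) - Y\<^sub>h(T)|\<^sup>2 = O(h\<^sup>2)\<close>.  This is a Gronwall argument, but
  finiteness of the second moment is not known beforehand.  Instead of stopping times, the localisation uses the
  events \<open>B(t) < c\<close>, where \<open>B(t)\<close> is a pathwise time integral that dominates the energy of the
  difference of the coefficients: the Ito integral \<open>I\<close> of \<open>H\<close> with energy \<open>V\<close> satisfies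
  \<open>E (|I|\<^sup>2; V < c) \<le> E (min c V)\<close>, and \<open>E (min c (B t))\<close> then obeys a Gronwall inequality with
  constants independent of \<open>c\<close>.\<close>

section \<open>Test functions\<close>

text \<open>Two obstacles shape the localisation. Hypothesis (b) yields finite moments of the
  modified solutions only at one time at a time, for h below a threshold depending on that time; so
  for a fixed h no bound on the second moment of the difference is available along the whole
  interval, and a Gronwall argument cannot start. Moreover \<open>has_ito_integral\<close> describes
  the integral over [0, t] separately for each t, as a limit in probability; stopping it at a random
  time would mean treating it as a process in t. The event B(t) < c concerns the single time t, and
  the truncation behind it is made inside the simple integrands, on finite sums.

  One B bounds the energy of the drift difference and that of the diffusion difference at once. It
  is nondecreasing and continuous in time, so min c B grows only while B < c, which is the event on
  which the Ito estimate controls the squared distance of the solutions. The inequality therefore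
  closes on E (min c B), a quantity that is at most c and thus finite from the start.\<close>

definition poly_bounded :: "('k::real_normed_vector \<Rightarrow> real) \<Rightarrow> bool" where
  "poly_bounded g \<longleftrightarrow> (\<exists>C p. \<forall>x. \<bar>g x\<bar> \<le> C * (1 + norm x ^ (p::nat)))"

lemma poly_boundedE:
  assumes "poly_bounded g"
  obtains C p where "0 \<le> C" "\<And>x. \<bar>g x\<bar> \<le> C * (1 + norm x ^ p)"
proof -
  obtain C p where C: "\<And>x. \<bar>g x\<bar> \<le> C * (1 + norm x ^ p)"
    using assms by (auto simp: poly_bounded_def)
  have "\<bar>g x\<bar> \<le> \<bar>C\<bar> * (1 + norm x ^ p)" for x
    by (rule order_trans[OF C mult_right_mono]) auto
  then show thesis
    using that abs_ge_zero by blast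
qed

lemma power_le_one_plus_power:
  fixes r :: real
  assumes "0 \<le> r"
  shows "r ^ p \<le> 1 + r ^ (p + q)"
proof (cases "r \<le> 1")
  case True
  then have "r ^ p \<le> 1" "0 \<le> r ^ (p + q)"
    using assms by (auto intro: power_le_one)
  then show ?thesis by linarith
next
  case False
  then have "r ^ p \<le> r ^ (p + q)"
    by (intro power_increasing) auto
  then show ?thesis by linarith
qed

lemma poly_bounded_add:
  assumes "poly_bounded g" "poly_bounded g'"
  shows "poly_bounded (\<lambda>x. g x + g' x)"
proof -
  obtain C p where C: "0 \<le> C" "\<And>x. \<bar>g x\<bar> \<le> C * (1 + norm x ^ p)"
    using assms(1) by (rule poly_boundedE) blast
  obtain C' p' where C': "0 \<le> C'" "\<And>x. \<bar>g' x\<bar> \<le> C' * (1 + norm x ^ p')"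
    using assms(2) by (rule poly_boundedE) blast
  have "\<bar>g x + g' x\<bar> \<le> (2 * C + 2 * C') * (1 + norm x ^ (p + p'))" for x
  proof -
    have "norm x ^ p \<le> 1 + norm x ^ (p + p')" "norm x ^ p' \<le> 1 + norm x ^ (p + p')" "0 \<le> norm x ^ (p + p')"
      using power_le_one_plus_power[of "norm x" p p'] power_le_one_plus_power[of "norm x" p' p]
      by (auto simp: add.commute[of p' p])
    then have "1 + norm x ^ p \<le> 2 * (1 + norm x ^ (p + p'))" "1 + norm x ^ p' \<le> 2 * (1 + norm x ^ (p + p'))"
      by argo+
    then have "C * (1 + norm x ^ p) \<le> C * (2 * (1 + norm x ^ (p + p')))"
      "C' * (1 + norm x ^ p') \<le> C' * (2 * (1 + norm x ^ (p + p')))"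
      using C(1) C'(1) by (auto intro: mult_left_mono)
    then have "C * (1 + norm x ^ p) + C' * (1 + norm x ^ p') \<le> (2 * C + 2 * C') * (1 + norm x ^ (p + p'))"
      by (simp add: algebra_simps)
    with C(2)[of x] C'(2)[of x] show ?thesis by linarith
  qed
  then show ?thesis unfolding poly_bounded_def by blast
qed

lemma poly_bounded_mult:
  assumes "poly_bounded g" "poly_bounded g'"
  shows "poly_bounded (\<lambda>x. g x * g' x)"
proof -
  obtain C p where C: "0 \<le> C" "\<And>x. \<bar>g x\<bar> \<le> C * (1 + norm x ^ p)"
    using assms(1) by (rule poly_boundedE) blast
  obtain C' p' where C': "0 \<le> C'" "\<And>x. \<bar>g' x\<bar> \<le> C' * (1 + norm x ^ p')"
    using assms(2) by (rule poly_boundedE) blast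
  have "\<bar>g x * g' x\<bar> \<le> (3 * (C * C')) * (1 + norm x ^ (p + p'))" for x
  proof -
    have "\<bar>g x * g' x\<bar> \<le> (C * (1 + norm x ^ p)) * (C' * (1 + norm x ^ p'))"
      unfolding abs_mult using C C' by (intro mult_mono) auto
    also have "\<dots> = (C * C') * (1 + norm x ^ p + norm x ^ p' + norm x ^ (p + p'))"
      by (simp add: algebra_simps power_add)
    also have "\<dots> \<le> (C * C') * (3 * (1 + norm x ^ (p + p')))"
    proof (intro mult_left_mono)
      show "1 + norm x ^ p + norm x ^ p' + norm x ^ (p + p') \<le> 3 * (1 + norm x ^ (p + p'))"
        using power_le_one_plus_power[of "norm x" p p'] power_le_one_plus_power[of "norm x" p' p]
        unfolding add.commute[of p' p] by simp
    qed (use C C' in auto)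
    finally show ?thesis by (simp add: algebra_simps)
  qed
  then show ?thesis unfolding poly_bounded_def by blast
qed

lemma poly_bounded_compose_linear:
  assumes "poly_bounded g" "bounded_linear A"
  shows "poly_bounded (\<lambda>x. g (A x))"
proof -
  obtain C p where C: "0 \<le> C" "\<And>x. \<bar>g x\<bar> \<le> C * (1 + norm x ^ p)"
    using assms(1) by (rule poly_boundedE) blast
  obtain K where K: "0 \<le> K" "\<And>x. norm (A x) \<le> norm x * K"
    using bounded_linear.nonneg_bounded[OF assms(2)] by blast
  have "\<bar>g (A x)\<bar> \<le> (C * (1 + K ^ p)) * (1 + norm x ^ p)" for x
  proof -
    have "norm (A x) ^ p \<le> norm x ^ p * K ^ p"
      unfolding power_mult_distrib[symmetric] by (intro power_mono K) auto
    then have "1 + norm (A x) ^ p \<le> (1 + K ^ p) * (1 + norm x ^ p)"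
      using K(1) by (simp add: algebra_simps add_increasing)
    then have "C * (1 + norm (A x) ^ p) \<le> C * ((1 + K ^ p) * (1 + norm x ^ p))"
      using C(1) by (rule mult_left_mono)
    with C(2)[of "A x"] show ?thesis
      by (simp add: mult.assoc)
  qed
  then show ?thesis unfolding poly_bounded_def by blast
qed

text \<open>Membership in \<open>C_inf_poly\<close> speaks of all iterated derivatives. An invariant
  set of functions, closed under partial derivatives, avoids formulas for them such as the Leibniz
  rule of higher order.\<close>

lemma C_inf_poly_coinduct:
  assumes "\<phi> \<in> S"
    and differentiable: "\<And>g x. g \<in> S \<Longrightarrow> g differentiable (at x)"
    and bound: "\<And>g. g \<in> S \<Longrightarrow> poly_bounded g"
    and deriv: "\<And>g b. g \<in> S \<Longrightarrow> b \<in> Basis \<Longrightarrow> (\<lambda>x. frechet_derivative g (at x) b) \<in> S"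
  shows "\<phi> \<in> C_inf_poly"
proof -
  have "partial_deriv bs \<phi> \<in> S" if "bs \<in> lists Basis" for bs
    using that
  proof induction
    case Nil
    show ?case using assms(1) by simp
  next
    case (Cons b bs)
    then show ?case using deriv[of "partial_deriv bs \<phi>" b] by simp
  qed
  then show ?thesis
    using differentiable bound by (auto simp: C_inf_poly_def poly_bounded_def)
qed

lemma C_inf_poly_differentiable: "\<phi> \<in> C_inf_poly \<Longrightarrow> \<phi> differentiable (at x)"
  by (force simp: C_inf_poly_def dest: bspec[of _ _ "[]"])

lemma C_inf_poly_bound: "\<phi> \<in> C_inf_poly \<Longrightarrow> poly_bounded \<phi>"
  by (force simp: C_inf_poly_def poly_bounded_def dest: bspec[of _ _ "[]"])

lemma C_inf_poly_deriv:
  assumes "\<phi> \<in> C_inf_poly" "b \<in> Basis"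
  shows "(\<lambda>x. frechet_derivative \<phi> (at x) b) \<in> C_inf_poly"
proof -
  \<comment> \<open>\<open>partial_deriv\<close> applies the head of the word last, so the
    derivative taken first stands at the end of the word.\<close>
  have "partial_deriv bs (\<lambda>x. frechet_derivative \<phi> (at x) b) = partial_deriv (bs @ [b]) \<phi>" for bs
    by (induction bs) auto
  moreover have "bs @ [b] \<in> lists Basis" if "bs \<in> lists Basis" for bs
    using that assms(2) by auto
  ultimately show ?thesis
    using assms(1) unfolding C_inf_poly_def mem_Collect_eq by metis
qed

lemma C_inf_poly_const: "(\<lambda>_. c) \<in> C_inf_poly"
proof (rule C_inf_poly_coinduct[where S = "range (\<lambda>c _. c)"])
  fix g :: "'a \<Rightarrow> real" assume "g \<in> range (\<lambda>c _. c)"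
  then obtain c where "g = (\<lambda>_. c)" by auto
  moreover have "\<bar>c\<bar> \<le> \<bar>c\<bar> * (1 + norm x ^ 0)" for x :: 'a
    by simp
  ultimately show "poly_bounded g"
    unfolding poly_bounded_def by blast
qed auto

inductive_set ring_closure :: "('x \<Rightarrow> real) set \<Rightarrow> ('x \<Rightarrow> real) set" for \<Phi> where
  gen: "g \<in> \<Phi> \<Longrightarrow> g \<in> ring_closure \<Phi>"
| add: "g \<in> ring_closure \<Phi> \<Longrightarrow> g' \<in> ring_closure \<Phi> \<Longrightarrow> (\<lambda>x. g x + g' x) \<in> ring_closure \<Phi>"
| mult: "g \<in> ring_closure \<Phi> \<Longrightarrow> g' \<in> ring_closure \<Phi> \<Longrightarrow> (\<lambda>x. g x * g' x) \<in> ring_closure \<Phi>"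

lemma ring_closure_C_inf_poly: "ring_closure C_inf_poly \<subseteq> C_inf_poly"
proof
  have diff: "g differentiable (at x)" if "g \<in> ring_closure C_inf_poly" for g and x :: 'a
    using that by induction (auto simp: C_inf_poly_differentiable)
  fix g :: "'a \<Rightarrow> real" assume "g \<in> ring_closure C_inf_poly"
  then show "g \<in> C_inf_poly"
  proof (rule C_inf_poly_coinduct)
    fix g :: "'a \<Rightarrow> real" assume g: "g \<in> ring_closure C_inf_poly"
    show "g differentiable (at x)" for x
      using g by (rule diff)
    show "poly_bounded g"
      using g by induction (auto intro: C_inf_poly_bound poly_bounded_add poly_bounded_mult)
    fix b :: 'a assume b: "b \<in> Basis"
    from g show "(\<lambda>x. frechet_derivative g (at x) b) \<in> ring_closure C_inf_poly"
    proof induction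
      case (gen g)
      then show ?case
        using C_inf_poly_deriv b by (auto intro: ring_closure.gen)
    next
      case (add g g')
      have "frechet_derivative (\<lambda>x. g x + g' x) (at x) b =
          frechet_derivative g (at x) b + frechet_derivative g' (at x) b" for x
        using frechet_derivative_at[OF has_derivative_add[OF diff[OF add.hyps(1), unfolded frechet_derivative_works]
            diff[OF add.hyps(2), unfolded frechet_derivative_works]], of x] by metis
      then show ?case
        using add.IH by (auto intro: ring_closure.add)
    next
      case (mult g g')
      have "frechet_derivative (\<lambda>x. g x * g' x) (at x) b =
          g x * frechet_derivative g' (at x) b + frechet_derivative g (at x) b * g' x" for x
        using frechet_derivative_at[OF has_derivative_mult[OF diff[OF mult.hyps(1), unfolded frechet_derivative_works]
            diff[OF mult.hyps(2), unfolded frechet_derivative_works]], of x] by metis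
      then show ?case
        using mult by (auto intro!: ring_closure.intros(2,3))
    qed
  qed
qed

lemma C_inf_poly_add: "g \<in> C_inf_poly \<Longrightarrow> g' \<in> C_inf_poly \<Longrightarrow> (\<lambda>x. g x + g' x) \<in> C_inf_poly"
  and C_inf_poly_mult: "g \<in> C_inf_poly \<Longrightarrow> g' \<in> C_inf_poly \<Longrightarrow> (\<lambda>x. g x * g' x) \<in> C_inf_poly"
  by (auto intro: subsetD[OF ring_closure_C_inf_poly] ring_closure.intros)

lemma C_inf_poly_diff:
  assumes "g \<in> C_inf_poly" "g' \<in> C_inf_poly"
  shows "(\<lambda>x. g x - g' x) \<in> C_inf_poly"
  using C_inf_poly_add[OF assms(1) C_inf_poly_mult[OF C_inf_poly_const[of "-1"] assms(2)]] by simp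

text \<open>By the chain rule the derivative of \<open>g (A x)\<close> along \<open>b\<close> is the
  derivative of \<open>g\<close> along \<open>A b\<close>. As \<open>C_inf_poly\<close> speaks of
  derivatives along basis vectors, \<open>A\<close> has to map these to basis vectors or to 0, as
  the two projections of a product do. The inserted zero function receives the case
  \<open>A b = 0\<close>.\<close>

lemma C_inf_poly_compose_linear:
  fixes A :: "'a::euclidean_space \<Rightarrow> 'b::euclidean_space"
  assumes "\<phi> \<in> C_inf_poly" and A: "bounded_linear A" and basis: "A ` Basis \<subseteq> insert 0 Basis"
  shows "(\<lambda>x. \<phi> (A x)) \<in> C_inf_poly"
proof -
  have diff: "(\<lambda>x. g (A x)) differentiable at x" if "g \<in> C_inf_poly" for g x
    using differentiable_compose[of g A] C_inf_poly_differentiable[OF that] A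
    by (auto intro: bounded_linear_imp_differentiable)
  show ?thesis
  proof (rule C_inf_poly_coinduct[where S = "insert (\<lambda>_. 0) ((\<lambda>g x. g (A x)) ` C_inf_poly)"])
    show "(\<lambda>x. \<phi> (A x)) \<in> insert (\<lambda>_. 0) ((\<lambda>g x. g (A x)) ` C_inf_poly)"
      using assms(1) by auto
    fix g assume g_in: "g \<in> insert (\<lambda>_. 0) ((\<lambda>g x. g (A x)) ` C_inf_poly)"
    then show "g differentiable (at x)" for x
      using diff by auto
    show "poly_bounded g"
      using g_in poly_bounded_compose_linear[OF C_inf_poly_bound A] C_inf_poly_bound[OF C_inf_poly_const[of 0]]
      by auto
    fix b :: 'a assume b: "b \<in> Basis"
    show "(\<lambda>x. frechet_derivative g (at x) b) \<in> insert (\<lambda>_. 0) ((\<lambda>g x. g (A x)) ` C_inf_poly)"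
    proof (cases "g = (\<lambda>_. 0)")
      case True
      then show ?thesis by simp
    next
      case False
      then obtain g' where g: "g' \<in> C_inf_poly" "g = (\<lambda>x. g' (A x))"
        using g_in by auto
      have D: "frechet_derivative g (at x) b = frechet_derivative g' (at (A x)) (A b)" for x
        using frechet_derivative_at[OF has_derivative_compose[OF bounded_linear_imp_has_derivative[OF A]
            C_inf_poly_differentiable[OF g(1), unfolded frechet_derivative_works], of x]]
        unfolding g(2) by metis
      show ?thesis
      proof (cases "A b = 0")
        case True
        then have "frechet_derivative g' (at y) (A b) = 0" for y
          using linear_0[OF linear_frechet_derivative[OF C_inf_poly_differentiable[OF g(1)]]] by simp
        then show ?thesis by (simp add: D)
      next
        case False
        then have "A b \<in> Basis" using basis b by auto
        then show ?thesis
          using C_inf_poly_deriv[OF g(1)] by (auto simp: D)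
      qed
    qed
  qed
qed

lemma C_inf_poly_compose_fst: "\<phi> \<in> C_inf_poly \<Longrightarrow> (\<lambda>z. \<phi> (fst z)) \<in> C_inf_poly"
  by (rule C_inf_poly_compose_linear[OF _ bounded_linear_fst]) (auto simp: Basis_prod_def)

lemma C_inf_poly_compose_snd: "\<phi> \<in> C_inf_poly \<Longrightarrow> (\<lambda>z. \<phi> (snd z)) \<in> C_inf_poly"
  by (rule C_inf_poly_compose_linear[OF _ bounded_linear_snd]) (auto simp: Basis_prod_def)

section \<open>Ito isometry for simple integrands\<close>

lemma borel_measurable_matrix_nth [measurable (raw)]:
  fixes H :: "'a \<Rightarrow> real ^ 'm ^ 'd"
  assumes "H \<in> borel_measurable N"
  shows "(\<lambda>\<omega>. H \<omega> $ i $ j) \<in> borel_measurable N"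
  by (rule measurable_compose[OF assms]) (intro borel_measurable_continuous_onI continuous_intros)

lemma borel_measurable_vector_nth [measurable (raw)]:
  fixes H :: "'a \<Rightarrow> real ^ 'm"
  assumes "H \<in> borel_measurable N"
  shows "(\<lambda>\<omega>. H \<omega> $ i) \<in> borel_measurable N"
  by (rule measurable_compose[OF assms]) (intro borel_measurable_continuous_onI continuous_intros)

lemma borel_measurable_matrix_vector_mult [measurable (raw)]:
  fixes H :: "'a \<Rightarrow> real ^ 'm ^ 'd" and V :: "'a \<Rightarrow> real ^ 'm"
  assumes [measurable]: "H \<in> borel_measurable N" "V \<in> borel_measurable N"
  shows "(\<lambda>\<omega>. H \<omega> *v V \<omega>) \<in> borel_measurable N"
  by (subst borel_measurable_euclidean_space)
     (auto simp: Basis_vec_def inner_axis matrix_vector_mult_def)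

lemma power2_norm_matrix: "(norm (A :: real ^ 'm ^ 'd))\<^sup>2 = (\<Sum>i\<in>UNIV. \<Sum>j\<in>UNIV. A $ i $ j * A $ i $ j)"
  by (simp add: power2_norm_eq_inner inner_vec_def)

lemma power2_norm_matrix_vector_mult:
  "(norm ((A :: real ^ 'm ^ 'd) *v v))\<^sup>2 = (\<Sum>i\<in>UNIV. \<Sum>j\<in>UNIV. \<Sum>k\<in>UNIV. (A $ i $ j * A $ i $ k) * (v $ j * v $ k))"
  by (simp add: power2_norm_eq_inner inner_vec_def matrix_vector_mult_def sum_product ac_simps)

lemma inner_matrix_vector_mult:
  "u \<bullet> ((A :: real ^ 'm ^ 'd) *v v) = (\<Sum>i\<in>UNIV. \<Sum>j\<in>UNIV. (u $ i * A $ i $ j) * v $ j)"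
  by (simp add: inner_vec_def matrix_vector_mult_def sum_distrib_left ac_simps)

lemma abs_matrix_nth_le_norm: "\<bar>(A :: real ^ 'm ^ 'd) $ i $ j\<bar> \<le> norm A"
  using component_le_norm_cart[of "A $ i" j] Finite_Cartesian_Product.norm_nth_le[where x=A and i=i] by linarith

locale brownian_setting = prob_space M for M :: "'a measure" +
  fixes F :: "real \<Rightarrow> 'a measure" and W :: "real \<Rightarrow> 'a \<Rightarrow> real ^ 'm"
  assumes brownian_vector: "brownian_vector M W"
    and brownian_filtration: "brownian_filtration M F W"
begin

lemma subalgebra_F: "0 \<le> t \<Longrightarrow> subalgebra M (F t)"
  using brownian_filtration by (auto simp: brownian_filtration_def)

lemma measurable_F_mono:
  assumes "s \<le> t" "U \<in> borel_measurable (F s)"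
  shows "U \<in> borel_measurable (F t)"
proof -
  have fil: "filtration (space M) F"
    using brownian_filtration by (auto simp: brownian_filtration_def)
  show ?thesis
    using assms filtration.sets_F_mono[OF fil, of s t] filtration.space_F[OF fil]
    by (auto simp: measurable_def)
qed

lemma measurable_F_M: "0 \<le> t \<Longrightarrow> U \<in> borel_measurable (F t) \<Longrightarrow> U \<in> borel_measurable M"
  using measurable_from_subalg[OF subalgebra_F] by blast

lemma measurable_W_F: "0 \<le> t \<Longrightarrow> W t \<in> borel_measurable (F t)"
  using brownian_filtration by (auto simp: brownian_filtration_def)

lemma measurable_W [measurable]: "0 \<le> t \<Longrightarrow> W t \<in> borel_measurable M"
  using measurable_W_F measurable_F_M by blast

section \<open>Moments of the Brownian increments and their independence of the past\<close>

lemma distributed_increment: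
  assumes "0 \<le> s" "s < t"
  shows "distributed M lborel (\<lambda>\<omega>. (W t \<omega> - W s \<omega>) $ j) (normal_density 0 (sqrt (t - s)))"
  using brownian_vector assms by (auto simp: brownian_vector_def standard_brownian_motion_def)

lemma integrable_increment_power:
  assumes "0 \<le> s" "s < t"
  shows "integrable M (\<lambda>\<omega>. ((W t \<omega> - W s \<omega>) $ j) ^ k)"
  using distributed_integrable[OF distributed_increment[OF assms], of "\<lambda>x. x ^ k"]
    integrable_normal_moment[of "sqrt (t - s)" 0 k] assms by simp

lemma expectation_increment:
  assumes "0 \<le> s" "s < t"
  shows "expectation (\<lambda>\<omega>. (W t \<omega> - W s \<omega>) $ j) = 0"
  using normal_distributed_expectation[OF _ distributed_increment[OF assms]] assms by simp

lemma indep_increment_components: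
  assumes "0 \<le> s" "s < t"
  shows "indep_vars (\<lambda>_. borel) (\<lambda>j \<omega>. (W t \<omega> - W s \<omega>) $ j) UNIV"
proof -
  have "indep_vars (\<lambda>_. PiM {0..} (\<lambda>_. borel)) (\<lambda>j \<omega>. restrict (\<lambda>t. W t \<omega> $ j) {0..}) UNIV"
    using brownian_vector by (auto simp: brownian_vector_def)
  then have "indep_vars (\<lambda>_. borel) (\<lambda>j \<omega>. restrict (\<lambda>t. W t \<omega> $ j) {0..} t - restrict (\<lambda>t. W t \<omega> $ j) {0..} s) UNIV"
    by (rule indep_vars_compose2[where Y = "\<lambda>j x. x t - x s"]) (use assms in auto)
  then show ?thesis
    using assms by simp
qed

lemma increment_covariance:
  assumes st: "0 \<le> s" "s < t"
  shows "has_bochner_integral M (\<lambda>\<omega>. (W t \<omega> - W s \<omega>) $ j * (W t \<omega> - W s \<omega>) $ k) (if j = k then t - s else 0)"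
proof (cases "j = k")
  case True
  have "expectation (\<lambda>\<omega>. ((W t \<omega> - W s \<omega>) $ j)\<^sup>2) = t - s"
    using normal_distributed_variance[OF _ distributed_increment[OF st], of j] expectation_increment[OF st, of j] st by simp
  then show ?thesis
    using True integrable_increment_power[OF st, of j 2] by (simp add: has_bochner_integral_iff power2_eq_square)
next
  case False
  have indep: "indep_vars (\<lambda>_. borel) (\<lambda>j \<omega>. (W t \<omega> - W s \<omega>) $ j) {j, k}"
    by (rule indep_vars_subset[OF indep_increment_components[OF st]]) auto
  have int: "integrable M (\<lambda>\<omega>. (W t \<omega> - W s \<omega>) $ i)" for i
    using integrable_increment_power[OF st, of i 1] by simp
  show ?thesis
    using indep_vars_integrable[OF _ indep int] indep_vars_lebesgue_integral[OF _ indep int] False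
      expectation_increment[OF st] by (simp add: has_bochner_integral_iff)
qed

text \<open>Independence of \<open>F s\<close> and the increment passes to the smaller
  sigma-algebras generated by \<open>U\<close> and by \<open>g\<close> of the increment, so the
  expectation factorises. The function \<open>g\<close> is kept general for two uses: a coordinate,
  with mean 0, and a product of two coordinates, with the covariance as mean.\<close>

lemma has_bochner_integral_F_mult_increment:
  fixes U :: "'a \<Rightarrow> real"
  assumes st: "0 \<le> s" "s < t" and U: "U \<in> borel_measurable (F s)" "integrable M U"
    and g: "g \<in> borel_measurable borel" "has_bochner_integral M (\<lambda>\<omega>. g (W t \<omega> - W s \<omega>)) c"
  shows "has_bochner_integral M (\<lambda>\<omega>. U \<omega> * g (W t \<omega> - W s \<omega>)) (expectation U * c)"
proof -
  let ?D = "\<lambda>\<omega>. W t \<omega> - W s \<omega>"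
  have [measurable]: "?D \<in> borel_measurable M" "g \<in> borel_measurable borel"
    using st g(1) by auto
  have F: "sigma_algebra (space M) (sets (F s))" "space (F s) = space M"
    using subalgebra_F[OF st(1)] sets.sigma_algebra_axioms[of "F s"] by (auto simp: subalgebra_def)
  have U_sets: "sigma_sets (space M) {U -` A \<inter> space M |A. A \<in> sets borel} \<subseteq> sets (F s)"
    using measurable_sets[OF U(1)] F by (intro sigma_algebra.sigma_sets_subset) auto
  \<comment> \<open>The preimages of Borel sets under the increment already form a sigma-algebra, so
    the independence required of them by \<open>brownian_filtration\<close> is that of the generated
    sigma-algebra.\<close>
  have D_sets: "sigma_sets (space M) {?D -` A \<inter> space M |A. A \<in> sets borel} = {?D -` A \<inter> space M |A. A \<in> sets borel}"
    using sets_vimage_algebra[of "space M" ?D borel] sets_vimage_algebra2[of ?D "space M" borel] by simp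
  let ?V = "\<lambda>\<omega>. g (?D \<omega>)"
  have "{?V -` A \<inter> space M |A. A \<in> sets borel} \<subseteq> {?D -` A \<inter> space M |A. A \<in> sets borel}"
  proof safe
    fix A :: "real set" assume "A \<in> sets borel"
    then have "g -` A \<in> sets borel"
      using measurable_sets[OF g(1)] by simp
    then show "\<exists>A'. ?V -` A \<inter> space M = ?D -` A' \<inter> space M \<and> A' \<in> sets borel"
      by (intro exI[of _ "g -` A"]) auto
  qed
  then have V_sets: "sigma_sets (space M) {?V -` A \<inter> space M |A. A \<in> sets borel} \<subseteq> {?D -` A \<inter> space M |A. A \<in> sets borel}"
    by (rule order_trans[OF sigma_sets_mono' eq_refl[OF D_sets]])
  have "indep_set (sets (F s)) {?D -` A \<inter> space M |A. A \<in> sets borel}"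
    using brownian_filtration st by (auto simp: brownian_filtration_def)
  then have "indep_set (sigma_sets (space M) {U -` A \<inter> space M |A. A \<in> sets borel})
      (sigma_sets (space M) {?V -` A \<inter> space M |A. A \<in> sets borel})"
    unfolding indep_set_def
    by (rule indep_sets_mono_sets) (simp add: U_sets V_sets split: bool.split)
  then have "indep_var borel U borel ?V"
    unfolding indep_var_eq using measurable_F_M[OF st(1) U(1)] by simp
  then show ?thesis
    using indep_var_lebesgue_integral[of U "\<lambda>\<omega>. g (?D \<omega>)"] indep_var_integrable[of U "\<lambda>\<omega>. g (?D \<omega>)"] U(2) g(2)
    by (simp add: has_bochner_integral_iff)
qed

text \<open>Expand the square. In the cross term every summand is a factor known at time
  \<open>s\<close> times an increment of mean 0. In the quadratic term the covariance keeps only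
  \<open>j = k\<close>, and what remains is \<open>t - s\<close> times the squared Frobenius norm.
  Boundedness of \<open>\<eta>\<close> makes all these products integrable.\<close>

lemma one_step_isometry:
  fixes \<eta> :: "'a \<Rightarrow> real ^ 'm ^ 'd" and S :: "'a \<Rightarrow> real ^ 'd"
  assumes st: "0 \<le> s" "s < t"
    and S [measurable]: "S \<in> borel_measurable (F s)" and S2: "integrable M (\<lambda>\<omega>. (norm (S \<omega>))\<^sup>2)"
    and \<eta> [measurable]: "\<eta> \<in> borel_measurable (F s)" and bdd: "bounded (\<eta> ` space M)"
  shows "has_bochner_integral M (\<lambda>\<omega>. (norm (S \<omega> + \<eta> \<omega> *v (W t \<omega> - W s \<omega>)))\<^sup>2)
    ((LINT \<omega>|M. (norm (S \<omega>))\<^sup>2) + (t - s) * (LINT \<omega>|M. (norm (\<eta> \<omega>))\<^sup>2))"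
proof -
  let ?D = "\<lambda>\<omega>. W t \<omega> - W s \<omega>"
  have S_M [measurable]: "S \<in> borel_measurable M" and \<eta>_M [measurable]: "\<eta> \<in> borel_measurable M"
    using S \<eta> st(1) measurable_F_M by blast+
  obtain K where K: "0 < K" "\<And>\<omega>. \<omega> \<in> space M \<Longrightarrow> norm (\<eta> \<omega>) \<le> K"
    using bdd by (auto simp: bounded_pos)
  have \<eta>_nth: "\<bar>\<eta> \<omega> $ i $ j\<bar> \<le> K" if "\<omega> \<in> space M" for \<omega> i j
    using K(2)[OF that] abs_matrix_nth_le_norm[of "\<eta> \<omega>" i j] by linarith
  have int_\<eta>\<eta>: "integrable M (\<lambda>\<omega>. \<eta> \<omega> $ i $ j * \<eta> \<omega> $ i $ k)" for i j k
    by (rule integrable_const_bound[where B = "K * K"])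
       (use K(1) in \<open>auto simp: abs_mult intro!: AE_I2 mult_mono \<eta>_nth\<close>)
  have int_S: "integrable M (\<lambda>\<omega>. S \<omega> $ i)" for i
  proof -
    have "integrable M (\<lambda>\<omega>. (S \<omega> $ i)\<^sup>2)"
      by (rule Bochner_Integration.integrable_bound[OF S2])
         (auto simp: component_le_norm_cart intro!: AE_I2 power_mono abs_le_square_iff[THEN iffD1])
    then show ?thesis
      by (rule square_integrable_imp_integrable[rotated]) simp
  qed
  have int_S\<eta>: "integrable M (\<lambda>\<omega>. S \<omega> $ i * \<eta> \<omega> $ i $ j)" for i j
  proof (rule Bochner_Integration.integrable_bound)
    show "integrable M (\<lambda>\<omega>. K * (S \<omega> $ i))"
      using int_S by simp
    show "AE \<omega> in M. norm (S \<omega> $ i * \<eta> \<omega> $ i $ j) \<le> norm (K * (S \<omega> $ i))"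
      by (rule AE_I2) (use K(1) in \<open>simp add: abs_mult mult.commute[of K] mult_left_mono \<eta>_nth\<close>)
  qed simp
  have "has_bochner_integral M (\<lambda>\<omega>. S \<omega> \<bullet> (\<eta> \<omega> *v ?D \<omega>)) (\<Sum>i\<in>UNIV. \<Sum>j\<in>UNIV. expectation (\<lambda>\<omega>. S \<omega> $ i * \<eta> \<omega> $ i $ j) * 0)"
    unfolding inner_matrix_vector_mult
  proof (intro has_bochner_integral_sum has_bochner_integral_F_mult_increment[OF st, where g = "\<lambda>x. x $ _"] int_S\<eta>)
    show "has_bochner_integral M (\<lambda>\<omega>. ?D \<omega> $ j) 0" for j
      using integrable_increment_power[OF st, of j 1] expectation_increment[OF st, of j]
      by (simp add: has_bochner_integral_iff)
  qed auto
  then have cross: "has_bochner_integral M (\<lambda>\<omega>. S \<omega> \<bullet> (\<eta> \<omega> *v ?D \<omega>)) 0"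
    by simp
  have "has_bochner_integral M (\<lambda>\<omega>. (norm (\<eta> \<omega> *v ?D \<omega>))\<^sup>2) (\<Sum>i\<in>UNIV. \<Sum>j\<in>UNIV. \<Sum>k\<in>UNIV.
     expectation (\<lambda>\<omega>. \<eta> \<omega> $ i $ j * \<eta> \<omega> $ i $ k) * (if j = k then t - s else 0))"
    unfolding power2_norm_matrix_vector_mult
    by (intro has_bochner_integral_sum has_bochner_integral_F_mult_increment[OF st, where g = "\<lambda>x. x $ _ * x $ _"]
        int_\<eta>\<eta> increment_covariance[OF st]) auto
  also have "(\<Sum>i\<in>UNIV. \<Sum>j\<in>UNIV. \<Sum>k\<in>UNIV.
     expectation (\<lambda>\<omega>. \<eta> \<omega> $ i $ j * \<eta> \<omega> $ i $ k) * (if j = k then t - s else 0)) = (t - s) * (LINT \<omega>|M. (norm (\<eta> \<omega>))\<^sup>2)"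
    unfolding power2_norm_matrix
    by (simp add: Bochner_Integration.integral_sum int_\<eta>\<eta> sum_distrib_left mult.commute if_distrib sum.delta' cong: if_cong)
  finally have "has_bochner_integral M (\<lambda>\<omega>. (norm (S \<omega>))\<^sup>2 + (2 * (S \<omega> \<bullet> (\<eta> \<omega> *v ?D \<omega>)) + (norm (\<eta> \<omega> *v ?D \<omega>))\<^sup>2))
      ((LINT \<omega>|M. (norm (S \<omega>))\<^sup>2) + (2 * 0 + (t - s) * (LINT \<omega>|M. (norm (\<eta> \<omega>))\<^sup>2)))"
    by (intro has_bochner_integral_add has_bochner_integral_mult_right cross)
       (use S2 in \<open>auto simp: has_bochner_integral_iff\<close>)
  then show ?thesis
    by (simp add: power2_norm_eq_inner inner_add_left inner_add_right inner_commute algebra_simps)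
qed

text \<open>Induction on the number of intervals, with the integral so far in the role of
  \<open>S\<close> in the one-step isometry. Its measurability at time \<open>p n\<close> and
  \<open>0 \<le> p n\<close> belong to the claim because the next step relies on them.\<close>

lemma simple_integral_isometry:
  fixes \<xi> :: "nat \<Rightarrow> 'a \<Rightarrow> real ^ 'm ^ 'd"
  assumes "0 \<le> p 0" "\<And>i. i < n \<Longrightarrow> p i < p (Suc i)"
    and "\<And>i. i < n \<Longrightarrow> \<xi> i \<in> borel_measurable (F (p i))" "\<And>i. i < n \<Longrightarrow> bounded (\<xi> i ` space M)"
  shows "simple_integral W n p \<xi> \<in> borel_measurable (F (p n)) \<and> 0 \<le> p n \<and>
    has_bochner_integral M (\<lambda>\<omega>. (norm (simple_integral W n p \<xi> \<omega>))\<^sup>2) (\<Sum>i<n. (p (Suc i) - p i) * (LINT \<omega>|M. (norm (\<xi> i \<omega>))\<^sup>2))"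
  using assms
proof (induction n)
  case 0
  then show ?case by (simp add: simple_integral_def has_bochner_integral_zero)
next
  case (Suc n)
  have IH: "simple_integral W n p \<xi> \<in> borel_measurable (F (p n))" "0 \<le> p n"
    "has_bochner_integral M (\<lambda>\<omega>. (norm (simple_integral W n p \<xi> \<omega>))\<^sup>2) (\<Sum>i<n. (p (Suc i) - p i) * (LINT \<omega>|M. (norm (\<xi> i \<omega>))\<^sup>2))"
    using Suc by auto
  have lt: "p n < p (Suc n)"
    using Suc.prems(2) by simp
  have eq: "simple_integral W (Suc n) p \<xi> = (\<lambda>\<omega>. simple_integral W n p \<xi> \<omega> + \<xi> n \<omega> *v (W (p (Suc n)) \<omega> - W (p n) \<omega>))"
    by (simp add: simple_integral_def fun_eq_iff)
  have [measurable]: "simple_integral W n p \<xi> \<in> borel_measurable (F (p (Suc n)))" "\<xi> n \<in> borel_measurable (F (p (Suc n)))"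
    "W (p (Suc n)) \<in> borel_measurable (F (p (Suc n)))" "W (p n) \<in> borel_measurable (F (p (Suc n)))"
    using measurable_F_mono[OF less_imp_le[OF lt]] IH Suc.prems(3) measurable_W_F lt by auto
  have "simple_integral W (Suc n) p \<xi> \<in> borel_measurable (F (p (Suc n)))"
    unfolding eq by measurable
  moreover have "has_bochner_integral M (\<lambda>\<omega>. (norm (simple_integral W (Suc n) p \<xi> \<omega>))\<^sup>2)
      (\<Sum>i<Suc n. (p (Suc i) - p i) * (LINT \<omega>|M. (norm (\<xi> i \<omega>))\<^sup>2))"
    using one_step_isometry[OF IH(2) lt IH(1), of "\<xi> n"] IH(3) Suc.prems(3,4)[of n]
    by (simp add: eq has_bochner_integral_iff)
  ultimately show ?case
    using IH lt by simp
qed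

text \<open>Truncating the integrand as soon as its accumulated energy reaches the level \<open>c\<close> keeps it adapted,
  because the value on \<open>(p i, p (i + 1)]\<close> is already known at time \<open>p i\<close>.\<close>

lemma simple_integral_truncated:
  fixes \<xi> :: "nat \<Rightarrow> 'a \<Rightarrow> real ^ 'm ^ 'd" and p :: "nat \<Rightarrow> real"
  defines "E k \<omega> \<equiv> \<Sum>i<k. (p (Suc i) - p i) * (norm (\<xi> i \<omega>))\<^sup>2"
  assumes p: "0 \<le> p 0" "\<And>i. i < n \<Longrightarrow> p i < p (Suc i)"
    and \<xi>: "\<And>i. i < n \<Longrightarrow> \<xi> i \<in> borel_measurable (F (p i))" and bdd: "\<And>i. i < n \<Longrightarrow> bounded (\<xi> i ` space M)"
    and "0 < c"
  shows "(\<integral>\<^sup>+\<omega>. ennreal ((norm (simple_integral W n p \<xi> \<omega>))\<^sup>2) * indicator {\<omega>. E n \<omega> < c} \<omega> \<partial>M)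
    \<le> (\<integral>\<^sup>+\<omega>. ennreal (min c (E n \<omega>)) \<partial>M)"
proof -
  have p_mono: "p i \<le> p j" if "i \<le> j" "j \<le> n" for i j
    using that
  proof (induction j rule: dec_induct)
    case (step j)
    then show ?case using p(2)[of j] by simp
  qed simp
  have p_diff: "0 \<le> p (Suc i) - p i" if "i < n" for i
    using p(2)[OF that] by simp
  have E_mono: "E j \<omega> \<le> E k \<omega>" if "j \<le> k" "k \<le> n" for j k \<omega>
    unfolding E_def using that by (intro sum_mono2) (auto intro!: mult_nonneg_nonneg p_diff)
  \<comment> \<open>The test uses \<open>E (Suc i)\<close>, which includes the current interval, so
    the energy that is kept never overshoots \<open>c\<close>.\<close>
  define \<eta> where "\<eta> i \<omega> = (if E (Suc i) \<omega> < c then \<xi> i \<omega> else 0)" for i \<omega>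
  have [measurable]: "\<xi> j \<in> borel_measurable (F (p i))" if "j \<le> i" "i < n" for i j
    using that \<xi>[of j] measurable_F_mono[OF p_mono[of j i]] by simp
  have E_meas: "E (Suc i) \<in> borel_measurable (F (p i))" if "i < n" for i
    unfolding E_def using that by measurable
  have \<eta>_meas: "\<eta> i \<in> borel_measurable (F (p i))" if "i < n" for i
    unfolding \<eta>_def using that E_meas[OF that] \<xi>[OF that] by measurable
  have \<eta>_bdd: "bounded (\<eta> i ` space M)" if "i < n" for i
    using bdd[OF that] bounded_subset[of "insert 0 (\<xi> i ` space M)" "\<eta> i ` space M"] by (auto simp: \<eta>_def)
  have iso: "has_bochner_integral M (\<lambda>\<omega>. (norm (simple_integral W n p \<eta> \<omega>))\<^sup>2) (\<Sum>i<n. (p (Suc i) - p i) * (LINT \<omega>|M. (norm (\<eta> i \<omega>))\<^sup>2))"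
    using simple_integral_isometry[of p n \<eta>] p \<eta>_meas \<eta>_bdd by auto
  have p_nonneg: "0 \<le> p i" if "i \<le> n" for i
    using p_mono[of 0 i] p(1) that by simp
  have int_\<eta>: "integrable M (\<lambda>\<omega>. (norm (\<eta> i \<omega>))\<^sup>2)" if i: "i < n" for i
  proof -
    obtain K where K: "\<And>\<omega>. \<omega> \<in> space M \<Longrightarrow> norm (\<eta> i \<omega>) \<le> K"
      using \<eta>_bdd[OF i] by (auto simp: bounded_iff)
    have [measurable]: "\<eta> i \<in> borel_measurable M"
      using measurable_F_M[OF p_nonneg \<eta>_meas] i by simp
    show ?thesis
      by (rule integrable_const_bound[where B = "K\<^sup>2"]) (auto intro!: AE_I2 power_mono K)
  qed
  \<comment> \<open>If interval \<open>k\<close> is kept, the new sum is at most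
    \<open>E (Suc k) \<omega>\<close>, which is below \<open>c\<close>; if it is dropped, the left
    side stays the same and the right side does not decrease.\<close>
  have energy: "(\<Sum>i<k. (p (Suc i) - p i) * (norm (\<eta> i \<omega>))\<^sup>2) \<le> min c (E k \<omega>)" if "k \<le> n" for k \<omega>
    using that
  proof (induction k)
    case (Suc k)
    have le: "E k \<omega> \<le> E (Suc k) \<omega>" using E_mono Suc.prems by simp
    have E_Suc: "E (Suc k) \<omega> = E k \<omega> + (p (Suc k) - p k) * (norm (\<xi> k \<omega>))\<^sup>2" by (simp add: E_def)
    show ?case
      using Suc le E_Suc by (auto simp: \<eta>_def)
  qed (use \<open>0 < c\<close> in \<open>simp add: E_def\<close>)
  have "(\<integral>\<^sup>+\<omega>. ennreal ((norm (simple_integral W n p \<xi> \<omega>))\<^sup>2) * indicator {\<omega>. E n \<omega> < c} \<omega> \<partial>M)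
      \<le> (\<integral>\<^sup>+\<omega>. ennreal ((norm (simple_integral W n p \<eta> \<omega>))\<^sup>2) \<partial>M)"
  proof (intro nn_integral_mono)
    fix \<omega>
    \<comment> \<open>\<open>E\<close> is nondecreasing in its index, so on this event no interval
      has been dropped.\<close>
    have "simple_integral W n p \<eta> \<omega> = simple_integral W n p \<xi> \<omega>" if "E n \<omega> < c"
      unfolding simple_integral_def \<eta>_def using E_mono[of "Suc _" n \<omega>] that by (intro sum.cong) (auto simp: Suc_le_eq dest: order_le_less_trans)
    then show "ennreal ((norm (simple_integral W n p \<xi> \<omega>))\<^sup>2) * indicator {\<omega>. E n \<omega> < c} \<omega>
        \<le> ennreal ((norm (simple_integral W n p \<eta> \<omega>))\<^sup>2)"
      by (auto simp: indicator_def)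
  qed
  also have "\<dots> = ennreal (\<Sum>i<n. (p (Suc i) - p i) * (LINT \<omega>|M. (norm (\<eta> i \<omega>))\<^sup>2))"
    using iso by (subst nn_integral_eq_integral) (auto simp: has_bochner_integral_iff)
  also have "\<dots> = ennreal (LINT \<omega>|M. (\<Sum>i<n. (p (Suc i) - p i) * (norm (\<eta> i \<omega>))\<^sup>2))"
    using int_\<eta> by (subst Bochner_Integration.integral_sum) auto
  also have "\<dots> = (\<integral>\<^sup>+\<omega>. ennreal (\<Sum>i<n. (p (Suc i) - p i) * (norm (\<eta> i \<omega>))\<^sup>2) \<partial>M)"
    using int_\<eta> by (subst nn_integral_eq_integral) (auto intro!: sum_nonneg mult_nonneg_nonneg p_diff)
  also have "\<dots> \<le> (\<integral>\<^sup>+\<omega>. ennreal (min c (E n \<omega>)) \<partial>M)"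
    using energy by (intro nn_integral_mono ennreal_leI) auto
  finally show ?thesis .
qed

end

section \<open>Approximation by simple integrands\<close>

text \<open>The distances cut off at 1 tend to 0 in mean, and convergence in mean yields an almost
  surely convergent subsequence. Along it the cut-off is eventually inactive.\<close>

lemma (in prob_space) tendsto_in_prob_AE_subseq:
  fixes V :: "nat \<Rightarrow> 'a \<Rightarrow> 'v :: {real_normed_vector, second_countable_topology}"
  assumes [measurable]: "\<And>k. V k \<in> borel_measurable M" "V' \<in> borel_measurable M"
    and lim: "tendsto_in_prob M V V'"
  obtains r :: "nat \<Rightarrow> nat" where "strict_mono r" "AE \<omega> in M. (\<lambda>k. V (r k) \<omega>) \<longlonglongrightarrow> V' \<omega>"
proof -
  define u where "u k \<omega> = min 1 (norm (V k \<omega> - V' \<omega>))" for k \<omega>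
  have [measurable]: "u k \<in> borel_measurable M" for k
    unfolding u_def by measurable
  have u_bounds: "0 \<le> u k \<omega>" "u k \<omega> \<le> 1" for k \<omega>
    by (auto simp: u_def)
  have int_u: "integrable M (u k)" for k
    using u_bounds by (intro integrable_const_bound[where B = 1]) auto
  have "(\<lambda>k. expectation (\<lambda>\<omega>. norm (u k \<omega>))) \<longlonglongrightarrow> 0"
  proof (rule LIMSEQ_I)
    fix \<epsilon> :: real assume "0 < \<epsilon>"
    then have "(\<lambda>k. prob {\<omega> \<in> space M. \<epsilon> / 2 < norm (V k \<omega> - V' \<omega>)}) \<longlonglongrightarrow> 0"
      using lim[unfolded tendsto_in_prob_def, rule_format, of "\<epsilon> / 2"] by simp
    then have "\<forall>\<^sub>F k in sequentially. prob {\<omega> \<in> space M. \<epsilon> / 2 < norm (V k \<omega> - V' \<omega>)} < \<epsilon> / 2"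
      using \<open>0 < \<epsilon>\<close> by (intro order_tendstoD(2)) auto
    then obtain n where n: "\<And>k. n \<le> k \<Longrightarrow> prob {\<omega> \<in> space M. \<epsilon> / 2 < norm (V k \<omega> - V' \<omega>)} < \<epsilon> / 2"
      by (auto simp: eventually_sequentially)
    have "norm (expectation (\<lambda>\<omega>. norm (u k \<omega>)) - 0) < \<epsilon>" if "n \<le> k" for k
    proof -
      let ?A = "{\<omega> \<in> space M. \<epsilon> / 2 < norm (V k \<omega> - V' \<omega>)}"
      \<comment> \<open>The cut-off distance is at most \<open>\<epsilon> / 2\<close> outside
        \<open>?A\<close> and at most 1 on \<open>?A\<close>, an event of probability below
        \<open>\<epsilon> / 2\<close>.\<close>
      have "expectation (\<lambda>\<omega>. norm (u k \<omega>)) \<le> expectation (\<lambda>\<omega>. \<epsilon> / 2 + indicator ?A \<omega>)"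
      proof (rule integral_mono)
        show "integrable M (\<lambda>\<omega>. norm (u k \<omega>))"
          using int_u by simp
        show "integrable M (\<lambda>\<omega>. \<epsilon> / 2 + indicator ?A \<omega>)"
          by (intro Bochner_Integration.integrable_add integrable_real_indicator) (auto simp: emeasure_finite less_top[symmetric])
        show "norm (u k \<omega>) \<le> \<epsilon> / 2 + indicator ?A \<omega>" if "\<omega> \<in> space M" for \<omega>
          using \<open>0 < \<epsilon>\<close> that by (auto simp: u_def indicator_def)
      qed
      also have "\<dots> = \<epsilon> / 2 + prob ?A"
        by (subst Bochner_Integration.integral_add) (auto simp: prob_space less_top[symmetric] intro!: integrable_real_indicator)
      finally show ?thesis
        using n[OF that] u_bounds by simp
    qed
    then show "\<exists>n. \<forall>k\<ge>n. norm (expectation (\<lambda>\<omega>. norm (u k \<omega>)) - 0) < \<epsilon>" by blast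
  qed
  then obtain r :: "nat \<Rightarrow> nat" where r: "strict_mono r" "AE \<omega> in M. (\<lambda>k. u (r k) \<omega>) \<longlonglongrightarrow> 0"
    using tendsto_L1_AE_subseq[of M u] int_u by auto
  have "AE \<omega> in M. (\<lambda>k. V (r k) \<omega>) \<longlonglongrightarrow> V' \<omega>"
    using r(2)
  proof eventually_elim
    case (elim \<omega>)
    have "\<forall>\<^sub>F k in sequentially. u (r k) \<omega> < 1"
      using order_tendstoD(2)[OF elim, of 1] by simp
    then have "\<forall>\<^sub>F k in sequentially. u (r k) \<omega> = norm (V (r k) \<omega> - V' \<omega>)"
      by eventually_elim (auto simp: u_def)
    then have "(\<lambda>k. norm (V (r k) \<omega> - V' \<omega>)) \<longlonglongrightarrow> 0"
      using elim tendsto_cong by fast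
    then show ?case
      by (rule LIM_zero_cancel[OF tendsto_norm_zero_cancel])
  qed
  with r(1) show thesis
    by (rule that)
qed

lemma tendsto_in_prob_subseq:
  "tendsto_in_prob M V V' \<Longrightarrow> strict_mono r \<Longrightarrow> tendsto_in_prob M (\<lambda>k. V (r k)) V'"
  unfolding tendsto_in_prob_def using LIMSEQ_subseq_LIMSEQ[of _ 0 r, unfolded comp_def] by blast

section \<open>Common refinements of partitions\<close>

lemma telescope_partition:
  fixes g :: "real \<Rightarrow> 'v::ab_group_add" and p :: "nat \<Rightarrow> real"
  assumes p: "\<And>i j. i < j \<Longrightarrow> j \<le> m \<Longrightarrow> p i < p j" and ab: "a \<le> b" "b \<le> m"
  shows "(\<Sum>j<m. if p a < p (Suc j) \<and> p (Suc j) \<le> p b then g (p (Suc j)) - g (p j) else 0) = g (p b) - g (p a)"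
proof -
  have less_iff: "p i < p j \<longleftrightarrow> i < j" if "i \<le> m" "j \<le> m" for i j
    using p[of i j] p[of j i] that by (metis linorder_neqE_nat order_less_asym order_less_irrefl)
  have "(\<Sum>j<m. if p a < p (Suc j) \<and> p (Suc j) \<le> p b then g (p (Suc j)) - g (p j) else 0)
      = (\<Sum>j\<in>{..<m} \<inter> {j. p a < p (Suc j) \<and> p (Suc j) \<le> p b}. g (p (Suc j)) - g (p j))"
    by (simp add: sum.inter_restrict)
  also have "{..<m} \<inter> {j. p a < p (Suc j) \<and> p (Suc j) \<le> p b} = {a..<b}"
    using less_iff ab by (auto simp: not_less[symmetric] Suc_le_eq)
  also have "(\<Sum>j\<in>{a..<b}. g (p (Suc j)) - g (p j)) = g (p b) - g (p a)"
    using ab(1) by (rule sum_Suc_diff')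
  finally show ?thesis .
qed

text \<open>Each coarse increment is the telescoping sum of its fine increments. The bilinear map is
  left open so that the same computation serves the integral, with the matrix-vector product and
  \<open>g\<close> a path of \<open>W\<close>, and the process itself at time \<open>s\<close>, with
  scalar multiplication and \<open>g\<close> the indicator of \<open>{s..}\<close>, whose increment
  over an interval is the indicator of that interval at \<open>s\<close>.\<close>

lemma sum_refine_partition:
  fixes b :: "'x::real_normed_vector \<Rightarrow> 'y::real_normed_vector \<Rightarrow> 'z::real_normed_vector" and p \<tau> :: "nat \<Rightarrow> real"
  assumes b: "bounded_bilinear b"
    and p: "\<And>i j. i < j \<Longrightarrow> j \<le> m \<Longrightarrow> p i < p j"
    and \<tau>: "\<And>i. i < n \<Longrightarrow> \<tau> i < \<tau> (Suc i)" and sub: "\<tau> ` {..n} \<subseteq> p ` {..m}"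
  shows "(\<Sum>j<m. b (\<Sum>i<n. indicator {\<tau> i <.. \<tau> (Suc i)} (p (Suc j)) *\<^sub>R \<xi> i) (g (p (Suc j)) - g (p j)))
    = (\<Sum>i<n. b (\<xi> i) (g (\<tau> (Suc i)) - g (\<tau> i)))"
proof -
  interpret bounded_bilinear b by fact
  have "(\<Sum>j<m. b (\<Sum>i<n. indicator {\<tau> i <.. \<tau> (Suc i)} (p (Suc j)) *\<^sub>R \<xi> i) (g (p (Suc j)) - g (p j)))
    = (\<Sum>j<m. \<Sum>i<n. b (\<xi> i) (if \<tau> i < p (Suc j) \<and> p (Suc j) \<le> \<tau> (Suc i) then g (p (Suc j)) - g (p j) else 0))"
    by (intro sum.cong refl) (auto simp: sum_left indicator_def scaleR_left zero_right zero_left intro!: sum.cong)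
  also have "\<dots> = (\<Sum>i<n. b (\<xi> i) (\<Sum>j<m. if \<tau> i < p (Suc j) \<and> p (Suc j) \<le> \<tau> (Suc i) then g (p (Suc j)) - g (p j) else 0))"
    unfolding sum_right by (rule sum.swap)
  also have "\<dots> = (\<Sum>i<n. b (\<xi> i) (g (\<tau> (Suc i)) - g (\<tau> i)))"
  proof (intro sum.cong refl)
    fix i assume "i \<in> {..<n}"
    then have i: "i < n" "\<tau> i \<in> p ` {..m}" "\<tau> (Suc i) \<in> p ` {..m}"
      using sub by auto
    then obtain a c where ac: "a \<le> m" "c \<le> m" "\<tau> i = p a" "\<tau> (Suc i) = p c"
      by auto
    have "a \<le> c"
      using \<tau>[OF i(1)] p[of c a] ac by (metis leI order_less_asym)
    then show "b (\<xi> i) (\<Sum>j<m. if \<tau> i < p (Suc j) \<and> p (Suc j) \<le> \<tau> (Suc i) then g (p (Suc j)) - g (p j) else 0)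
        = b (\<xi> i) (g (\<tau> (Suc i)) - g (\<tau> i))"
      unfolding ac using telescope_partition[of m p a c g] p ac by simp
  qed
  finally show ?thesis .
qed

lemma indicator_Ioc_eq_diff:
  fixes u v s :: real
  shows "u \<le> v \<Longrightarrow> (indicator {u<..v} s :: real) = indicator {s..} v - indicator {s..} u"
  by (auto simp: indicator_def)

lemma bounded_bilinear_matrix_vector_mult: "bounded_bilinear ((*v) :: real ^ 'm ^ 'd \<Rightarrow> real ^ 'm \<Rightarrow> real ^ 'd)"
proof
  show "\<exists>K. \<forall>A v. norm ((A :: real ^ 'm ^ 'd) *v v) \<le> norm A * norm v * K"
  proof (intro exI[of _ "real CARD('d) * real CARD('m)"] allI)
    fix A :: "real ^ 'm ^ 'd" and v :: "real ^ 'm"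
    have "norm (A *v v) \<le> (\<Sum>i\<in>UNIV. \<bar>(A *v v) $ i\<bar>)"
      by (rule norm_le_l1_cart)
    also have "\<dots> \<le> (\<Sum>i\<in>(UNIV::'d set). \<Sum>j\<in>(UNIV::'m set). norm A * norm v)"
    proof (intro sum_mono)
      fix i
      have "\<bar>(A *v v) $ i\<bar> \<le> (\<Sum>j\<in>UNIV. \<bar>A $ i $ j * v $ j\<bar>)"
        by (simp add: matrix_vector_mult_def sum_abs)
      also have "\<dots> \<le> (\<Sum>j\<in>(UNIV::'m set). norm A * norm v)"
        by (intro sum_mono) (auto simp: abs_mult intro!: mult_mono abs_matrix_nth_le_norm component_le_norm_cart)
      finally show "\<bar>(A *v v) $ i\<bar> \<le> (\<Sum>j\<in>(UNIV::'m set). norm A * norm v)" .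
    qed
    finally show "norm (A *v v) \<le> norm A * norm v * (real CARD('d) * real CARD('m))"
      by (simp add: ac_simps)
  qed
qed (auto simp: matrix_vector_mult_add_rdistrib matrix_vector_right_distrib matrix_vector_mult_scaleR scaleR_matrix_vector_assoc)

context brownian_setting
begin

lemma simple_integrand_partition_mono:
  assumes "simple_integrand M F t n \<tau> \<xi>" "i \<le> j" "j \<le> n"
  shows "\<tau> i \<le> \<tau> j"
  using assms(2,3)
proof (induction j rule: dec_induct)
  case (step j)
  then have "\<tau> j < \<tau> (Suc j)"
    using assms(1) by (simp add: simple_integrand_def)
  with step show ?case by simp
qed simp

text \<open>The intervals of a simple process are left-open and right-closed. Its value on a cell of
  the finer partition is therefore its value at the right endpoint \<open>p (Suc j)\<close>.\<close>

lemma simple_integrand_refine: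
  fixes \<xi> :: "nat \<Rightarrow> 'a \<Rightarrow> real ^ 'm ^ 'd"
  assumes si: "simple_integrand M F t n \<tau> \<xi>"
    and p: "\<And>i j. i < j \<Longrightarrow> j \<le> m \<Longrightarrow> p i < p j" "p 0 = 0" "p m = t" and sub: "\<tau> ` {..n} \<subseteq> p ` {..m}"
  defines "\<zeta> j \<omega> \<equiv> simple_process n \<tau> \<xi> (p (Suc j)) \<omega>"
  shows "simple_integrand M F t m p \<zeta>"
    and "simple_process m p \<zeta> = simple_process n \<tau> \<xi>"
    and "simple_integral W m p \<zeta> = simple_integral W n \<tau> \<xi>"
proof -
  have \<tau>: "\<tau> i < \<tau> (Suc i)" "\<xi> i \<in> borel_measurable (F (\<tau> i))" "bounded (\<xi> i ` space M)" if "i < n" for i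
    using si that by (auto simp: simple_integrand_def)
  have p_mono: "p i \<le> p j" if "i \<le> j" "j \<le> m" for i j
    using p(1)[of i j] that by (cases "i = j") auto
  have meas: "\<zeta> j \<in> borel_measurable (F (p j))" if "j < m" for j
  proof -
    have "(\<lambda>\<omega>. indicator {\<tau> i <.. \<tau> (Suc i)} (p (Suc j)) *\<^sub>R \<xi> i \<omega>) \<in> borel_measurable (F (p j))" if "i < n" for i
    proof (cases "\<tau> i < p (Suc j)")
      case True
      \<comment> \<open>\<open>\<tau> i\<close> is a point of the finer partition before
        \<open>p (Suc j)\<close>, hence at most \<open>p j\<close>. So the value read off at the
        right endpoint of the cell is known at the left one.\<close>
      obtain a where a: "a \<le> m" "\<tau> i = p a"
        using sub \<open>i < n\<close> by (auto dest!: subsetD[of _ _ "\<tau> i"])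
      have "a < Suc j"
      proof (rule ccontr)
        assume "\<not> a < Suc j"
        then have "p (Suc j) \<le> p a" using p_mono a by simp
        with True a(2) show False by simp
      qed
      then have "\<tau> i \<le> p j"
        using p_mono[of a j] a \<open>j < m\<close> by simp
      then have [measurable]: "\<xi> i \<in> borel_measurable (F (p j))"
        using measurable_F_mono \<tau>(2)[OF \<open>i < n\<close>] by blast
      show ?thesis by measurable
    qed simp
    then show ?thesis
      unfolding \<zeta>_def simple_process_def by (intro borel_measurable_sum) auto
  qed
  have bdd: "bounded (\<zeta> j ` space M)" for j
  proof -
    have "\<exists>K. \<forall>\<omega>\<in>space M. norm (\<xi> i \<omega>) \<le> K" if "i < n" for i
      using \<tau>(3)[OF that] by (auto simp: bounded_iff)
    then obtain K where K: "\<And>i \<omega>. i < n \<Longrightarrow> \<omega> \<in> space M \<Longrightarrow> norm (\<xi> i \<omega>) \<le> K i"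
      by metis
    have "norm (\<zeta> j \<omega>) \<le> (\<Sum>i<n. K i)" if "\<omega> \<in> space M" for \<omega>
      unfolding \<zeta>_def simple_process_def
    proof (rule order_trans[OF norm_sum], intro sum_mono)
      fix i assume "i \<in> {..<n}"
      then show "norm (indicator {\<tau> i<..\<tau> (Suc i)} (p (Suc j)) *\<^sub>R \<xi> i \<omega>) \<le> K i"
        using K[of i \<omega>] that norm_ge_zero[of "\<xi> i \<omega>"] by (auto simp: indicator_def simp del: norm_ge_zero)
    qed
    then show ?thesis
      by (auto simp: bounded_iff)
  qed
  show "simple_integrand M F t m p \<zeta>"
    using p meas bdd by (auto simp: simple_integrand_def)
  show "simple_process m p \<zeta> = simple_process n \<tau> \<xi>"
  proof (intro ext)
    fix s \<omega>
    have "simple_process m p \<zeta> s \<omega> = (\<Sum>j<m. (indicator {s..} (p (Suc j)) - indicator {s..} (p j)) *\<^sub>R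
        (\<Sum>i<n. indicator {\<tau> i <.. \<tau> (Suc i)} (p (Suc j)) *\<^sub>R \<xi> i \<omega>))"
      unfolding simple_process_def \<zeta>_def using p(1) by (intro sum.cong refl) (simp add: indicator_Ioc_eq_diff less_imp_le)
    also have "\<dots> = (\<Sum>i<n. (indicator {s..} (\<tau> (Suc i)) - indicator {s..} (\<tau> i)) *\<^sub>R \<xi> i \<omega>)"
      by (rule sum_refine_partition[OF bounded_bilinear.flip[OF bounded_bilinear_scaleR]]) (use p \<tau> sub in auto)
    also have "\<dots> = simple_process n \<tau> \<xi> s \<omega>"
      unfolding simple_process_def using \<tau>(1) by (intro sum.cong refl) (simp add: indicator_Ioc_eq_diff less_imp_le)
    finally show "simple_process m p \<zeta> s \<omega> = simple_process n \<tau> \<xi> s \<omega>" .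
  qed
  show "simple_integral W m p \<zeta> = simple_integral W n \<tau> \<xi>"
    unfolding simple_integral_def \<zeta>_def simple_process_def
    by (intro ext sum_refine_partition[OF bounded_bilinear_matrix_vector_mult, where g = "\<lambda>t. W t _"]) (use p \<tau> sub in auto)
qed

text \<open>The approximations of two Ito integrals come with unrelated partitions. On the union of
  the partition points their difference is again one simple integrand, to which the truncated
  isometry applies.\<close>

lemma simple_integrand_diff:
  fixes \<xi>\<^sub>1 \<xi>\<^sub>2 :: "nat \<Rightarrow> 'a \<Rightarrow> real ^ 'm ^ 'd"
  assumes si: "simple_integrand M F t n\<^sub>1 \<tau>\<^sub>1 \<xi>\<^sub>1" "simple_integrand M F t n\<^sub>2 \<tau>\<^sub>2 \<xi>\<^sub>2"
  obtains m p \<zeta> where "simple_integrand M F t m p \<zeta>"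
    "\<And>s \<omega>. simple_process m p \<zeta> s \<omega> = simple_process n\<^sub>1 \<tau>\<^sub>1 \<xi>\<^sub>1 s \<omega> - simple_process n\<^sub>2 \<tau>\<^sub>2 \<xi>\<^sub>2 s \<omega>"
    "\<And>\<omega>. simple_integral W m p \<zeta> \<omega> = simple_integral W n\<^sub>1 \<tau>\<^sub>1 \<xi>\<^sub>1 \<omega> - simple_integral W n\<^sub>2 \<tau>\<^sub>2 \<xi>\<^sub>2 \<omega>"
proof -
  define S where "S = \<tau>\<^sub>1 ` {..n\<^sub>1} \<union> \<tau>\<^sub>2 ` {..n\<^sub>2}"
  define xs where "xs = sorted_list_of_set S"
  \<comment> \<open>\<open>Suc m\<close> points bound \<open>m\<close> cells; for
    \<open>t = 0\<close> the only point is 0 and there is no cell.\<close>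
  define m where "m = card S - 1"
  define p where "p i = xs ! i" for i
  have S: "finite S" "S \<noteq> {}" "0 \<in> S" "t \<in> S"
    using si by (auto simp: S_def simple_integrand_def image_iff intro: bexI[of _ 0] bexI[of _ n\<^sub>1])
  have len: "length xs = Suc m"
    using S card_gt_0_iff[of S] by (simp add: xs_def m_def)
  have range: "0 \<le> u \<and> u \<le> t" if "u \<in> S" for u
  proof -
    have \<tau>: "\<tau>\<^sub>1 0 = 0" "\<tau>\<^sub>1 n\<^sub>1 = t" "\<tau>\<^sub>2 0 = 0" "\<tau>\<^sub>2 n\<^sub>2 = t"
      using si by (auto simp: simple_integrand_def)
    consider i where "i \<le> n\<^sub>1" "u = \<tau>\<^sub>1 i" | i where "i \<le> n\<^sub>2" "u = \<tau>\<^sub>2 i"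
      using \<open>u \<in> S\<close> unfolding S_def by blast
    then show ?thesis
    proof cases
      case 1
      then show ?thesis
        using simple_integrand_partition_mono[OF si(1), of 0 i] simple_integrand_partition_mono[OF si(1), of i n\<^sub>1] \<tau> by simp
    next
      case 2
      then show ?thesis
        using simple_integrand_partition_mono[OF si(2), of 0 i] simple_integrand_partition_mono[OF si(2), of i n\<^sub>2] \<tau> by simp
    qed
  qed
  have image: "p ` {..m} = S"
  proof -
    have "p ` {..m} = set xs"
      using len by (auto simp: p_def set_conv_nth image_iff less_Suc_eq_le)
    then show ?thesis using S by (simp add: xs_def)
  qed
  have p: "p i < p j" if "i < j" "j \<le> m" for i j
    using sorted_wrt_nth_less[OF strict_sorted_list_of_set[of S], of i j] that len by (simp add: p_def xs_def)
  have p_mono: "p i \<le> p j" if "i \<le> j" "j \<le> m" for i j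
    using p[of i j] that by (cases "i = j") auto
  have p0: "p 0 = 0"
  proof (rule antisym)
    obtain i where "i \<le> m" "p i = 0" using S(3) image by (metis atMost_iff imageE)
    then show "p 0 \<le> 0" using p_mono[of 0 i] by simp
    show "0 \<le> p 0" using image range by blast
  qed
  have pm: "p m = t"
  proof (rule antisym)
    obtain i where "i \<le> m" "p i = t" using S(4) image by (metis atMost_iff imageE)
    then show "t \<le> p m" using p_mono[of i m] by simp
    show "p m \<le> t" using image range by blast
  qed
  define \<zeta>\<^sub>1 where "\<zeta>\<^sub>1 j \<omega> = simple_process n\<^sub>1 \<tau>\<^sub>1 \<xi>\<^sub>1 (p (Suc j)) \<omega>" for j \<omega>
  define \<zeta>\<^sub>2 where "\<zeta>\<^sub>2 j \<omega> = simple_process n\<^sub>2 \<tau>\<^sub>2 \<xi>\<^sub>2 (p (Suc j)) \<omega>" for j \<omega>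
  have sub: "\<tau>\<^sub>1 ` {..n\<^sub>1} \<subseteq> p ` {..m}" "\<tau>\<^sub>2 ` {..n\<^sub>2} \<subseteq> p ` {..m}"
    unfolding image by (auto simp: S_def)
  note r1 = simple_integrand_refine[OF si(1) p p0 pm sub(1), folded \<zeta>\<^sub>1_def]
  note r2 = simple_integrand_refine[OF si(2) p p0 pm sub(2), folded \<zeta>\<^sub>2_def]
  show thesis
  proof
    have "bounded ((\<lambda>\<omega>. \<zeta>\<^sub>1 i \<omega> - \<zeta>\<^sub>2 i \<omega>) ` space M)" if "i < m" for i
      using r1(1) r2(1) that by (intro bounded_minus_comp) (auto simp: simple_integrand_def)
    then show "simple_integrand M F t m p (\<lambda>i \<omega>. \<zeta>\<^sub>1 i \<omega> - \<zeta>\<^sub>2 i \<omega>)"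
      using r1(1) r2(1) by (auto simp: simple_integrand_def intro!: borel_measurable_diff)
    show "simple_process m p (\<lambda>i \<omega>. \<zeta>\<^sub>1 i \<omega> - \<zeta>\<^sub>2 i \<omega>) s \<omega>
        = simple_process n\<^sub>1 \<tau>\<^sub>1 \<xi>\<^sub>1 s \<omega> - simple_process n\<^sub>2 \<tau>\<^sub>2 \<xi>\<^sub>2 s \<omega>" for s \<omega>
    proof -
      have "simple_process m p (\<lambda>i \<omega>. \<zeta>\<^sub>1 i \<omega> - \<zeta>\<^sub>2 i \<omega>) s \<omega> = simple_process m p \<zeta>\<^sub>1 s \<omega> - simple_process m p \<zeta>\<^sub>2 s \<omega>"
        by (simp only: simple_process_def sum_subtractf scaleR_diff_right)
      then show ?thesis by (simp only: r1(2) r2(2))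
    qed
    show "simple_integral W m p (\<lambda>i \<omega>. \<zeta>\<^sub>1 i \<omega> - \<zeta>\<^sub>2 i \<omega>) \<omega>
        = simple_integral W n\<^sub>1 \<tau>\<^sub>1 \<xi>\<^sub>1 \<omega> - simple_integral W n\<^sub>2 \<tau>\<^sub>2 \<xi>\<^sub>2 \<omega>" for \<omega>
    proof -
      have "simple_integral W m p (\<lambda>i \<omega>. \<zeta>\<^sub>1 i \<omega> - \<zeta>\<^sub>2 i \<omega>) \<omega> = simple_integral W m p \<zeta>\<^sub>1 \<omega> - simple_integral W m p \<zeta>\<^sub>2 \<omega>"
        by (simp only: simple_integral_def sum_subtractf matrix_vector_mult_diff_rdistrib)
      then show ?thesis by (simp only: r1(3) r2(3))
    qed
  qed
qed

end

section \<open>Lebesgue measure on a time interval and convergence of energies\<close>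

abbreviation leb :: "real \<Rightarrow> real measure" where
  "leb t \<equiv> restrict_space lborel {0..t}"

lemma finite_measure_leb: "finite_measure (leb t)"
  by (rule finite_measureI) (simp add: emeasure_restrict_space emeasure_lborel_Icc_eq)

lemma sigma_finite_leb: "sigma_finite_measure (leb t)"
  using finite_measure_leb by (rule finite_measure.axioms)

lemma integrable_leb_iff:
  fixes f :: "real \<Rightarrow> 'v::{banach, second_countable_topology}"
  shows "integrable (leb t) f \<longleftrightarrow> set_integrable lborel {0..t} f"
  by (simp add: integrable_restrict_space set_integrable_def)

lemma integral_leb_eq:
  fixes f :: "real \<Rightarrow> 'v::{banach, second_countable_topology}"
  shows "integral\<^sup>L (leb t) f = (LINT s:{0..t}|lborel. f s)"
  by (simp add: integral_restrict_space set_lebesgue_integral_def)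

lemma measurable_joint_leb:
  fixes H :: "real \<Rightarrow> 'a \<Rightarrow> 'b::topological_space"
  assumes "(\<lambda>(t, \<omega>). H t \<omega>) \<in> borel_measurable (restrict_space borel {0..} \<Otimes>\<^sub>M M)"
  shows "(\<lambda>(\<omega>, s). H s \<omega>) \<in> borel_measurable (M \<Otimes>\<^sub>M leb t)"
proof -
  have "(\<lambda>s. s) \<in> leb t \<rightarrow>\<^sub>M restrict_space borel {0..}"
    by (intro measurable_restrict_space2 measurable_restrict_space1) (auto simp: space_restrict_space)
  then have "(\<lambda>z. (snd z, fst z)) \<in> M \<Otimes>\<^sub>M leb t \<rightarrow>\<^sub>M restrict_space borel {0..} \<Otimes>\<^sub>M M"
    by (intro measurable_Pair measurable_compose[OF measurable_snd]) auto
  from measurable_compose[OF this assms] show ?thesis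
    by (simp add: case_prod_beta')
qed

lemma power2_norm_diff_le:
  fixes a b :: "'v::real_normed_vector"
  shows "(norm (a - b))\<^sup>2 \<le> 2 * (norm a)\<^sup>2 + 2 * (norm b)\<^sup>2"
proof -
  have "(norm (a - b))\<^sup>2 \<le> (norm a + norm b)\<^sup>2"
    by (intro power_mono norm_triangle_ineq4) simp
  also have "\<dots> \<le> 2 * (norm a)\<^sup>2 + 2 * (norm b)\<^sup>2"
    using sum_squares_bound[of "norm a" "norm b"] by (simp add: power2_sum)
  finally show ?thesis .
qed

text \<open>With d the norm of \<open>g - h\<close>, the left side is at most d (2 |h| + d), and
  Young's inequality with weight \<open>e\<close> splits the mixed term. The weight makes the share
  of \<open>h\<close> as small as desired, at the price of a large factor on the part that tends to
  0.\<close>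

lemma abs_power2_norm_diff_le:
  fixes g h :: "'v::real_normed_vector"
  assumes "0 < e"
  shows "\<bar>(norm g)\<^sup>2 - (norm h)\<^sup>2\<bar> \<le> e * (norm h)\<^sup>2 + (1 + 1 / e) * (norm (g - h))\<^sup>2"
proof -
  define d where "d = norm (g - h)"
  have d: "\<bar>norm g - norm h\<bar> \<le> d" "0 \<le> d"
    using norm_triangle_ineq3[of g h] by (auto simp: d_def)
  have "\<bar>(norm g)\<^sup>2 - (norm h)\<^sup>2\<bar> = \<bar>norm g - norm h\<bar> * (norm g + norm h)"
    by (simp add: power2_eq_square square_diff_square_factored abs_mult mult.commute)
  also have "\<dots> \<le> d * (2 * norm h + d)"
    using d by (intro mult_mono) auto
  also have "\<dots> = 2 * (sqrt e * norm h) * (d / sqrt e) + d\<^sup>2"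
    using assms by (simp add: power2_eq_square algebra_simps)
  also have "\<dots> \<le> (sqrt e * norm h)\<^sup>2 + (d / sqrt e)\<^sup>2 + d\<^sup>2"
    using sum_squares_bound[of "sqrt e * norm h" "d / sqrt e"] by simp
  also have "\<dots> = e * (norm h)\<^sup>2 + (1 + 1 / e) * d\<^sup>2"
    using assms by (simp add: power_mult_distrib power_divide algebra_simps)
  finally show ?thesis by (simp add: d_def)
qed

lemma integrable_power2_norm_diff:
  fixes g h :: "'s \<Rightarrow> 'v::{real_normed_vector, second_countable_topology}"
  assumes [measurable]: "h \<in> borel_measurable N" "g \<in> borel_measurable N"
    and int: "integrable N (\<lambda>s. (norm (h s))\<^sup>2)" "integrable N (\<lambda>s. (norm (g s))\<^sup>2)"
  shows "integrable N (\<lambda>s. (norm (g s - h s))\<^sup>2)"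
proof (rule Bochner_Integration.integrable_bound)
  show "integrable N (\<lambda>s. 2 * (norm (g s))\<^sup>2 + 2 * (norm (h s))\<^sup>2)"
    using int by simp
  show "AE s in N. norm ((norm (g s - h s))\<^sup>2) \<le> norm (2 * (norm (g s))\<^sup>2 + 2 * (norm (h s))\<^sup>2)"
    using power2_norm_diff_le by (intro AE_I2) (simp add: power2_norm_diff_le)
qed simp

lemma L2_convergence_imp_energy:
  fixes h :: "'s \<Rightarrow> 'v::{real_normed_vector, second_countable_topology}" and g :: "nat \<Rightarrow> 's \<Rightarrow> 'v"
  assumes [measurable]: "h \<in> borel_measurable N" "\<And>k. g k \<in> borel_measurable N"
    and int: "integrable N (\<lambda>s. (norm (h s))\<^sup>2)" "\<And>k. integrable N (\<lambda>s. (norm (g k s))\<^sup>2)"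
    and lim: "(\<lambda>k. LINT s|N. (norm (g k s - h s))\<^sup>2) \<longlonglongrightarrow> 0"
  shows "(\<lambda>k. LINT s|N. (norm (g k s))\<^sup>2) \<longlonglongrightarrow> (LINT s|N. (norm (h s))\<^sup>2)"
proof (rule LIMSEQ_I)
  fix r :: real assume r: "0 < r"
  define V where "V = (LINT s|N. (norm (h s))\<^sup>2)"
  have "0 \<le> V" by (simp add: V_def)
  \<comment> \<open>Chosen such that \<open>e * V\<close> is at most \<open>r / 2\<close>; the added
    1 covers \<open>V = 0\<close>.\<close>
  define e where "e = r / (2 * (V + 1))"
  have e: "0 < e" "e * V \<le> r / 2"
    using r \<open>0 \<le> V\<close> by (auto simp: e_def field_simps)
  have J: "integrable N (\<lambda>s. (norm (g k s - h s))\<^sup>2)" for k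
    using int by (intro integrable_power2_norm_diff) auto
  have bound: "\<bar>(LINT s|N. (norm (g k s))\<^sup>2) - V\<bar> \<le> e * V + (1 + 1 / e) * (LINT s|N. (norm (g k s - h s))\<^sup>2)" for k
  proof -
    have "\<bar>(LINT s|N. (norm (g k s))\<^sup>2) - V\<bar> = \<bar>LINT s|N. (norm (g k s))\<^sup>2 - (norm (h s))\<^sup>2\<bar>"
      unfolding V_def using int by (subst Bochner_Integration.integral_diff) auto
    also have "\<dots> \<le> (LINT s|N. \<bar>(norm (g k s))\<^sup>2 - (norm (h s))\<^sup>2\<bar>)"
      by (rule integral_abs_bound)
    also have "\<dots> \<le> (LINT s|N. e * (norm (h s))\<^sup>2 + (1 + 1 / e) * (norm (g k s - h s))\<^sup>2)"
      using int J abs_power2_norm_diff_le[OF e(1)] by (intro integral_mono) auto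
    also have "\<dots> = e * V + (1 + 1 / e) * (LINT s|N. (norm (g k s - h s))\<^sup>2)"
      unfolding V_def using int J by (subst Bochner_Integration.integral_add) auto
    finally show ?thesis .
  qed
  have "(\<lambda>k. (1 + 1 / e) * (LINT s|N. (norm (g k s - h s))\<^sup>2)) \<longlonglongrightarrow> (1 + 1 / e) * 0"
    by (intro tendsto_mult_left lim)
  then have "\<forall>\<^sub>F k in sequentially. (1 + 1 / e) * (LINT s|N. (norm (g k s - h s))\<^sup>2) < r / 2"
    using r by (intro order_tendstoD(2)) auto
  then have "\<forall>\<^sub>F k in sequentially. norm ((LINT s|N. (norm (g k s))\<^sup>2) - V) < r"
  proof eventually_elim
    case (elim k)
    then show ?case using bound[of k] e(2) unfolding real_norm_def by linarith
  qed
  then show "\<exists>n. \<forall>k\<ge>n. norm ((LINT s|N. (norm (g k s))\<^sup>2) - (LINT s|N. (norm (h s))\<^sup>2)) < r"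
    by (simp add: V_def eventually_sequentially)
qed

context brownian_setting
begin

section \<open>Energy of simple processes and passage to the Ito integral\<close>

lemma measurable_simple_process_joint:
  fixes \<xi> :: "nat \<Rightarrow> 'a \<Rightarrow> real ^ 'm ^ 'd"
  assumes si: "simple_integrand M F t n \<tau> \<xi>"
  shows "(\<lambda>(\<omega>, s). simple_process n \<tau> \<xi> s \<omega>) \<in> borel_measurable (M \<Otimes>\<^sub>M leb t)"
proof -
  have [measurable]: "\<xi> i \<in> borel_measurable M" if "i < n" for i
    using si that simple_integrand_partition_mono[OF si, of 0 i]
    by (intro measurable_F_M[of "\<tau> i"]) (auto simp: simple_integrand_def)
  have [measurable]: "{a<..b} \<inter> {0..t} \<in> sets (leb t)" for a b
    by (auto simp: sets_restrict_space)
  have [measurable]: "(\<lambda>z. indicator {a<..b} (snd z) :: real) \<in> borel_measurable (M \<Otimes>\<^sub>M leb t)" for a b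
    by (rule measurable_compose[OF measurable_snd measurable_restrict_space1]) simp
  show ?thesis
    unfolding simple_process_def case_prod_beta by measurable
qed

lemma simple_process_energy:
  fixes \<xi> :: "nat \<Rightarrow> 'a \<Rightarrow> real ^ 'm ^ 'd"
  assumes si: "simple_integrand M F t n \<tau> \<xi>"
  shows "has_bochner_integral (leb t) (\<lambda>s. (norm (simple_process n \<tau> \<xi> s \<omega>))\<^sup>2)
    (\<Sum>i<n. (\<tau> (Suc i) - \<tau> i) * (norm (\<xi> i \<omega>))\<^sup>2)"
proof -
  have lt: "\<tau> i < \<tau> (Suc i)" if "i < n" for i
    using si that by (simp add: simple_integrand_def)
  have in_range: "0 \<le> \<tau> i" "\<tau> i \<le> t" if "i \<le> n" for i
    using simple_integrand_partition_mono[OF si, of 0 i] simple_integrand_partition_mono[OF si, of i n] si that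
    by (auto simp: simple_integrand_def)
  have "has_bochner_integral (leb t) (\<lambda>s. \<Sum>i<n. indicator {\<tau> i<..\<tau> (Suc i)} s * (norm (\<xi> i \<omega>))\<^sup>2)
    (\<Sum>i<n. (\<tau> (Suc i) - \<tau> i) * (norm (\<xi> i \<omega>))\<^sup>2)"
  proof (intro has_bochner_integral_sum has_bochner_integral_mult_left)
    fix i assume i: "i \<in> {..<n}"
    then have sub: "{\<tau> i<..\<tau> (Suc i)} \<subseteq> {0..t}"
      using in_range[of i] in_range[of "Suc i"] by auto
    have "has_bochner_integral (leb t) (indicator {\<tau> i<..\<tau> (Suc i)}) (measure (leb t) {\<tau> i<..\<tau> (Suc i)})"
    proof (rule has_bochner_integral_real_indicator)
      show "{\<tau> i<..\<tau> (Suc i)} \<in> sets (leb t)"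
        using sub by (auto simp: sets_restrict_space)
      show "emeasure (leb t) {\<tau> i<..\<tau> (Suc i)} < \<infinity>"
        using sub lt[of i] i by (simp add: emeasure_restrict_space)
    qed
    then show "has_bochner_integral (leb t) (indicator {\<tau> i<..\<tau> (Suc i)}) (\<tau> (Suc i) - \<tau> i)"
      using sub lt[of i] i by (simp add: measure_restrict_space)
  qed
  moreover have "(norm (simple_process n \<tau> \<xi> s \<omega>))\<^sup>2 = (\<Sum>i<n. indicator {\<tau> i<..\<tau> (Suc i)} s * (norm (\<xi> i \<omega>))\<^sup>2)" for s
  proof (cases "\<exists>i<n. s \<in> {\<tau> i<..\<tau> (Suc i)}")
    case True
    then obtain i where i: "i < n" "s \<in> {\<tau> i<..\<tau> (Suc i)}" by auto
    \<comment> \<open>The intervals are disjoint, so at time \<open>s\<close> only the index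
      \<open>i\<close> contributes and the squared norm may be taken term by term.\<close>
    have ind: "(indicator {\<tau> j<..\<tau> (Suc j)} s :: real) = (if j = i then 1 else 0)" if "j < n" for j
    proof -
      consider "j < i" | "j = i" | "i < j" by linarith
      then show ?thesis
      proof cases
        case 1
        then show ?thesis using simple_integrand_partition_mono[OF si, of "Suc j" i] i by (auto simp: indicator_def)
      next
        case 3
        then show ?thesis using simple_integrand_partition_mono[OF si, of "Suc i" j] i that by (auto simp: indicator_def)
      qed (use i in simp)
    qed
    have "simple_process n \<tau> \<xi> s \<omega> = (\<Sum>j<n. if j = i then \<xi> j \<omega> else 0)"
      unfolding simple_process_def by (intro sum.cong refl) (simp add: ind)
    moreover have "(\<Sum>j<n. indicator {\<tau> j<..\<tau> (Suc j)} s * (norm (\<xi> j \<omega>))\<^sup>2) = (\<Sum>j<n. if j = i then (norm (\<xi> j \<omega>))\<^sup>2 else 0)"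
      by (intro sum.cong refl) (simp add: ind)
    ultimately show ?thesis using i(1) by simp
  next
    case False
    then show ?thesis by (simp add: simple_process_def)
  qed
  ultimately show ?thesis by simp
qed

text \<open>Two extractions: the first makes the energy errors converge almost surely, the second,
  taken from the first, the integrals; passing to a further subsequence keeps the first convergence.
  Joint measurability of the integrand enters because the energy error must be a random
  variable.\<close>

lemma has_ito_integral_AE_approx:
  fixes H :: "real \<Rightarrow> 'a \<Rightarrow> real ^ 'm ^ 'd"
  assumes ito: "has_ito_integral M F W H t I"
  obtains n \<tau> \<xi> where "\<And>k::nat. simple_integrand M F t (n k) (\<tau> k) (\<xi> k)"
    "AE \<omega> in M. (\<lambda>k. LINT s|leb t. (norm (simple_process (n k) (\<tau> k) (\<xi> k) s \<omega> - H s \<omega>))\<^sup>2) \<longlonglongrightarrow> 0"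
    "AE \<omega> in M. (\<lambda>k. simple_integral W (n k) (\<tau> k) (\<xi> k) \<omega>) \<longlonglongrightarrow> I \<omega>"
proof -
  obtain n \<tau> \<xi> where si: "\<And>k::nat. simple_integrand M F t (n k) (\<tau> k) (\<xi> k)"
    and J: "tendsto_in_prob M (\<lambda>k \<omega>. LINT s|leb t. (norm (simple_process (n k) (\<tau> k) (\<xi> k) s \<omega> - H s \<omega>))\<^sup>2) (\<lambda>_. 0)"
    and S: "tendsto_in_prob M (\<lambda>k. simple_integral W (n k) (\<tau> k) (\<xi> k)) I"
    using ito unfolding has_ito_integral_def integral_leb_eq by blast
  have I: "I \<in> borel_measurable M"
    using ito by (simp add: has_ito_integral_def)
  have H [measurable]: "(\<lambda>(\<omega>, s). H s \<omega>) \<in> borel_measurable (M \<Otimes>\<^sub>M leb t)"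
    using ito by (intro measurable_joint_leb) (auto simp: has_ito_integral_def measurable_adapted_def)
  interpret leb: sigma_finite_measure "leb t" by (rule sigma_finite_leb)
  have J_meas: "(\<lambda>\<omega>. LINT s|leb t. (norm (simple_process (n k) (\<tau> k) (\<xi> k) s \<omega> - H s \<omega>))\<^sup>2) \<in> borel_measurable M" for k
  proof (rule leb.borel_measurable_lebesgue_integral)
    note [measurable] = measurable_simple_process_joint[OF si[of k]]
    have "(\<lambda>z. (norm ((case z of (\<omega>, s) \<Rightarrow> simple_process (n k) (\<tau> k) (\<xi> k) s \<omega>) - (case z of (\<omega>, s) \<Rightarrow> H s \<omega>)))\<^sup>2) \<in> borel_measurable (M \<Otimes>\<^sub>M leb t)"
      by measurable
    then show "(\<lambda>(\<omega>, s). (norm (simple_process (n k) (\<tau> k) (\<xi> k) s \<omega> - H s \<omega>))\<^sup>2) \<in> borel_measurable (M \<Otimes>\<^sub>M leb t)"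
      by (simp add: case_prod_beta)
  qed
  have S_meas: "simple_integral W (n k) (\<tau> k) (\<xi> k) \<in> borel_measurable M" for k
  proof -
    have "simple_integral W (n k) (\<tau> k) (\<xi> k) \<in> borel_measurable (F (\<tau> k (n k))) \<and> 0 \<le> \<tau> k (n k)"
      using simple_integral_isometry[of "\<tau> k" "n k" "\<xi> k"] si[of k] by (auto simp: simple_integrand_def)
    then show ?thesis using measurable_F_M by blast
  qed
  obtain r where r: "strict_mono r"
    "AE \<omega> in M. (\<lambda>k. LINT s|leb t. (norm (simple_process (n (r k)) (\<tau> (r k)) (\<xi> (r k)) s \<omega> - H s \<omega>))\<^sup>2) \<longlonglongrightarrow> 0"
    by (rule tendsto_in_prob_AE_subseq[OF J_meas _ J]) auto
  obtain q where q: "strict_mono q"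
    "AE \<omega> in M. (\<lambda>k. simple_integral W (n (r (q k))) (\<tau> (r (q k))) (\<xi> (r (q k))) \<omega>) \<longlonglongrightarrow> I \<omega>"
    by (rule tendsto_in_prob_AE_subseq[OF S_meas I tendsto_in_prob_subseq[OF S r(1)]]) auto
  show thesis
  proof (rule that[of "\<lambda>k. n (r (q k))" "\<lambda>k. \<tau> (r (q k))" "\<lambda>k. \<xi> (r (q k))"])
    show "AE \<omega> in M. (\<lambda>k. LINT s|leb t. (norm (simple_process (n (r (q k))) (\<tau> (r (q k))) (\<xi> (r (q k))) s \<omega> - H s \<omega>))\<^sup>2) \<longlonglongrightarrow> 0"
      using r(2)
    proof eventually_elim
      case (elim \<omega>)
      then show ?case using LIMSEQ_subseq_LIMSEQ[OF elim q(1)] by (simp add: comp_def)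
    qed
  qed (use si q in auto)
qed

text \<open>The truncated isometry for the simple differences passes to the limit by Fatou's lemma
  on the left and by dominated convergence, with the constant \<open>c\<close> as dominating
  function, on the right. Stating it for a difference of two integrals avoids proving linearity of
  the Ito integral first.\<close>

lemma ito_difference_truncated:
  fixes H\<^sub>1 H\<^sub>2 :: "real \<Rightarrow> 'a \<Rightarrow> real ^ 'm ^ 'd"
  assumes ito: "has_ito_integral M F W H\<^sub>1 t I\<^sub>1" "has_ito_integral M F W H\<^sub>2 t I\<^sub>2" and "0 < c"
  defines "V \<omega> \<equiv> \<integral>\<^sup>+s. ennreal ((norm (H\<^sub>1 s \<omega> - H\<^sub>2 s \<omega>))\<^sup>2) \<partial>leb t"
  shows "(\<integral>\<^sup>+\<omega>. ennreal ((norm (I\<^sub>1 \<omega> - I\<^sub>2 \<omega>))\<^sup>2) * indicator {\<omega>. V \<omega> < ennreal c} \<omega> \<partial>M) \<le> (\<integral>\<^sup>+\<omega>. min (ennreal c) (V \<omega>) \<partial>M)"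
proof -
  obtain n\<^sub>1 \<tau>\<^sub>1 \<xi>\<^sub>1 where si1: "\<And>k::nat. simple_integrand M F t (n\<^sub>1 k) (\<tau>\<^sub>1 k) (\<xi>\<^sub>1 k)"
    and J1: "AE \<omega> in M. (\<lambda>k. LINT s|leb t. (norm (simple_process (n\<^sub>1 k) (\<tau>\<^sub>1 k) (\<xi>\<^sub>1 k) s \<omega> - H\<^sub>1 s \<omega>))\<^sup>2) \<longlonglongrightarrow> 0"
    and S1: "AE \<omega> in M. (\<lambda>k. simple_integral W (n\<^sub>1 k) (\<tau>\<^sub>1 k) (\<xi>\<^sub>1 k) \<omega>) \<longlonglongrightarrow> I\<^sub>1 \<omega>"
    using ito(1) by (rule has_ito_integral_AE_approx) blast
  obtain n\<^sub>2 \<tau>\<^sub>2 \<xi>\<^sub>2 where si2: "\<And>k::nat. simple_integrand M F t (n\<^sub>2 k) (\<tau>\<^sub>2 k) (\<xi>\<^sub>2 k)"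
    and J2: "AE \<omega> in M. (\<lambda>k. LINT s|leb t. (norm (simple_process (n\<^sub>2 k) (\<tau>\<^sub>2 k) (\<xi>\<^sub>2 k) s \<omega> - H\<^sub>2 s \<omega>))\<^sup>2) \<longlonglongrightarrow> 0"
    and S2: "AE \<omega> in M. (\<lambda>k. simple_integral W (n\<^sub>2 k) (\<tau>\<^sub>2 k) (\<xi>\<^sub>2 k) \<omega>) \<longlonglongrightarrow> I\<^sub>2 \<omega>"
    using ito(2) by (rule has_ito_integral_AE_approx) blast
  have "\<exists>m p \<zeta>. simple_integrand M F t m p \<zeta> \<and>
      (\<forall>s \<omega>. simple_process m p \<zeta> s \<omega> = simple_process (n\<^sub>1 k) (\<tau>\<^sub>1 k) (\<xi>\<^sub>1 k) s \<omega> - simple_process (n\<^sub>2 k) (\<tau>\<^sub>2 k) (\<xi>\<^sub>2 k) s \<omega>) \<and>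
      (\<forall>\<omega>. simple_integral W m p \<zeta> \<omega> = simple_integral W (n\<^sub>1 k) (\<tau>\<^sub>1 k) (\<xi>\<^sub>1 k) \<omega> - simple_integral W (n\<^sub>2 k) (\<tau>\<^sub>2 k) (\<xi>\<^sub>2 k) \<omega>)" for k
    by (rule simple_integrand_diff[OF si1[of k] si2[of k]]) blast
  then obtain m p \<zeta> where si: "\<And>k. simple_integrand M F t (m k) (p k) (\<zeta> k)"
    and process: "\<And>k s \<omega>. simple_process (m k) (p k) (\<zeta> k) s \<omega> = simple_process (n\<^sub>1 k) (\<tau>\<^sub>1 k) (\<xi>\<^sub>1 k) s \<omega> - simple_process (n\<^sub>2 k) (\<tau>\<^sub>2 k) (\<xi>\<^sub>2 k) s \<omega>"
    and integral: "\<And>k \<omega>. simple_integral W (m k) (p k) (\<zeta> k) \<omega> = simple_integral W (n\<^sub>1 k) (\<tau>\<^sub>1 k) (\<xi>\<^sub>1 k) \<omega> - simple_integral W (n\<^sub>2 k) (\<tau>\<^sub>2 k) (\<xi>\<^sub>2 k) \<omega>"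
    by metis
  define Q where "Q k \<omega> = (\<Sum>i<m k. (p k (Suc i) - p k i) * (norm (\<zeta> k i \<omega>))\<^sup>2)" for k \<omega>
  define S where "S k \<omega> = simple_integral W (m k) (p k) (\<zeta> k) \<omega>" for k \<omega>
  have p_nonneg: "0 \<le> p k i" if "i \<le> m k" for k i
    using simple_integrand_partition_mono[OF si, of 0 i k] si[of k] that by (simp add: simple_integrand_def)
  have \<zeta>_meas [measurable]: "\<zeta> k i \<in> borel_measurable M" if "i < m k" for k i
    using measurable_F_M[OF p_nonneg, of i k "\<zeta> k i"] si[of k] that by (simp add: simple_integrand_def)
  have Q_meas [measurable]: "Q k \<in> borel_measurable M" for k
    unfolding Q_def by measurable
  have S_meas [measurable]: "S k \<in> borel_measurable M" for k
  proof -
    have "(\<lambda>\<omega>. W (p k (Suc i)) \<omega> - W (p k i) \<omega>) \<in> borel_measurable M" if "i < m k" for i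
      using p_nonneg[of i k] p_nonneg[of "Suc i" k] that by simp
    then show ?thesis
      unfolding S_def simple_integral_def by (intro borel_measurable_sum borel_measurable_matrix_vector_mult) auto
  qed
  have truncated: "(\<integral>\<^sup>+\<omega>. ennreal ((norm (S k \<omega>))\<^sup>2) * indicator {\<omega>. Q k \<omega> < c} \<omega> \<partial>M) \<le> (\<integral>\<^sup>+\<omega>. ennreal (min c (Q k \<omega>)) \<partial>M)" for k
    unfolding S_def Q_def using si[of k] \<open>0 < c\<close> by (intro simple_integral_truncated) (auto simp: simple_integrand_def)
  have H_joint [measurable]: "(\<lambda>(\<omega>, s). H\<^sub>1 s \<omega>) \<in> borel_measurable (M \<Otimes>\<^sub>M leb t)" "(\<lambda>(\<omega>, s). H\<^sub>2 s \<omega>) \<in> borel_measurable (M \<Otimes>\<^sub>M leb t)"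
    using ito by (auto intro!: measurable_joint_leb simp: has_ito_integral_def measurable_adapted_def)
  have H_path: "H\<^sub>1' \<in> borel_measurable (leb t)" if "\<omega> \<in> space M" "H\<^sub>1' = (\<lambda>s. H\<^sub>1 s \<omega>) \<or> H\<^sub>1' = (\<lambda>s. H\<^sub>2 s \<omega>)" for \<omega> H\<^sub>1'
    using that measurable_Pair2[OF H_joint(1), of \<omega>] measurable_Pair2[OF H_joint(2), of \<omega>] by auto
  have int: "AE \<omega> in M. integrable (leb t) (\<lambda>s. (norm (H\<^sub>1 s \<omega>))\<^sup>2)" "AE \<omega> in M. integrable (leb t) (\<lambda>s. (norm (H\<^sub>2 s \<omega>))\<^sup>2)"
    using ito unfolding integrable_leb_iff by (auto simp: has_ito_integral_def)
  interpret leb: sigma_finite_measure "leb t" by (rule sigma_finite_leb)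
  have V_meas [measurable]: "V \<in> borel_measurable M"
  proof -
    have "(\<lambda>z. ennreal ((norm ((case z of (\<omega>, s) \<Rightarrow> H\<^sub>1 s \<omega>) - (case z of (\<omega>, s) \<Rightarrow> H\<^sub>2 s \<omega>)))\<^sup>2)) \<in> borel_measurable (M \<Otimes>\<^sub>M leb t)"
      by measurable
    then show ?thesis
      unfolding V_def by (intro leb.borel_measurable_nn_integral) (simp add: case_prod_beta)
  qed
  have lim: "AE \<omega> in M. V \<omega> < \<infinity> \<and> (\<lambda>k. Q k \<omega>) \<longlonglongrightarrow> enn2real (V \<omega>) \<and> (\<lambda>k. S k \<omega>) \<longlonglongrightarrow> I\<^sub>1 \<omega> - I\<^sub>2 \<omega>"
    using int J1 J2 S1 S2 AE_space
  proof eventually_elim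
    case (elim \<omega>)
    let ?h = "\<lambda>s. H\<^sub>1 s \<omega> - H\<^sub>2 s \<omega>" and ?g = "\<lambda>k s. simple_process (m k) (p k) (\<zeta> k) s \<omega>"
    let ?J1 = "\<lambda>k. LINT s|leb t. (norm (simple_process (n\<^sub>1 k) (\<tau>\<^sub>1 k) (\<xi>\<^sub>1 k) s \<omega> - H\<^sub>1 s \<omega>))\<^sup>2"
      and ?J2 = "\<lambda>k. LINT s|leb t. (norm (simple_process (n\<^sub>2 k) (\<tau>\<^sub>2 k) (\<xi>\<^sub>2 k) s \<omega> - H\<^sub>2 s \<omega>))\<^sup>2"
    have H [measurable]: "(\<lambda>s. H\<^sub>1 s \<omega>) \<in> borel_measurable (leb t)" "(\<lambda>s. H\<^sub>2 s \<omega>) \<in> borel_measurable (leb t)"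
      using H_path[OF elim(7)] by auto
    have simple_path: "(\<lambda>s. simple_process n \<tau> \<xi> s \<omega>) \<in> borel_measurable (leb t)"
      if "simple_integrand M F t n \<tau> \<xi>" for n \<tau> and \<xi> :: "nat \<Rightarrow> 'a \<Rightarrow> real ^ 'm ^ 'd"
      using measurable_Pair2[OF measurable_simple_process_joint[OF that] elim(7)] by simp
    have simple_int: "integrable (leb t) (\<lambda>s. (norm (simple_process n \<tau> \<xi> s \<omega>))\<^sup>2)"
      if "simple_integrand M F t n \<tau> \<xi>" for n \<tau> and \<xi> :: "nat \<Rightarrow> 'a \<Rightarrow> real ^ 'm ^ 'd"
      using simple_process_energy[OF that, of \<omega>] by (rule integrable.intros)
    have int_h: "integrable (leb t) (\<lambda>s. (norm (?h s))\<^sup>2)"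
      using elim by (intro integrable_power2_norm_diff) auto
    have V: "V \<omega> = ennreal (LINT s|leb t. (norm (?h s))\<^sup>2)"
      unfolding V_def using int_h by (intro nn_integral_eq_integral) auto
    have Q: "Q k \<omega> = (LINT s|leb t. (norm (?g k s))\<^sup>2)" for k
      unfolding Q_def using simple_process_energy[OF si[of k], of \<omega>] by (simp add: has_bochner_integral_integral_eq)
    \<comment> \<open>The approximation error of the difference is the difference of the two errors,
      so it vanishes in the limit together with them.\<close>
    have J_le: "(LINT s|leb t. (norm (?g k s - ?h s))\<^sup>2) \<le> 2 * ?J1 k + 2 * ?J2 k" for k
    proof -
      note sp = simple_path[OF si1[of k]] simple_path[OF si2[of k]] simple_int[OF si1[of k]] simple_int[OF si2[of k]]
      have i: "integrable (leb t) (\<lambda>s. (norm (simple_process (n\<^sub>1 k) (\<tau>\<^sub>1 k) (\<xi>\<^sub>1 k) s \<omega> - H\<^sub>1 s \<omega>))\<^sup>2)"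
        "integrable (leb t) (\<lambda>s. (norm (simple_process (n\<^sub>2 k) (\<tau>\<^sub>2 k) (\<xi>\<^sub>2 k) s \<omega> - H\<^sub>2 s \<omega>))\<^sup>2)"
        using sp elim by (intro integrable_power2_norm_diff; simp)+
      have "(LINT s|leb t. (norm (?g k s - ?h s))\<^sup>2) \<le> (LINT s|leb t. 2 * (norm (simple_process (n\<^sub>1 k) (\<tau>\<^sub>1 k) (\<xi>\<^sub>1 k) s \<omega> - H\<^sub>1 s \<omega>))\<^sup>2
          + 2 * (norm (simple_process (n\<^sub>2 k) (\<tau>\<^sub>2 k) (\<xi>\<^sub>2 k) s \<omega> - H\<^sub>2 s \<omega>))\<^sup>2)"
      proof (rule integral_mono)
        show "integrable (leb t) (\<lambda>s. (norm (?g k s - ?h s))\<^sup>2)"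
          by (rule integrable_power2_norm_diff) (use int_h simple_int[OF si[of k]] simple_path[OF si[of k]] in auto)
        show "(norm (?g k s - ?h s))\<^sup>2 \<le> 2 * (norm (simple_process (n\<^sub>1 k) (\<tau>\<^sub>1 k) (\<xi>\<^sub>1 k) s \<omega> - H\<^sub>1 s \<omega>))\<^sup>2
          + 2 * (norm (simple_process (n\<^sub>2 k) (\<tau>\<^sub>2 k) (\<xi>\<^sub>2 k) s \<omega> - H\<^sub>2 s \<omega>))\<^sup>2" for s
          using power2_norm_diff_le[of "simple_process (n\<^sub>1 k) (\<tau>\<^sub>1 k) (\<xi>\<^sub>1 k) s \<omega> - H\<^sub>1 s \<omega>" "simple_process (n\<^sub>2 k) (\<tau>\<^sub>2 k) (\<xi>\<^sub>2 k) s \<omega> - H\<^sub>2 s \<omega>"]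
          by (simp add: process algebra_simps)
      qed (use i in auto)
      also have "\<dots> = 2 * ?J1 k + 2 * ?J2 k"
        using i by (subst Bochner_Integration.integral_add) auto
      finally show ?thesis .
    qed
    have "(\<lambda>k. LINT s|leb t. (norm (?g k s - ?h s))\<^sup>2) \<longlonglongrightarrow> 0"
    proof (rule tendsto_sandwich[OF _ _ tendsto_const])
      show "(\<lambda>k. 2 * ?J1 k + 2 * ?J2 k) \<longlonglongrightarrow> 0"
        using tendsto_add[OF tendsto_mult_left[OF elim(3), of 2] tendsto_mult_left[OF elim(4), of 2]] by simp
    qed (use J_le in auto)
    then have "(\<lambda>k. Q k \<omega>) \<longlonglongrightarrow> (LINT s|leb t. (norm (?h s))\<^sup>2)"
      unfolding Q using int_h simple_int[OF si] simple_path[OF si] H by (intro L2_convergence_imp_energy) auto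
    moreover have "(\<lambda>k. S k \<omega>) \<longlonglongrightarrow> I\<^sub>1 \<omega> - I\<^sub>2 \<omega>"
      unfolding S_def integral using elim by (intro tendsto_diff)
    ultimately show ?case
      by (simp add: V)
  qed
  have Q_nonneg: "0 \<le> Q k \<omega>" for k \<omega>
    unfolding Q_def using si[of k] by (intro sum_nonneg mult_nonneg_nonneg) (auto simp: simple_integrand_def less_imp_le)
  have "(\<integral>\<^sup>+\<omega>. ennreal ((norm (I\<^sub>1 \<omega> - I\<^sub>2 \<omega>))\<^sup>2) * indicator {\<omega>. V \<omega> < ennreal c} \<omega> \<partial>M)
      \<le> (\<integral>\<^sup>+\<omega>. liminf (\<lambda>k. ennreal ((norm (S k \<omega>))\<^sup>2) * indicator {\<omega>. Q k \<omega> < c} \<omega>) \<partial>M)"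
  proof (rule nn_integral_mono_AE)
    show "AE \<omega> in M. ennreal ((norm (I\<^sub>1 \<omega> - I\<^sub>2 \<omega>))\<^sup>2) * indicator {\<omega>. V \<omega> < ennreal c} \<omega>
        \<le> liminf (\<lambda>k. ennreal ((norm (S k \<omega>))\<^sup>2) * indicator {\<omega>. Q k \<omega> < c} \<omega>)"
      using lim
    proof eventually_elim
      case (elim \<omega>)
      show ?case
      proof (cases "V \<omega> < ennreal c")
        case True
        then have "enn2real (V \<omega>) < c"
          using elim \<open>0 < c\<close> by (simp add: enn2real_less_iff)
        \<comment> \<open>The strict inequality in the event matters: it is inherited by the
          approximating energies, so the indicator does not cut off the limit.\<close>
        then have "\<forall>\<^sub>F k in sequentially. Q k \<omega> < c"
          using elim order_tendstoD(2) by blast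
        then have "\<forall>\<^sub>F k in sequentially. ennreal ((norm (S k \<omega>))\<^sup>2) = ennreal ((norm (S k \<omega>))\<^sup>2) * indicator {\<omega>. Q k \<omega> < c} \<omega>"
          by eventually_elim simp
        moreover have "(\<lambda>k. ennreal ((norm (S k \<omega>))\<^sup>2)) \<longlonglongrightarrow> ennreal ((norm (I\<^sub>1 \<omega> - I\<^sub>2 \<omega>))\<^sup>2)"
          using elim by (intro tendsto_ennrealI tendsto_power tendsto_norm) auto
        ultimately have "(\<lambda>k. ennreal ((norm (S k \<omega>))\<^sup>2) * indicator {\<omega>. Q k \<omega> < c} \<omega>) \<longlonglongrightarrow> ennreal ((norm (I\<^sub>1 \<omega> - I\<^sub>2 \<omega>))\<^sup>2)"
          using tendsto_cong by fast
        then show ?thesis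
          using lim_imp_Liminf[OF sequentially_bot] True by fastforce
      qed simp
    qed
  qed
  also have "\<dots> \<le> liminf (\<lambda>k. \<integral>\<^sup>+\<omega>. ennreal ((norm (S k \<omega>))\<^sup>2) * indicator {\<omega>. Q k \<omega> < c} \<omega> \<partial>M)"
    by (rule nn_integral_liminf) measurable
  also have "\<dots> \<le> liminf (\<lambda>k. \<integral>\<^sup>+\<omega>. ennreal (min c (Q k \<omega>)) \<partial>M)"
    by (intro Liminf_mono always_eventually allI truncated)
  also have "\<dots> = (\<integral>\<^sup>+\<omega>. min (ennreal c) (V \<omega>) \<partial>M)"
  proof (rule lim_imp_Liminf[OF sequentially_bot], rule nn_integral_dominated_convergence[where w = "\<lambda>_. ennreal c"])
    show "AE \<omega> in M. (\<lambda>k. ennreal (min c (Q k \<omega>))) \<longlonglongrightarrow> min (ennreal c) (V \<omega>)"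
      using lim
    proof eventually_elim
      case (elim \<omega>)
      then have "(\<lambda>k. ennreal (min c (Q k \<omega>))) \<longlonglongrightarrow> ennreal (min c (enn2real (V \<omega>)))"
        by (intro tendsto_ennrealI tendsto_min) auto
      also have "ennreal (min c (enn2real (V \<omega>))) = min (ennreal c) (V \<omega>)"
        using elim \<open>0 < c\<close> by (cases "V \<omega>") (auto simp: min_def ennreal_le_iff)
      finally show ?case .
    qed
    show "(\<integral>\<^sup>+\<omega>. ennreal c \<partial>M) < \<infinity>"
      by (simp add: emeasure_space_1)
    show "AE \<omega> in M. ennreal (min c (Q k \<omega>)) \<le> ennreal c" for k
      by (intro AE_I2 ennreal_leI) simp
  qed measurable
  finally show ?thesis .
qed

end

section \<open>Mean square distance of two solutions\<close>

text \<open>The chain rule for \<open>x \<mapsto> min c x\<close> along the indefinite integral \<open>B\<close>, as an inequality: the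
  integrand may be stopped at the first time at which \<open>B\<close> reaches the level \<open>c\<close>.\<close>

lemma min_indefinite_integral_le:
  fixes \<beta> :: "real \<Rightarrow> ennreal"
  assumes [measurable]: "\<beta> \<in> borel_measurable borel" and t: "0 \<le> t"
  defines "B s \<equiv> \<integral>\<^sup>+r. \<beta> r * indicator {0..s} r \<partial>lborel"
  assumes fin: "B t < \<infinity>" and c: "0 < c"
  shows "min c (B t) \<le> (\<integral>\<^sup>+s. (\<beta> s * indicator {s. B s < c} s) * indicator {0..t} s \<partial>lborel)"
proof -
  have B_mono: "B r \<le> B s" if "r \<le> s" for r s
    unfolding B_def using that by (intro nn_integral_mono) (auto simp: indicator_def)
  show ?thesis
  proof (cases "B t < c")
    case True
    have "B s < c" if "s \<le> t" for s
      using B_mono[OF that] True by (rule le_less_trans)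
    then have "B t \<le> (\<integral>\<^sup>+s. (\<beta> s * indicator {s. B s < c} s) * indicator {0..t} s \<partial>lborel)"
      unfolding B_def[of t] by (intro nn_integral_mono) (auto simp: indicator_def)
    then show ?thesis by (rule min.coboundedI2)
  next
    case False
    define A where "A = {s. 0 \<le> s \<and> s \<le> t \<and> B s < c}"
    \<comment> \<open>A single point is a null set. This places 0 in \<open>A\<close>, so that the
      supremum below is taken over a nonempty set.\<close>
    have B0: "B 0 = 0"
    proof -
      have "AE r in lborel. \<beta> r * indicator {0..0} r = 0"
        using AE_lborel_singleton[of 0] by eventually_elim auto
      then show ?thesis
        unfolding B_def by (subst nn_integral_0_iff_AE) auto
    qed
    have A: "0 \<in> A" "bdd_above A" "\<And>s. s \<in> A \<Longrightarrow> s \<le> t"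
      using t c B0 by (auto simp: A_def bdd_above_def)
    \<comment> \<open>The first time at which \<open>B\<close> reaches \<open>c\<close>. Before
      \<open>u\<close> the integrand is not cut off, so it suffices to show that \<open>B\<close>
      has indeed reached \<open>c\<close> at \<open>u\<close>.\<close>
    define u where "u = Sup A"
    have u: "0 \<le> u" "u \<le> t"
      unfolding u_def using A by (auto intro: cSup_upper cSup_least)
    have below: "B s < c" if "s < u" "0 \<le> s" for s
    proof -
      obtain s' where "s' \<in> A" "s < s'"
        using less_cSupE[of s A] \<open>s < u\<close> A(1) unfolding u_def by blast
      then show ?thesis
        using B_mono[of s s'] by (auto simp: A_def)
    qed
    have "c \<le> B u"
    proof (cases "u = t")
      case True
      then show ?thesis using False by (simp add: not_less)
    next
      case False
      with u have "u < t" by simp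
      \<comment> \<open>Right-continuity of \<open>B\<close> at \<open>u\<close>: \<open>B s\<close>
        is the mass of [0, s] under \<open>N\<close>, and the intervals \<open>X i\<close> shrink to
        [0, u] with finite mass. Their right endpoints lie beyond \<open>u\<close> and hence outside
        \<open>A\<close>, so each mass is at least \<open>c\<close>.\<close>
      define N where "N = density lborel \<beta>"
      define X where "X i = {0..u + (t - u) / real (Suc i)}" for i
      have emeasure_N: "emeasure N {0..s} = B s" for s
        by (simp add: N_def emeasure_density B_def)
      have X_range: "u < u + (t - u) / real (Suc i)" "u + (t - u) / real (Suc i) \<le> t" for i
        using \<open>u < t\<close> mult_right_mono[of u t "real i"] by (auto simp: field_simps)
      have "(\<lambda>i. emeasure N (X i)) \<longlonglongrightarrow> emeasure N (\<Inter>i. X i)"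
      proof (rule Lim_emeasure_decseq)
        show "range X \<subseteq> sets N"
          by (auto simp: X_def N_def)
        have "(t - u) / real (Suc j) \<le> (t - u) / real (Suc i)" if "i \<le> j" for i j
          using \<open>u < t\<close> that by (intro divide_left_mono) auto
        then show "decseq X"
          unfolding decseq_def X_def by (auto intro: order_trans add_left_mono simp del: of_nat_Suc)
        show "emeasure N (X i) \<noteq> \<infinity>" for i
          using B_mono[OF X_range(2)[of i]] fin by (auto simp: X_def emeasure_N top_unique)
      qed
      also have "(\<Inter>i. X i) = {0..u}"
      proof -
        have "(\<lambda>i. u + (t - u) / real (Suc i)) \<longlonglongrightarrow> u + 0"
          by (intro tendsto_intros LIMSEQ_Suc lim_const_over_n)
        then have le_u: "s \<le> u" if "\<And>i. s \<le> u + (t - u) / real (Suc i)" for s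
          using that by (intro LIMSEQ_le_const[of _ u]) auto
        have u_le: "s \<le> u + (t - u) / real (Suc i)" if "s \<le> u" for s i
          using that X_range(1)[of i] by linarith
        show ?thesis
        proof (intro set_eqI iffI)
          fix s assume "s \<in> (\<Inter>i. X i)"
          then have "0 \<le> s" "\<And>i. s \<le> u + (t - u) / real (Suc i)"
            unfolding X_def INT_iff atLeastAtMost_iff by blast+
          with le_u show "s \<in> {0..u}" by simp
        next
          fix s assume "s \<in> {0..u}"
          with u_le show "s \<in> (\<Inter>i. X i)"
            unfolding X_def INT_iff atLeastAtMost_iff by blast
        qed
      qed
      finally have "(\<lambda>i. emeasure N (X i)) \<longlonglongrightarrow> B u"
        by (simp add: emeasure_N)
      moreover have "c \<le> emeasure N (X i)" for i
      proof -
        have "u + (t - u) / real (Suc i) \<notin> A"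
          using X_range(1)[of i] A(2) cSup_upper[of _ A] unfolding u_def by (metis not_less)
        then show ?thesis
          using X_range[of i] u(1) unfolding X_def emeasure_N by (auto simp: A_def not_less)
      qed
      ultimately show ?thesis
        by (intro LIMSEQ_le_const) auto
    qed
    also have "B u \<le> (\<integral>\<^sup>+s. (\<beta> s * indicator {s. B s < c} s) * indicator {0..t} s \<partial>lborel)"
      unfolding B_def[of u]
    proof (rule nn_integral_mono_AE)
      \<comment> \<open>At \<open>u\<close> itself the integrand is already cut off, but one point
        does not affect the integral.\<close>
      show "AE s in lborel. \<beta> s * indicator {0..u} s \<le> (\<beta> s * indicator {s. B s < c} s) * indicator {0..t} s"
        using AE_lborel_singleton[of u] by eventually_elim (use below u in \<open>auto simp: indicator_def\<close>)
    qed
    finally show ?thesis by (rule min.coboundedI1)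
  qed
qed

text \<open>A constant \<open>S\<close> with \<open>r s \<le> S * exp (2 * a * s)\<close> can be improved to \<open>S / 2 + k * T\<close>, so the least
  such constant is at most \<open>2 * k * T\<close>.\<close>

lemma gronwall_nn_integral:
  fixes r :: "real \<Rightarrow> real"
  assumes r: "\<And>t. 0 \<le> t \<Longrightarrow> t \<le> T \<Longrightarrow> 0 \<le> r t" "\<And>t. 0 \<le> t \<Longrightarrow> t \<le> T \<Longrightarrow> r t \<le> c"
    and ineq: "\<And>t. 0 \<le> t \<Longrightarrow> t \<le> T \<Longrightarrow> ennreal (r t) \<le> (\<integral>\<^sup>+s. ennreal (a * r s + k) * indicator {0..t} s \<partial>lborel)"
    and a: "0 < a" and k: "0 \<le> k" and T: "0 \<le> T"
  shows "r T \<le> 2 * k * T * exp (2 * a * T)"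
proof -
  define S where "S = Sup ((\<lambda>t. r t * exp (- (2 * a * t))) ` {0..T})"
  \<comment> \<open>The bound \<open>c\<close> serves to make the supremum finite. It does not enter
    the final estimate, which is what allows \<open>c\<close> to tend to infinity later.\<close>
  have bdd: "bdd_above ((\<lambda>t. r t * exp (- (2 * a * t))) ` {0..T})"
  proof (rule bdd_aboveI2)
    fix t assume t: "t \<in> {0..T}"
    then have "r t * exp (- (2 * a * t)) \<le> r t * 1"
      using r(1)[of t] a by (intro mult_left_mono) auto
    then show "r t * exp (- (2 * a * t)) \<le> c"
      using r(2)[of t] t by simp
  qed
  have r_le: "r t \<le> S * exp (2 * a * t)" if "0 \<le> t" "t \<le> T" for t
  proof -
    have "r t * exp (- (2 * a * t)) \<le> S"
      unfolding S_def using bdd that by (intro cSUP_upper) auto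
    then show ?thesis by (simp add: exp_minus field_simps)
  qed
  have S_nonneg: "0 \<le> S"
    using r_le[of 0] r(1)[of 0] T by simp
  have "S \<le> S / 2 + k * T"
    unfolding S_def
  proof (rule cSUP_least, goal_cases)
    case (2 t)
    then have t: "0 \<le> t" "t \<le> T" by auto
    have "ennreal (r t) \<le> (\<integral>\<^sup>+s. ennreal (a * (S * exp (2 * a * s)) + k) * indicator {0..t} s \<partial>lborel)"
      using r_le t a by (intro order_trans[OF ineq[OF t]] nn_integral_mono) (auto simp: indicator_def intro!: ennreal_leI mult_left_mono)
    \<comment> \<open>The primitive of \<open>a * (S * exp (2 * a * s))\<close> is
      \<open>S / 2 * exp (2 * a * s)\<close>: the 2 in the exponent is there to produce the factor
      one half.\<close>
    also have "\<dots> = ennreal ((S / 2 * exp (2 * a * t) + k * t) - (S / 2 * exp (2 * a * 0) + k * 0))"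
      using a S_nonneg k t by (intro nn_integral_FTC_Icc) (auto intro!: derivative_eq_intros)
    also have "\<dots> \<le> ennreal (S / 2 * exp (2 * a * t) + k * T)"
      using S_nonneg mult_left_mono[OF t(2) k] by (intro ennreal_leI) simp
    finally have "r t \<le> S / 2 * exp (2 * a * t) + k * T"
      using S_nonneg k T by (subst (asm) ennreal_le_iff) auto
    then have "r t * exp (- (2 * a * t)) \<le> (S / 2 * exp (2 * a * t) + k * T) * exp (- (2 * a * t))"
      by (intro mult_right_mono) auto
    also have "\<dots> = S / 2 + k * T * exp (- (2 * a * t))"
      by (simp add: algebra_simps flip: exp_add)
    also have "\<dots> \<le> S / 2 + k * T * 1"
      using k T a t by (intro add_left_mono mult_left_mono) auto
    finally show ?case by (simp add: S_def)
  qed (use T in simp)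
  then have "S \<le> 2 * k * T" by simp
  then have "S * exp (2 * a * T) \<le> 2 * k * T * exp (2 * a * T)"
    by (intro mult_right_mono) auto
  with r_le[of T] T show ?thesis by linarith
qed

text \<open>Adapted processes are jointly measurable on nonnegative times only. Freezing them at
  time 0 for negative times gives functions on the whole line, as Fubini's theorem with
  \<open>lborel\<close> requires.\<close>

lemma measurable_extend_time:
  fixes H :: "real \<Rightarrow> 'a \<Rightarrow> 'b::topological_space"
  assumes "(\<lambda>(t, \<omega>). H t \<omega>) \<in> borel_measurable (restrict_space borel {0..} \<Otimes>\<^sub>M M)"
  shows "(\<lambda>z. H (max 0 (fst z)) (snd z)) \<in> borel_measurable (borel \<Otimes>\<^sub>M M)"
proof -
  have "(\<lambda>s. max 0 s) \<in> borel \<rightarrow>\<^sub>M restrict_space borel {0::real..}"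
    by (intro measurable_restrict_space2) auto
  then have "(\<lambda>z. (max 0 (fst z), snd z)) \<in> borel \<Otimes>\<^sub>M M \<rightarrow>\<^sub>M restrict_space borel {0::real..} \<Otimes>\<^sub>M M"
    by (intro measurable_Pair measurable_compose[OF measurable_fst]) auto
  from measurable_compose[OF this assms] show ?thesis
    by simp
qed

lemma norm_integral_leb_power2_le:
  fixes v :: "real \<Rightarrow> 'v::{banach, second_countable_topology}"
  assumes int: "integrable (leb t) v" and t: "0 \<le> t"
  shows "ennreal ((norm (integral\<^sup>L (leb t) v))\<^sup>2) \<le> ennreal t * (\<integral>\<^sup>+s. ennreal ((norm (v s))\<^sup>2) \<partial>leb t)"
proof -
  have [measurable]: "v \<in> borel_measurable (leb t)"
    using int by simp
  have "ennreal (norm (integral\<^sup>L (leb t) v)) \<le> (\<integral>\<^sup>+s. ennreal (norm (v s)) \<partial>leb t)"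
    using int by (rule integral_norm_bound_ennreal)
  then have "(ennreal (norm (integral\<^sup>L (leb t) v)))\<^sup>2 \<le> (\<integral>\<^sup>+s. 1 * ennreal (norm (v s)) \<partial>leb t)\<^sup>2"
    by (intro power_mono) auto
  also have "\<dots> \<le> (\<integral>\<^sup>+s. 1\<^sup>2 \<partial>leb t) * (\<integral>\<^sup>+s. (ennreal (norm (v s)))\<^sup>2 \<partial>leb t)"
    by (intro Cauchy_Schwarz_nn_integral) measurable
  also have "(\<integral>\<^sup>+s. 1\<^sup>2 \<partial>leb t) = ennreal t"
    using t by (simp add: emeasure_restrict_space space_restrict_space)
  finally show ?thesis
    by (simp add: ennreal_power)
qed

context brownian_setting
begin

text \<open>The term \<open>g\<close> collects the perturbation of the coefficients; it may be
  random and is controlled only in mean. On the event B < c the squared distance has mean at most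
  \<open>2 * T + 2\<close> times E (min c B): the part \<open>2 * T\<close> is Cauchy-Schwarz in
  time for the drift, the part 2 the Ito estimate. Inserting this into the growth of E (min c B)
  gives Gronwall's inequality with rate \<open>a * (2 * T + 2)\<close> and source
  \<open>k\<close>.\<close>

lemma sde_difference_L2:
  fixes b\<^sub>1 b\<^sub>2 :: "real ^ 'd \<Rightarrow> real ^ 'd" and \<sigma>\<^sub>1 \<sigma>\<^sub>2 :: "real ^ 'd \<Rightarrow> real ^ 'm ^ 'd"
  assumes X: "sde_solution M F W b\<^sub>1 \<sigma>\<^sub>1 x\<^sub>0 X" and Y: "sde_solution M F W b\<^sub>2 \<sigma>\<^sub>2 x\<^sub>0 Y"
    and b_diff: "\<And>s \<omega>. 0 \<le> s \<Longrightarrow> (norm (b\<^sub>1 (X s \<omega>) - b\<^sub>2 (Y s \<omega>)))\<^sup>2 \<le> a * (norm (X s \<omega> - Y s \<omega>))\<^sup>2 + g s \<omega>"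
    and \<sigma>_diff: "\<And>s \<omega>. 0 \<le> s \<Longrightarrow> (norm (\<sigma>\<^sub>1 (X s \<omega>) - \<sigma>\<^sub>2 (Y s \<omega>)))\<^sup>2 \<le> a * (norm (X s \<omega> - Y s \<omega>))\<^sup>2 + g s \<omega>"
    and g_meas: "(\<lambda>(s, \<omega>). g s \<omega>) \<in> borel_measurable (restrict_space borel {0..} \<Otimes>\<^sub>M M)"
    and g_nonneg: "\<And>s \<omega>. 0 \<le> g s \<omega>"
    and g_le: "\<And>s. 0 \<le> s \<Longrightarrow> s \<le> T \<Longrightarrow> (\<integral>\<^sup>+\<omega>. ennreal (g s \<omega>) \<partial>M) \<le> ennreal k"
    and a: "0 < a" and k: "0 \<le> k" and T: "0 < T"
  shows "(\<integral>\<^sup>+\<omega>. ennreal ((norm (X T \<omega> - Y T \<omega>))\<^sup>2) \<partial>M)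
    \<le> ennreal ((2 * T + 2) * (2 * k * T * exp (2 * (a * (2 * T + 2)) * T)))"
proof -
  define D where "D s \<omega> = X (max 0 s) \<omega> - Y (max 0 s) \<omega>" for s \<omega>
  define \<beta> where "\<beta> s \<omega> = ennreal (a * (norm (D s \<omega>))\<^sup>2 + g (max 0 s) \<omega>)" for s \<omega>
  define B where "B t \<omega> = (\<integral>\<^sup>+s. \<beta> s \<omega> * indicator {0..t} s \<partial>lborel)" for t \<omega>
  have D_meas [measurable]: "(\<lambda>z. D (fst z) (snd z)) \<in> borel_measurable (borel \<Otimes>\<^sub>M M)"
    unfolding D_def using X Y
    by (intro borel_measurable_diff measurable_extend_time) (auto simp: sde_solution_def measurable_adapted_def)
  have \<beta>_meas [measurable]: "(\<lambda>z. \<beta> (fst z) (snd z)) \<in> borel_measurable (borel \<Otimes>\<^sub>M M)"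
    unfolding \<beta>_def using measurable_extend_time[OF g_meas] by measurable
  have \<beta>_path [measurable]: "(\<lambda>s. \<beta> s \<omega>) \<in> borel_measurable borel" if "\<omega> \<in> space M" for \<omega>
    using measurable_compose[OF measurable_Pair2'[OF that] \<beta>_meas] by simp
  have D_at [measurable]: "D s \<in> borel_measurable M" for s
    using measurable_compose[OF measurable_Pair1'[of s borel] D_meas] by simp
  have B_meas [measurable]: "(\<lambda>z. B (fst z) (snd z)) \<in> borel_measurable (borel \<Otimes>\<^sub>M M)"
  proof -
    have "(\<lambda>w. (snd w, snd (fst w))) \<in> (borel \<Otimes>\<^sub>M M) \<Otimes>\<^sub>M lborel \<rightarrow>\<^sub>M borel \<Otimes>\<^sub>M M"
      by measurable
    from measurable_compose[OF this \<beta>_meas]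
    have [measurable]: "(\<lambda>w. \<beta> (snd w) (snd (fst w))) \<in> borel_measurable ((borel \<Otimes>\<^sub>M M) \<Otimes>\<^sub>M lborel)"
      by simp
    have "(\<lambda>w. \<beta> (snd w) (snd (fst w)) * indicator {w. 0 \<le> snd w \<and> snd w \<le> fst (fst w)} w) \<in> borel_measurable ((borel \<Otimes>\<^sub>M M) \<Otimes>\<^sub>M lborel)"
      by measurable
    then have "(\<lambda>z. \<integral>\<^sup>+s. \<beta> s (snd z) * indicator {w. 0 \<le> snd w \<and> snd w \<le> fst (fst w)} (z, s) \<partial>lborel) \<in> borel_measurable (borel \<Otimes>\<^sub>M M)"
      by (intro lborel.borel_measurable_nn_integral) (simp add: case_prod_beta)
    also have "(\<lambda>z. \<integral>\<^sup>+s. \<beta> s (snd z) * indicator {w. 0 \<le> snd w \<and> snd w \<le> fst (fst w)} (z, s) \<partial>lborel) = (\<lambda>z. B (fst z) (snd z))"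
      unfolding B_def by (intro ext nn_integral_cong) (auto simp: indicator_def)
    finally show ?thesis .
  qed
  have B_at [measurable]: "B s \<in> borel_measurable M" for s
    using measurable_compose[OF measurable_Pair1'[of s borel] B_meas] by simp
  have B_mono: "B s \<omega> \<le> B t \<omega>" if "s \<le> t" for s t \<omega>
    unfolding B_def using that by (intro nn_integral_mono) (auto simp: indicator_def)
  interpret pair_sigma_finite lborel M
    by (intro pair_sigma_finite.intro sigma_finite_lborel sigma_finite_measure_axioms)
  have E_g: "(\<integral>\<^sup>+\<omega>. (\<integral>\<^sup>+s. ennreal (g (max 0 s) \<omega>) * indicator {0..T} s \<partial>lborel) \<partial>M) < \<infinity>"
  proof -
    have g' [measurable]: "(\<lambda>z. g (max 0 (fst z)) (snd z)) \<in> borel_measurable (borel \<Otimes>\<^sub>M M)"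
      by (rule measurable_extend_time[OF g_meas])
    have "(\<integral>\<^sup>+\<omega>. (\<integral>\<^sup>+s. ennreal (g (max 0 s) \<omega>) * indicator {0..T} s \<partial>lborel) \<partial>M)
      = (\<integral>\<^sup>+s. (\<integral>\<^sup>+\<omega>. ennreal (g (max 0 s) \<omega>) * indicator {0..T} s \<partial>M) \<partial>lborel)"
      by (rule Fubini') (simp add: case_prod_beta)
    also have "\<dots> \<le> (\<integral>\<^sup>+s. ennreal k * indicator {0..T} s \<partial>lborel)"
      using g_le by (intro nn_integral_mono) (auto simp: indicator_def)
    also have "\<dots> < \<infinity>"
      using T by (simp add: nn_integral_cmult_indicator ennreal_mult_less_top)
    finally show ?thesis .
  qed
  \<comment> \<open>Finiteness comes from the paths and not from moments of the solutions:
    continuous paths are bounded on [0, T], and the time integral of \<open>g\<close> has finite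
    mean.\<close>
  have B_fin: "AE \<omega> in M. B T \<omega> < \<infinity>"
  proof -
    have g' [measurable]: "(\<lambda>z. g (max 0 (fst z)) (snd z)) \<in> borel_measurable (borel \<Otimes>\<^sub>M M)"
      by (rule measurable_extend_time[OF g_meas])
    have gs: "(\<lambda>\<omega>. \<integral>\<^sup>+s. ennreal (g (max 0 s) \<omega>) * indicator {0..T} s \<partial>lborel) \<in> borel_measurable M"
    proof (rule lborel.borel_measurable_nn_integral)
      have "(\<lambda>w. (snd w, fst w)) \<in> M \<Otimes>\<^sub>M lborel \<rightarrow>\<^sub>M borel \<Otimes>\<^sub>M M"
        by measurable
      from measurable_compose[OF this g']
      have [measurable]: "(\<lambda>w. g (max 0 (snd w)) (fst w)) \<in> borel_measurable (M \<Otimes>\<^sub>M lborel)"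
        by simp
      have "(\<lambda>w. ennreal (g (max 0 (snd w)) (fst w)) * indicator {0..T} (snd w)) \<in> borel_measurable (M \<Otimes>\<^sub>M lborel)"
        by measurable
      then show "(\<lambda>(\<omega>, s). ennreal (g (max 0 s) \<omega>) * indicator {0..T} s) \<in> borel_measurable (M \<Otimes>\<^sub>M lborel)"
        by (simp add: case_prod_beta)
    qed
    have "AE \<omega> in M. (\<integral>\<^sup>+s. ennreal (g (max 0 s) \<omega>) * indicator {0..T} s \<partial>lborel) \<noteq> \<infinity>"
      using E_g by (intro nn_integral_PInf_AE gs) auto
    moreover have "AE \<omega> in M. continuous_on {0..} (\<lambda>t. X t \<omega>)" "AE \<omega> in M. continuous_on {0..} (\<lambda>t. Y t \<omega>)"
      using X Y by (auto simp: sde_solution_def)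
    ultimately show ?thesis
      using AE_space
    proof eventually_elim
      case (elim \<omega>)
      have "continuous_on {0..T} (\<lambda>t. norm (X t \<omega> - Y t \<omega>))"
        using elim by (intro continuous_intros) (auto elim: continuous_on_subset)
      then have "bounded ((\<lambda>t. norm (X t \<omega> - Y t \<omega>)) ` {0..T})"
        by (intro compact_imp_bounded compact_continuous_image) auto
      then obtain K where "\<forall>t\<in>{0..T}. norm (X t \<omega> - Y t \<omega>) \<le> K"
        by (auto simp: bounded_iff)
      then have K: "norm (X t \<omega> - Y t \<omega>) \<le> K" if "0 \<le> t" "t \<le> T" for t
        using that by auto
      have [measurable]: "(\<lambda>s. g (max 0 s) \<omega>) \<in> borel_measurable borel"
        using measurable_compose[OF measurable_Pair2'[OF elim(4)] g'] by simp
      have "B T \<omega> \<le> (\<integral>\<^sup>+s. ennreal (a * K\<^sup>2) * indicator {0..T} s + ennreal (g (max 0 s) \<omega>) * indicator {0..T} s \<partial>lborel)"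
        unfolding B_def
      proof (intro nn_integral_mono)
        fix s
        have "a * (norm (D s \<omega>))\<^sup>2 \<le> a * K\<^sup>2" if "0 \<le> s" "s \<le> T"
          using a K[OF that] that by (intro mult_left_mono power_mono) (auto simp: D_def)
        then show "\<beta> s \<omega> * indicator {0..T} s \<le> ennreal (a * K\<^sup>2) * indicator {0..T} s + ennreal (g (max 0 s) \<omega>) * indicator {0..T} s"
          using a g_nonneg by (auto simp: \<beta>_def indicator_def ennreal_plus[symmetric] simp del: ennreal_plus intro!: ennreal_leI)
      qed
      also have "\<dots> = ennreal (a * K\<^sup>2) * ennreal T + (\<integral>\<^sup>+s. ennreal (g (max 0 s) \<omega>) * indicator {0..T} s \<partial>lborel)"
        using T by (subst nn_integral_add) (auto simp: nn_integral_cmult_indicator)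
      also have "\<dots> < \<infinity>"
        using elim by (auto simp: ennreal_mult_less_top less_top)
      finally show ?case .
    qed
  qed
  \<comment> \<open>On the event \<open>B t < c\<close> the drift contribution is a multiple of
    \<open>B t\<close>, which equals \<open>min c (B t)\<close> there; the Ito contribution is
    handled by the truncated estimate.\<close>
  have main: "(\<integral>\<^sup>+\<omega>. ennreal ((norm (D t \<omega>))\<^sup>2) * indicator {\<omega>. B t \<omega> < ennreal c} \<omega> \<partial>M)
      \<le> ennreal (2 * T + 2) * (\<integral>\<^sup>+\<omega>. min (ennreal c) (B t \<omega>) \<partial>M)" if t: "0 \<le> t" "t \<le> T" and c: "0 < c" for t c
  proof -
    obtain I\<^sub>1 where I1: "has_ito_integral M F W (\<lambda>s \<omega>. \<sigma>\<^sub>1 (X s \<omega>)) t I\<^sub>1"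
      and X_eq: "AE \<omega> in M. X t \<omega> = x\<^sub>0 + (LINT s|leb t. b\<^sub>1 (X s \<omega>)) + I\<^sub>1 \<omega>"
      using X t(1) unfolding sde_solution_def integral_leb_eq by blast
    obtain I\<^sub>2 where I2: "has_ito_integral M F W (\<lambda>s \<omega>. \<sigma>\<^sub>2 (Y s \<omega>)) t I\<^sub>2"
      and Y_eq: "AE \<omega> in M. Y t \<omega> = x\<^sub>0 + (LINT s|leb t. b\<^sub>2 (Y s \<omega>)) + I\<^sub>2 \<omega>"
      using Y t(1) unfolding sde_solution_def integral_leb_eq by blast
    have int: "AE \<omega> in M. integrable (leb t) (\<lambda>s. b\<^sub>1 (X s \<omega>))" "AE \<omega> in M. integrable (leb t) (\<lambda>s. b\<^sub>2 (Y s \<omega>))"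
      using X Y t(1) unfolding sde_solution_def integrable_leb_iff by auto
    have [measurable]: "I\<^sub>1 \<in> borel_measurable M" "I\<^sub>2 \<in> borel_measurable M"
      using I1 I2 by (auto simp: has_ito_integral_def)
    define V where "V \<omega> = (\<integral>\<^sup>+s. ennreal ((norm (\<sigma>\<^sub>1 (X s \<omega>) - \<sigma>\<^sub>2 (Y s \<omega>)))\<^sup>2) \<partial>leb t)" for \<omega>
    have leb_le_B: "(\<integral>\<^sup>+s. ennreal (f s) \<partial>leb t) \<le> B t \<omega>"
      if "\<And>s. 0 \<le> s \<Longrightarrow> f s \<le> a * (norm (X s \<omega> - Y s \<omega>))\<^sup>2 + g s \<omega>" for f \<omega>
      unfolding B_def using that
      by (subst nn_integral_restrict_space) (auto intro!: nn_integral_mono ennreal_leI simp: \<beta>_def D_def indicator_def)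
    have V_le: "V \<omega> \<le> B t \<omega>" for \<omega>
      unfolding V_def using \<sigma>_diff by (intro leb_le_B)
    have pointwise: "AE \<omega> in M. ennreal ((norm (D t \<omega>))\<^sup>2) * indicator {\<omega>. B t \<omega> < ennreal c} \<omega>
        \<le> ennreal (2 * T) * min (ennreal c) (B t \<omega>) + 2 * (ennreal ((norm (I\<^sub>1 \<omega> - I\<^sub>2 \<omega>))\<^sup>2) * indicator {\<omega>. V \<omega> < ennreal c} \<omega>)"
      using X_eq Y_eq int
    proof eventually_elim
      case (elim \<omega>)
      show ?case
      proof (cases "B t \<omega> < ennreal c")
        case True
        let ?v = "\<lambda>s. b\<^sub>1 (X s \<omega>) - b\<^sub>2 (Y s \<omega>)"
        have D_eq: "D t \<omega> = (LINT s|leb t. ?v s) - - (I\<^sub>1 \<omega> - I\<^sub>2 \<omega>)"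
          using elim t(1) by (simp add: D_def Bochner_Integration.integral_diff max_def)
        have "(norm (D t \<omega>))\<^sup>2 \<le> 2 * (norm (LINT s|leb t. ?v s))\<^sup>2 + 2 * (norm (I\<^sub>1 \<omega> - I\<^sub>2 \<omega>))\<^sup>2"
          using power2_norm_diff_le[of "LINT s|leb t. ?v s" "- (I\<^sub>1 \<omega> - I\<^sub>2 \<omega>)"] unfolding D_eq norm_minus_cancel .
        then have "ennreal ((norm (D t \<omega>))\<^sup>2) \<le> ennreal (2 * (norm (LINT s|leb t. ?v s))\<^sup>2 + 2 * (norm (I\<^sub>1 \<omega> - I\<^sub>2 \<omega>))\<^sup>2)"
          by (rule ennreal_leI)
        also have "\<dots> = 2 * ennreal ((norm (LINT s|leb t. ?v s))\<^sup>2) + 2 * ennreal ((norm (I\<^sub>1 \<omega> - I\<^sub>2 \<omega>))\<^sup>2)"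
          by (simp add: ennreal_mult)
        finally have "ennreal ((norm (D t \<omega>))\<^sup>2) \<le> 2 * ennreal ((norm (LINT s|leb t. ?v s))\<^sup>2) + 2 * ennreal ((norm (I\<^sub>1 \<omega> - I\<^sub>2 \<omega>))\<^sup>2)" .
        moreover have "ennreal ((norm (LINT s|leb t. ?v s))\<^sup>2) \<le> ennreal T * B t \<omega>"
        proof (rule order_trans)
          show "ennreal ((norm (LINT s|leb t. ?v s))\<^sup>2) \<le> ennreal t * (\<integral>\<^sup>+s. ennreal ((norm (?v s))\<^sup>2) \<partial>leb t)"
            using elim t(1) by (intro norm_integral_leb_power2_le) auto
          show "ennreal t * (\<integral>\<^sup>+s. ennreal ((norm (?v s))\<^sup>2) \<partial>leb t) \<le> ennreal T * B t \<omega>"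
            using t b_diff by (intro mult_mono leb_le_B ennreal_leI) auto
        qed
        then have "2 * ennreal ((norm (LINT s|leb t. ?v s))\<^sup>2) + 2 * ennreal ((norm (I\<^sub>1 \<omega> - I\<^sub>2 \<omega>))\<^sup>2)
            \<le> 2 * (ennreal T * B t \<omega>) + 2 * ennreal ((norm (I\<^sub>1 \<omega> - I\<^sub>2 \<omega>))\<^sup>2)"
          by (intro add_right_mono mult_left_mono) auto
        ultimately have "ennreal ((norm (D t \<omega>))\<^sup>2) \<le> 2 * (ennreal T * B t \<omega>) + 2 * ennreal ((norm (I\<^sub>1 \<omega> - I\<^sub>2 \<omega>))\<^sup>2)"
          by (rule order_trans)
        \<comment> \<open>The energy \<open>V\<close> of the diffusion difference is dominated by
          \<open>B\<close>, so the event for \<open>B\<close> lies in the event for \<open>V\<close>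
          required by the Ito estimate.\<close>
        moreover have "V \<omega> < ennreal c"
          using V_le True by (rule le_less_trans)
        ultimately show ?thesis
          using True T by (simp add: ennreal_mult mult.assoc min_absorb2 less_imp_le)
      qed simp
    qed
    have V_meas [measurable]: "V \<in> borel_measurable M"
    proof -
      interpret leb: sigma_finite_measure "leb t" by (rule sigma_finite_leb)
      have [measurable]: "(\<lambda>(\<omega>, s). \<sigma>\<^sub>1 (X s \<omega>)) \<in> borel_measurable (M \<Otimes>\<^sub>M leb t)" "(\<lambda>(\<omega>, s). \<sigma>\<^sub>2 (Y s \<omega>)) \<in> borel_measurable (M \<Otimes>\<^sub>M leb t)"
        using I1 I2 by (auto intro!: measurable_joint_leb simp: has_ito_integral_def measurable_adapted_def)
      have "(\<lambda>z. ennreal ((norm ((case z of (\<omega>, s) \<Rightarrow> \<sigma>\<^sub>1 (X s \<omega>)) - (case z of (\<omega>, s) \<Rightarrow> \<sigma>\<^sub>2 (Y s \<omega>))))\<^sup>2)) \<in> borel_measurable (M \<Otimes>\<^sub>M leb t)"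
        by measurable
      then show ?thesis
        unfolding V_def by (intro leb.borel_measurable_nn_integral) (simp add: case_prod_beta)
    qed
    have "(\<integral>\<^sup>+\<omega>. ennreal ((norm (D t \<omega>))\<^sup>2) * indicator {\<omega>. B t \<omega> < ennreal c} \<omega> \<partial>M)
      \<le> (\<integral>\<^sup>+\<omega>. ennreal (2 * T) * min (ennreal c) (B t \<omega>) + 2 * (ennreal ((norm (I\<^sub>1 \<omega> - I\<^sub>2 \<omega>))\<^sup>2) * indicator {\<omega>. V \<omega> < ennreal c} \<omega>) \<partial>M)"
      using pointwise by (rule nn_integral_mono_AE)
    also have "\<dots> = ennreal (2 * T) * (\<integral>\<^sup>+\<omega>. min (ennreal c) (B t \<omega>) \<partial>M)
        + 2 * (\<integral>\<^sup>+\<omega>. ennreal ((norm (I\<^sub>1 \<omega> - I\<^sub>2 \<omega>))\<^sup>2) * indicator {\<omega>. V \<omega> < ennreal c} \<omega> \<partial>M)"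
      by (subst nn_integral_add) (auto simp: nn_integral_cmult)
    also have "\<dots> \<le> ennreal (2 * T) * (\<integral>\<^sup>+\<omega>. min (ennreal c) (B t \<omega>) \<partial>M) + 2 * (\<integral>\<^sup>+\<omega>. min (ennreal c) (B t \<omega>) \<partial>M)"
    proof (intro add_left_mono mult_left_mono)
      have "(\<integral>\<^sup>+\<omega>. ennreal ((norm (I\<^sub>1 \<omega> - I\<^sub>2 \<omega>))\<^sup>2) * indicator {\<omega>. V \<omega> < ennreal c} \<omega> \<partial>M) \<le> (\<integral>\<^sup>+\<omega>. min (ennreal c) (V \<omega>) \<partial>M)"
        unfolding V_def by (rule ito_difference_truncated[OF I1 I2 c])
      also have "\<dots> \<le> (\<integral>\<^sup>+\<omega>. min (ennreal c) (B t \<omega>) \<partial>M)"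
        using V_le by (intro nn_integral_mono min.mono) auto
      finally show "(\<integral>\<^sup>+\<omega>. ennreal ((norm (I\<^sub>1 \<omega> - I\<^sub>2 \<omega>))\<^sup>2) * indicator {\<omega>. V \<omega> < ennreal c} \<omega> \<partial>M) \<le> (\<integral>\<^sup>+\<omega>. min (ennreal c) (B t \<omega>) \<partial>M)" .
    qed simp
    finally have "(\<integral>\<^sup>+\<omega>. ennreal ((norm (D t \<omega>))\<^sup>2) * indicator {\<omega>. B t \<omega> < ennreal c} \<omega> \<partial>M)
      \<le> ennreal (2 * T) * (\<integral>\<^sup>+\<omega>. min (ennreal c) (B t \<omega>) \<partial>M) + 2 * (\<integral>\<^sup>+\<omega>. min (ennreal c) (B t \<omega>) \<partial>M)" .
    then show ?thesis
      using T by (simp add: distrib_right)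
  qed
  have truncated: "(\<integral>\<^sup>+\<omega>. ennreal ((norm (D T \<omega>))\<^sup>2) * indicator {\<omega>. B T \<omega> < ennreal c} \<omega> \<partial>M)
      \<le> ennreal ((2 * T + 2) * (2 * k * T * exp (2 * (a * (2 * T + 2)) * T)))" if c: "0 < c" for c
  proof -
    \<comment> \<open>At most \<open>c\<close>, so it is finite without any moment assumption on the
      solutions.\<close>
    define r where "r t = enn2real (\<integral>\<^sup>+\<omega>. min (ennreal c) (B t \<omega>) \<partial>M)" for t
    have m_le: "(\<integral>\<^sup>+\<omega>. min (ennreal c) (B t \<omega>) \<partial>M) \<le> ennreal c" for t
    proof -
      have "(\<integral>\<^sup>+\<omega>. min (ennreal c) (B t \<omega>) \<partial>M) \<le> (\<integral>\<^sup>+\<omega>. ennreal c \<partial>M)"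
        by (intro nn_integral_mono) simp
      then show ?thesis by (simp add: emeasure_space_1)
    qed
    have m_eq: "(\<integral>\<^sup>+\<omega>. min (ennreal c) (B t \<omega>) \<partial>M) = ennreal (r t)" for t
      unfolding r_def using m_le[of t] by (intro ennreal_enn2real[symmetric]) (auto intro: le_less_trans)
    have r_nonneg: "0 \<le> r t" for t
      by (simp add: r_def)
    have r_le: "r t \<le> c" for t
      using m_le[of t] c unfolding m_eq by (simp add: ennreal_le_iff)
    have "ennreal (r t) \<le> (\<integral>\<^sup>+s. ennreal ((a * (2 * T + 2)) * r s + k) * indicator {0..t} s \<partial>lborel)" if t: "0 \<le> t" "t \<le> T" for t
    proof -
      have ind_meas: "(\<lambda>z. \<beta> (fst z) (snd z) * indicator {z. B (fst z) (snd z) < ennreal c} z * indicator {0..t} (fst z)) \<in> borel_measurable (lborel \<Otimes>\<^sub>M M)"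
        by measurable
      have "ennreal (r t) = (\<integral>\<^sup>+\<omega>. min (ennreal c) (B t \<omega>) \<partial>M)"
        by (simp add: m_eq)
      \<comment> \<open>The pathwise chain rule. After exchanging the integrals, the integrand at
        time \<open>s\<close> is an expectation over the event \<open>B s < c\<close>, where
        \<open>main\<close> at time \<open>s\<close> bounds it by \<open>r s\<close>.\<close>
      also have "\<dots> \<le> (\<integral>\<^sup>+\<omega>. (\<integral>\<^sup>+s. (\<beta> s \<omega> * indicator {s. B s \<omega> < ennreal c} s) * indicator {0..t} s \<partial>lborel) \<partial>M)"
      proof (rule nn_integral_mono_AE)
        show "AE \<omega> in M. min (ennreal c) (B t \<omega>) \<le> (\<integral>\<^sup>+s. (\<beta> s \<omega> * indicator {s. B s \<omega> < ennreal c} s) * indicator {0..t} s \<partial>lborel)"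
          using B_fin AE_space
        proof eventually_elim
          case (elim \<omega>)
          show ?case
            unfolding B_def using elim t c B_mono[of t T \<omega>]
            by (intro min_indefinite_integral_le \<beta>_path) (auto simp: B_def[symmetric] intro: le_less_trans)
        qed
      qed
      also have "\<dots> = (\<integral>\<^sup>+s. (\<integral>\<^sup>+\<omega>. (\<beta> s \<omega> * indicator {s. B s \<omega> < ennreal c} s) * indicator {0..t} s \<partial>M) \<partial>lborel)"
        by (rule Fubini') (use ind_meas in \<open>simp add: case_prod_beta indicator_def\<close>)
      also have "\<dots> \<le> (\<integral>\<^sup>+s. ennreal ((a * (2 * T + 2)) * r s + k) * indicator {0..t} s \<partial>lborel)"
      proof (intro nn_integral_mono)
        fix s
        show "(\<integral>\<^sup>+\<omega>. (\<beta> s \<omega> * indicator {s. B s \<omega> < ennreal c} s) * indicator {0..t} s \<partial>M)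
            \<le> ennreal ((a * (2 * T + 2)) * r s + k) * indicator {0..t} s"
        proof (cases "s \<in> {0..t}")
          case True
          then have s: "0 \<le> s" "s \<le> T" using t by auto
          have [measurable]: "g s \<in> borel_measurable M"
            using measurable_compose[OF measurable_Pair1'[of s borel] measurable_extend_time[OF g_meas]] s by (simp add: max_def)
          have "(\<integral>\<^sup>+\<omega>. (\<beta> s \<omega> * indicator {s. B s \<omega> < ennreal c} s) * indicator {0..t} s \<partial>M)
            \<le> (\<integral>\<^sup>+\<omega>. ennreal a * (ennreal ((norm (D s \<omega>))\<^sup>2) * indicator {\<omega>. B s \<omega> < ennreal c} \<omega>) + ennreal (g s \<omega>) \<partial>M)"
          proof (intro nn_integral_mono)
            fix \<omega>
            have "\<beta> s \<omega> = ennreal a * ennreal ((norm (D s \<omega>))\<^sup>2) + ennreal (g s \<omega>)"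
              using a g_nonneg s by (simp add: \<beta>_def ennreal_mult max_def)
            then show "(\<beta> s \<omega> * indicator {s. B s \<omega> < ennreal c} s) * indicator {0..t} s
                \<le> ennreal a * (ennreal ((norm (D s \<omega>))\<^sup>2) * indicator {\<omega>. B s \<omega> < ennreal c} \<omega>) + ennreal (g s \<omega>)"
              by (auto simp: indicator_def)
          qed
          also have "\<dots> = ennreal a * (\<integral>\<^sup>+\<omega>. ennreal ((norm (D s \<omega>))\<^sup>2) * indicator {\<omega>. B s \<omega> < ennreal c} \<omega> \<partial>M) + (\<integral>\<^sup>+\<omega>. ennreal (g s \<omega>) \<partial>M)"
            by (subst nn_integral_add) (auto simp: nn_integral_cmult)
          also have "\<dots> \<le> ennreal a * (ennreal (2 * T + 2) * ennreal (r s)) + ennreal k"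
            using main[OF s c] g_le[OF s] unfolding m_eq by (intro add_mono mult_left_mono) auto
          also have "\<dots> = ennreal ((a * (2 * T + 2)) * r s + k)"
            using a T k r_nonneg by (simp add: ennreal_mult[symmetric] ennreal_plus[symmetric] mult.assoc del: ennreal_plus)
          finally show ?thesis using True by simp
        qed simp
      qed
      finally show ?thesis .
    qed
    then have "r T \<le> 2 * k * T * exp (2 * (a * (2 * T + 2)) * T)"
      using a k T r_nonneg r_le by (intro gronwall_nn_integral[where c = c]) auto
    then have "ennreal (2 * T + 2) * ennreal (r T) \<le> ennreal (2 * T + 2) * ennreal (2 * k * T * exp (2 * (a * (2 * T + 2)) * T))"
      by (intro mult_left_mono ennreal_leI) auto
    also have "\<dots> = ennreal ((2 * T + 2) * (2 * k * T * exp (2 * (a * (2 * T + 2)) * T)))"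
      using T k by (intro ennreal_mult[symmetric]) auto
    finally show ?thesis
      by (rule order_trans[OF main[OF less_imp_le[OF T] order_refl c, unfolded m_eq]])
  qed
  \<comment> \<open>Removal of the truncation along \<open>c = Suc n\<close>: as \<open>B T\<close>
    is almost surely finite, every path eventually belongs to the event, and Fatou's lemma preserves
    the bound, which is the same for all \<open>c\<close>.\<close>
  have "(\<integral>\<^sup>+\<omega>. ennreal ((norm (X T \<omega> - Y T \<omega>))\<^sup>2) \<partial>M)
      \<le> (\<integral>\<^sup>+\<omega>. liminf (\<lambda>n. ennreal ((norm (D T \<omega>))\<^sup>2) * indicator {\<omega>. B T \<omega> < ennreal (real (Suc n))} \<omega>) \<partial>M)"
  proof (rule nn_integral_mono_AE)
    show "AE \<omega> in M. ennreal ((norm (X T \<omega> - Y T \<omega>))\<^sup>2) \<le> liminf (\<lambda>n. ennreal ((norm (D T \<omega>))\<^sup>2) * indicator {\<omega>. B T \<omega> < ennreal (real (Suc n))} \<omega>)"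
      using B_fin
    proof eventually_elim
      case (elim \<omega>)
      obtain n where n: "B T \<omega> = ennreal n" "0 \<le> n"
        using elim by (cases "B T \<omega>") auto
      obtain N :: nat where N: "n < real N"
        using reals_Archimedean2 by blast
      have "\<forall>\<^sub>F j in sequentially. ennreal ((norm (X T \<omega> - Y T \<omega>))\<^sup>2) \<le> ennreal ((norm (D T \<omega>))\<^sup>2) * indicator {\<omega>. B T \<omega> < ennreal (real (Suc j))} \<omega>"
        using eventually_ge_at_top[of N]
      proof eventually_elim
        case (elim j)
        then have "B T \<omega> < ennreal (real (Suc j))"
          using n N by (simp add: ennreal_less_iff del: of_nat_Suc)
        then show ?case using T by (simp add: D_def)
      qed
      then show ?case by (rule Liminf_bounded)
    qed
  qed
  also have "\<dots> \<le> liminf (\<lambda>n. \<integral>\<^sup>+\<omega>. ennreal ((norm (D T \<omega>))\<^sup>2) * indicator {\<omega>. B T \<omega> < ennreal (real (Suc n))} \<omega> \<partial>M)"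
    by (rule nn_integral_liminf) measurable
  also have "\<dots> \<le> ennreal ((2 * T + 2) * (2 * k * T * exp (2 * (a * (2 * T + 2)) * T)))"
    proof (rule order_trans[OF Liminf_le_Limsup Limsup_bounded])
    show "\<forall>\<^sub>F n in sequentially. (\<integral>\<^sup>+\<omega>. ennreal ((norm (D T \<omega>))\<^sup>2) * indicator {\<omega>. B T \<omega> < ennreal (real (Suc n))} \<omega> \<partial>M)
        \<le> ennreal ((2 * T + 2) * (2 * k * T * exp (2 * (a * (2 * T + 2)) * T)))"
      by (intro always_eventually allI truncated) simp
  qed simp
  finally show ?thesis .
qed

end

section \<open>The modified equations\<close>

context brownian_setting
begin

text \<open>The two modified equations share \<open>f\<close>, \<open>G\<close> and the noise, so
  their coefficients differ by a Lipschitz part and a perturbation of size \<open>h\<close>. Its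
  square has mean of order h^2, and the Gronwall bound is linear in this mean.\<close>

lemma modified_equations_L2:
  fixes f f\<^sub>1 f\<^sub>2 :: "real ^ 'd \<Rightarrow> real ^ 'd" and G G\<^sub>1 G\<^sub>2 :: "real ^ 'd \<Rightarrow> real ^ 'm ^ 'd"
    and X Y :: "real \<Rightarrow> real \<Rightarrow> 'a \<Rightarrow> real ^ 'd"
  assumes X: "\<And>h. 0 < h \<Longrightarrow> sde_solution M F W (\<lambda>x. f x + h *\<^sub>R f\<^sub>1 x) (\<lambda>x. G x + h *\<^sub>R G\<^sub>1 x) x\<^sub>0 (X h)"
    and Y: "\<And>h. 0 < h \<Longrightarrow> sde_solution M F W (\<lambda>x. f x + h *\<^sub>R f\<^sub>2 x) (\<lambda>x. G x + h *\<^sub>R G\<^sub>2 x) x\<^sub>0 (Y h)"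
    and lip: "globally_lipschitz f" "globally_lipschitz G" and T: "0 < T" and C\<^sub>1: "0 \<le> C\<^sub>1"
  shows "\<exists>C\<ge>0. \<forall>h>0. (\<forall>s\<in>{0..T}.
           integrable M (\<lambda>\<omega>. (norm (f\<^sub>1 (X h s \<omega>)))\<^sup>2) \<and> (LINT \<omega>|M. (norm (f\<^sub>1 (X h s \<omega>)))\<^sup>2) \<le> C\<^sub>1 \<and>
           integrable M (\<lambda>\<omega>. (norm (G\<^sub>1 (X h s \<omega>)))\<^sup>2) \<and> (LINT \<omega>|M. (norm (G\<^sub>1 (X h s \<omega>)))\<^sup>2) \<le> C\<^sub>1 \<and>
           integrable M (\<lambda>\<omega>. (norm (f\<^sub>2 (Y h s \<omega>)))\<^sup>2) \<and> (LINT \<omega>|M. (norm (f\<^sub>2 (Y h s \<omega>)))\<^sup>2) \<le> C\<^sub>1 \<and>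
           integrable M (\<lambda>\<omega>. (norm (G\<^sub>2 (Y h s \<omega>)))\<^sup>2) \<and> (LINT \<omega>|M. (norm (G\<^sub>2 (Y h s \<omega>)))\<^sup>2) \<le> C\<^sub>1) \<longrightarrow>
         (\<integral>\<^sup>+\<omega>. ennreal ((norm (X h T \<omega> - Y h T \<omega>))\<^sup>2) \<partial>M) \<le> ennreal (C * h\<^sup>2)"
proof -
  obtain L\<^sub>f L\<^sub>G where "L\<^sub>f-lipschitz_on UNIV f" "L\<^sub>G-lipschitz_on UNIV G"
    using lip by (auto simp: globally_lipschitz_def)
  \<comment> \<open>The 1 makes \<open>L\<close>, and with it the Gronwall rate, positive.\<close>
  define L where "L = max 1 (max L\<^sub>f L\<^sub>G)"
  have L: "L-lipschitz_on UNIV f" "L-lipschitz_on UNIV G" "0 < L"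
    using \<open>L\<^sub>f-lipschitz_on UNIV f\<close> \<open>L\<^sub>G-lipschitz_on UNIV G\<close> by (auto simp: L_def intro: lipschitz_on_le)
  have [measurable]: "f \<in> borel_measurable borel" "G \<in> borel_measurable borel"
    using L lipschitz_on_continuous_on by (auto intro!: borel_measurable_continuous_onI)
  define a where "a = 2 * L\<^sup>2"
  have a: "0 < a" using L by (simp add: a_def)
  \<comment> \<open>The bound of \<open>sde_difference_L2\<close> with
    \<open>k = 16 * C\<^sub>1 * h\<^sup>2\<close> and the factor h^2 taken out; 16 comes from four
    perturbation terms, each with factor 4 from squaring a sum twice.\<close>
  define C where "C = (2 * T + 2) * (2 * (16 * C\<^sub>1) * T * exp (2 * (a * (2 * T + 2)) * T))"
  have perturbed_diff: "(norm ((u + h *\<^sub>R p) - (v + h *\<^sub>R q)))\<^sup>2 \<le> a * (norm z)\<^sup>2 + 4 * h\<^sup>2 * ((norm p)\<^sup>2 + (norm q)\<^sup>2)"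
    if "norm (u - v) \<le> L * norm z" for u v p q :: "'v::real_normed_vector" and z :: "real ^ 'd" and h
  proof -
    have "(norm ((u + h *\<^sub>R p) - (v + h *\<^sub>R q)))\<^sup>2 = (norm ((u - v) - h *\<^sub>R (q - p)))\<^sup>2"
      by (simp add: algebra_simps)
    also have "\<dots> \<le> 2 * (norm (u - v))\<^sup>2 + 2 * (norm (h *\<^sub>R (q - p)))\<^sup>2"
      by (rule power2_norm_diff_le)
    also have "(norm (u - v))\<^sup>2 \<le> (L * norm z)\<^sup>2"
      using that by (intro power_mono) auto
    also have "(norm (h *\<^sub>R (q - p)))\<^sup>2 \<le> h\<^sup>2 * (2 * (norm q)\<^sup>2 + 2 * (norm p)\<^sup>2)"
      using power2_norm_diff_le[of q p] by (auto simp: power_mult_distrib intro: mult_left_mono)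
    finally show ?thesis
      by (simp add: a_def power_mult_distrib algebra_simps)
  qed
  have "(\<integral>\<^sup>+\<omega>. ennreal ((norm (X h T \<omega> - Y h T \<omega>))\<^sup>2) \<partial>M) \<le> ennreal (C * h\<^sup>2)"
    if h: "0 < h" and bound: "\<And>s. s \<in> {0..T} \<Longrightarrow>
           integrable M (\<lambda>\<omega>. (norm (f\<^sub>1 (X h s \<omega>)))\<^sup>2) \<and> (LINT \<omega>|M. (norm (f\<^sub>1 (X h s \<omega>)))\<^sup>2) \<le> C\<^sub>1 \<and>
           integrable M (\<lambda>\<omega>. (norm (G\<^sub>1 (X h s \<omega>)))\<^sup>2) \<and> (LINT \<omega>|M. (norm (G\<^sub>1 (X h s \<omega>)))\<^sup>2) \<le> C\<^sub>1 \<and>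
           integrable M (\<lambda>\<omega>. (norm (f\<^sub>2 (Y h s \<omega>)))\<^sup>2) \<and> (LINT \<omega>|M. (norm (f\<^sub>2 (Y h s \<omega>)))\<^sup>2) \<le> C\<^sub>1 \<and>
           integrable M (\<lambda>\<omega>. (norm (G\<^sub>2 (Y h s \<omega>)))\<^sup>2) \<and> (LINT \<omega>|M. (norm (G\<^sub>2 (Y h s \<omega>)))\<^sup>2) \<le> C\<^sub>1" for h
  proof -
    \<comment> \<open>The sum of the perturbations of drift and diffusion, so that one
      \<open>g\<close> dominates both coefficient differences.\<close>
    define g where "g s \<omega> = 4 * h\<^sup>2 * ((norm (f\<^sub>1 (X h s \<omega>)))\<^sup>2 + (norm (f\<^sub>2 (Y h s \<omega>)))\<^sup>2)
        + 4 * h\<^sup>2 * ((norm (G\<^sub>1 (X h s \<omega>)))\<^sup>2 + (norm (G\<^sub>2 (Y h s \<omega>)))\<^sup>2)" for s \<omega>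
    have f_diff: "norm (f (X h s \<omega>) - f (Y h s \<omega>)) \<le> L * norm (X h s \<omega> - Y h s \<omega>)"
      and G_diff: "norm (G (X h s \<omega>) - G (Y h s \<omega>)) \<le> L * norm (X h s \<omega> - Y h s \<omega>)" for s \<omega>
      using lipschitz_onD[OF L(1), of "X h s \<omega>" "Y h s \<omega>"] lipschitz_onD[OF L(2), of "X h s \<omega>" "Y h s \<omega>"]
      by (auto simp: dist_norm)
    let ?N = "restrict_space borel {0::real..} \<Otimes>\<^sub>M M"
    \<comment> \<open>The perturbations are arbitrary functions. Their composition with the solution
      is measurable because the solution concept makes the full coefficient measurable along the
      path: subtract the Lipschitz part and divide by \<open>h\<close>.\<close>
    have perturbation_meas: "(\<lambda>(s, \<omega>). p (Z s \<omega>)) \<in> borel_measurable ?N"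
      if Z: "(\<lambda>(s, \<omega>). Z s \<omega>) \<in> borel_measurable ?N" and u: "u \<in> borel_measurable borel"
        and "(\<lambda>(s, \<omega>). u (Z s \<omega>) + h *\<^sub>R p (Z s \<omega>)) \<in> borel_measurable ?N"
      for Z :: "real \<Rightarrow> 'a \<Rightarrow> real ^ 'd" and u p :: "real ^ 'd \<Rightarrow> 'v::euclidean_space"
    proof -
      have "(\<lambda>z. u (case z of (s, \<omega>) \<Rightarrow> Z s \<omega>)) \<in> borel_measurable ?N"
        using measurable_compose[OF Z u] .
      with that(3) have "(\<lambda>z. (1 / h) *\<^sub>R ((case z of (s, \<omega>) \<Rightarrow> u (Z s \<omega>) + h *\<^sub>R p (Z s \<omega>)) - u (case z of (s, \<omega>) \<Rightarrow> Z s \<omega>))) \<in> borel_measurable ?N"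
        by measurable
      also have "(\<lambda>z. (1 / h) *\<^sub>R ((case z of (s, \<omega>) \<Rightarrow> u (Z s \<omega>) + h *\<^sub>R p (Z s \<omega>)) - u (case z of (s, \<omega>) \<Rightarrow> Z s \<omega>))) = (\<lambda>(s, \<omega>). p (Z s \<omega>))"
        using h by (auto simp: fun_eq_iff)
      finally show ?thesis .
    qed
    have sde_meas: "(\<lambda>(s, \<omega>). Z s \<omega>) \<in> borel_measurable ?N" "(\<lambda>(s, \<omega>). b (Z s \<omega>)) \<in> borel_measurable ?N"
      "(\<lambda>(s, \<omega>). \<sigma> (Z s \<omega>)) \<in> borel_measurable ?N"
      if "sde_solution M F W b \<sigma> x\<^sub>0 Z" for b \<sigma> and Z :: "real \<Rightarrow> 'a \<Rightarrow> real ^ 'd"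
      using that by (auto simp: sde_solution_def measurable_adapted_def has_ito_integral_def)
    note mX = sde_meas[OF X[OF h]] and mY = sde_meas[OF Y[OF h]]
    have [measurable]: "(\<lambda>(s, \<omega>). f\<^sub>1 (X h s \<omega>)) \<in> borel_measurable ?N" "(\<lambda>(s, \<omega>). G\<^sub>1 (X h s \<omega>)) \<in> borel_measurable ?N"
      "(\<lambda>(s, \<omega>). f\<^sub>2 (Y h s \<omega>)) \<in> borel_measurable ?N" "(\<lambda>(s, \<omega>). G\<^sub>2 (Y h s \<omega>)) \<in> borel_measurable ?N"
      using perturbation_meas[of "X h" f f\<^sub>1] perturbation_meas[of "X h" G G\<^sub>1]
        perturbation_meas[of "Y h" f f\<^sub>2] perturbation_meas[of "Y h" G G\<^sub>2] mX mY by simp_all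
    have g_meas: "(\<lambda>(s, \<omega>). g s \<omega>) \<in> borel_measurable ?N"
    proof -
      have "(\<lambda>z. 4 * h\<^sup>2 * ((norm (case z of (s, \<omega>) \<Rightarrow> f\<^sub>1 (X h s \<omega>)))\<^sup>2 + (norm (case z of (s, \<omega>) \<Rightarrow> f\<^sub>2 (Y h s \<omega>)))\<^sup>2)
        + 4 * h\<^sup>2 * ((norm (case z of (s, \<omega>) \<Rightarrow> G\<^sub>1 (X h s \<omega>)))\<^sup>2 + (norm (case z of (s, \<omega>) \<Rightarrow> G\<^sub>2 (Y h s \<omega>)))\<^sup>2)) \<in> borel_measurable ?N"
        by measurable
      then show ?thesis by (simp add: g_def case_prod_beta)
    qed
    have g_le: "(\<integral>\<^sup>+\<omega>. ennreal (g s \<omega>) \<partial>M) \<le> ennreal (16 * C\<^sub>1 * h\<^sup>2)" if "0 \<le> s" "s \<le> T" for s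
    proof -
      note b = bound[of s]
      have "(\<integral>\<^sup>+\<omega>. ennreal (g s \<omega>) \<partial>M) = ennreal (LINT \<omega>|M. g s \<omega>)"
        using b that by (intro nn_integral_eq_integral) (auto simp: g_def)
      also have "(LINT \<omega>|M. g s \<omega>) = 4 * h\<^sup>2 * ((LINT \<omega>|M. (norm (f\<^sub>1 (X h s \<omega>)))\<^sup>2) + (LINT \<omega>|M. (norm (f\<^sub>2 (Y h s \<omega>)))\<^sup>2)
          + ((LINT \<omega>|M. (norm (G\<^sub>1 (X h s \<omega>)))\<^sup>2) + (LINT \<omega>|M. (norm (G\<^sub>2 (Y h s \<omega>)))\<^sup>2)))"
        using b that by (simp add: g_def distrib_left)
      also have "\<dots> \<le> 4 * h\<^sup>2 * (4 * C\<^sub>1)"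
        using b that by (intro mult_left_mono) auto
      finally show ?thesis
        by (simp add: ennreal_leI algebra_simps)
    qed
    have "(\<integral>\<^sup>+\<omega>. ennreal ((norm (X h T \<omega> - Y h T \<omega>))\<^sup>2) \<partial>M)
      \<le> ennreal ((2 * T + 2) * (2 * (16 * C\<^sub>1 * h\<^sup>2) * T * exp (2 * (a * (2 * T + 2)) * T)))"
    proof (rule sde_difference_L2[OF X[OF h] Y[OF h] _ _ g_meas _ g_le a _ T])
      show "(norm (f (X h s \<omega>) + h *\<^sub>R f\<^sub>1 (X h s \<omega>) - (f (Y h s \<omega>) + h *\<^sub>R f\<^sub>2 (Y h s \<omega>))))\<^sup>2
          \<le> a * (norm (X h s \<omega> - Y h s \<omega>))\<^sup>2 + g s \<omega>" for s \<omega>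
        by (rule order_trans[OF perturbed_diff[OF f_diff]]) (simp add: g_def)
      show "(norm (G (X h s \<omega>) + h *\<^sub>R G\<^sub>1 (X h s \<omega>) - (G (Y h s \<omega>) + h *\<^sub>R G\<^sub>2 (Y h s \<omega>))))\<^sup>2
          \<le> a * (norm (X h s \<omega> - Y h s \<omega>))\<^sup>2 + g s \<omega>" for s \<omega>
        by (rule order_trans[OF perturbed_diff[OF G_diff]]) (simp add: g_def)
    qed (use C\<^sub>1 in \<open>auto simp: g_def\<close>)
    then show ?thesis
      by (simp add: C_def algebra_simps)
  qed
  moreover have "0 \<le> C"
    using C\<^sub>1 T by (simp add: C_def)
  ultimately show ?thesis by blast
qed

end

section \<open>Multilevel estimators\<close>

context prob_space
begin

section \<open>Mean and variance of sample means\<close>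

lemma expectation_sum_power2_indep:
  fixes U :: "'i \<Rightarrow> 'a \<Rightarrow> real"
  assumes indep: "indep_vars (\<lambda>_. borel) U J" and J: "finite J"
    and int: "\<And>i. i \<in> J \<Longrightarrow> integrable M (U i)" "\<And>i. i \<in> J \<Longrightarrow> integrable M (\<lambda>\<omega>. (U i \<omega>)\<^sup>2)"
    and mean: "\<And>i. i \<in> J \<Longrightarrow> expectation (U i) = 0"
  shows "has_bochner_integral M (\<lambda>\<omega>. (\<Sum>i\<in>J. U i \<omega>)\<^sup>2) (\<Sum>i\<in>J. expectation (\<lambda>\<omega>. (U i \<omega>)\<^sup>2))"
proof -
  have "has_bochner_integral M (\<lambda>\<omega>. U i \<omega> * U j \<omega>) (if i = j then expectation (\<lambda>\<omega>. (U i \<omega>)\<^sup>2) else 0)"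
    if ij: "i \<in> J" "j \<in> J" for i j
  proof (cases "i = j")
    case True
    then show ?thesis
      using int(2) ij by (simp add: has_bochner_integral_iff power2_eq_square)
  next
    case False
    have ind: "indep_vars (\<lambda>_. borel) U {i, j}"
      using ij by (intro indep_vars_subset[OF indep]) auto
    have i: "integrable M (U k)" if "k \<in> {i, j}" for k
      using int(1) ij that by auto
    show ?thesis
      using indep_vars_integrable[OF _ ind i] indep_vars_lebesgue_integral[OF _ ind i] False mean ij
      by (simp add: has_bochner_integral_iff)
  qed
  then have "has_bochner_integral M (\<lambda>\<omega>. \<Sum>i\<in>J. \<Sum>j\<in>J. U i \<omega> * U j \<omega>)
      (\<Sum>i\<in>J. \<Sum>j\<in>J. if i = j then expectation (\<lambda>\<omega>. (U i \<omega>)\<^sup>2) else 0)"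
    by (intro has_bochner_integral_sum)
  then show ?thesis
    using J by (simp add: power2_eq_square sum_product)
qed

text \<open>The samples live on \<open>M\<close>, their common law comes from \<open>Q\<close>; all
  moments are carried over through this law. The function \<open>g\<close> selects what is averaged:
  a single sample, the first coordinate of a coupled pair, or the difference of its coordinates. The
  variance of one sample is bounded by its second moment, which is the quantity controlled
  later.\<close>

lemma iid_sample_mean:
  fixes V :: "nat \<Rightarrow> 'a \<Rightarrow> 'v::topological_space" and g :: "'v \<Rightarrow> real" and Q :: "'b measure"
  assumes iid: "iid_samples M N V (distr Q borel \<Phi>)" and N: "0 < N"
    and \<Phi> [measurable]: "\<Phi> \<in> borel_measurable Q" and g [measurable]: "g \<in> borel_measurable borel"
    and int: "integrable Q (\<lambda>\<omega>. g (\<Phi> \<omega>))"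
  defines "S \<equiv> sample_mean N (\<lambda>i \<omega>. g (V i \<omega>))"
  shows "has_bochner_integral M S (LINT \<omega>|Q. g (\<Phi> \<omega>))"
    and "integrable Q (\<lambda>\<omega>. (g (\<Phi> \<omega>))\<^sup>2) \<Longrightarrow> integrable M (\<lambda>\<omega>. (S \<omega>)\<^sup>2)"
    and "integrable Q (\<lambda>\<omega>. (g (\<Phi> \<omega>))\<^sup>2) \<Longrightarrow> variance S \<le> (LINT \<omega>|Q. (g (\<Phi> \<omega>))\<^sup>2) / real N"
proof -
  define \<mu> where "\<mu> = (LINT \<omega>|Q. g (\<Phi> \<omega>))"
  have indep: "indep_vars (\<lambda>_. borel) V {1..N}" and distr: "\<And>i. i \<in> {1..N} \<Longrightarrow> distr M borel (V i) = distr Q borel \<Phi>"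
    using iid by (auto simp: iid_samples_def)
  have V_meas: "V i \<in> borel_measurable M" if "i \<in> {1..N}" for i
    using indep that by (auto simp: indep_vars_def)
  have transfer: "integrable M (\<lambda>\<omega>. u (V i \<omega>)) \<longleftrightarrow> integrable Q (\<lambda>\<omega>. u (\<Phi> \<omega>))"
    "expectation (\<lambda>\<omega>. u (V i \<omega>)) = (LINT \<omega>|Q. u (\<Phi> \<omega>))"
    if i: "i \<in> {1..N}" and u: "u \<in> borel_measurable borel" for u :: "'v \<Rightarrow> real" and i
    using integrable_distr_eq[OF V_meas[OF i] u] integrable_distr_eq[OF \<Phi> u]
      integral_distr[OF V_meas[OF i] u] integral_distr[OF \<Phi> u] distr[OF i] by simp_all
  have int_V: "integrable M (\<lambda>\<omega>. g (V i \<omega>))" "expectation (\<lambda>\<omega>. g (V i \<omega>)) = \<mu>" if "i \<in> {1..N}" for i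
    using transfer[OF that g] int by (auto simp: \<mu>_def)
  have "has_bochner_integral M (\<lambda>\<omega>. (\<Sum>i=1..N. g (V i \<omega>)) / real N) ((\<Sum>i=1..N. \<mu>) / real N)"
    using int_V by (intro has_bochner_integral_divide has_bochner_integral_sum) (auto simp: has_bochner_integral_iff)
  moreover have "(\<Sum>i=1..N. \<mu>) / real N = \<mu>"
    using N by simp
  ultimately have S: "has_bochner_integral M S \<mu>"
    by (simp add: S_def sample_mean_def[abs_def])
  then show "has_bochner_integral M S (LINT \<omega>|Q. g (\<Phi> \<omega>))"
    by (simp add: \<mu>_def)
  assume int2: "integrable Q (\<lambda>\<omega>. (g (\<Phi> \<omega>))\<^sup>2)"
  define U where "U i \<omega> = g (V i \<omega>) - \<mu>" for i \<omega>
  have int_V2: "integrable M (\<lambda>\<omega>. (g (V i \<omega>))\<^sup>2)" "expectation (\<lambda>\<omega>. (g (V i \<omega>))\<^sup>2) = (LINT \<omega>|Q. (g (\<Phi> \<omega>))\<^sup>2)"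
    if "i \<in> {1..N}" for i
    using transfer[OF that, of "\<lambda>x. (g x)\<^sup>2"] int2 by auto
  have U: "integrable M (U i)" "expectation (U i) = 0" "integrable M (\<lambda>\<omega>. (U i \<omega>)\<^sup>2)"
    "expectation (\<lambda>\<omega>. (U i \<omega>)\<^sup>2) \<le> (LINT \<omega>|Q. (g (\<Phi> \<omega>))\<^sup>2)" if i: "i \<in> {1..N}" for i
  proof -
    show "integrable M (U i)" "expectation (U i) = 0"
      using int_V[OF i] by (auto simp: U_def[abs_def] prob_space)
    show "integrable M (\<lambda>\<omega>. (U i \<omega>)\<^sup>2)"
      using int_V[OF i] int_V2[OF i] by (simp add: U_def power2_diff)
    have "expectation (\<lambda>\<omega>. (U i \<omega>)\<^sup>2) = (LINT \<omega>|Q. (g (\<Phi> \<omega>))\<^sup>2) - \<mu>\<^sup>2"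
      using variance_eq[OF int_V(1)[OF i] int_V2(1)[OF i]] int_V(2)[OF i] int_V2(2)[OF i] by (simp add: U_def)
    then show "expectation (\<lambda>\<omega>. (U i \<omega>)\<^sup>2) \<le> (LINT \<omega>|Q. (g (\<Phi> \<omega>))\<^sup>2)"
      by simp
  qed
  have "indep_vars (\<lambda>_. borel) U {1..N}"
    unfolding U_def[abs_def] by (rule indep_vars_compose2[OF indep]) measurable
  then have sum_U: "has_bochner_integral M (\<lambda>\<omega>. (\<Sum>i=1..N. U i \<omega>)\<^sup>2) (\<Sum>i=1..N. expectation (\<lambda>\<omega>. (U i \<omega>)\<^sup>2))"
    using U by (intro expectation_sum_power2_indep) auto
  have S_centered: "S \<omega> - \<mu> = (\<Sum>i=1..N. U i \<omega>) / real N" for \<omega>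
    using N by (simp add: S_def sample_mean_def U_def sum_subtractf field_simps)
  have var_S: "has_bochner_integral M (\<lambda>\<omega>. (S \<omega> - \<mu>)\<^sup>2) ((\<Sum>i=1..N. expectation (\<lambda>\<omega>. (U i \<omega>)\<^sup>2)) / (real N)\<^sup>2)"
    unfolding S_centered power_divide using sum_U by (rule has_bochner_integral_divide)
  \<comment> \<open>This combination is \<open>(S \<omega>)\<^sup>2\<close> after expanding the
    square.\<close>
  have "integrable M (\<lambda>\<omega>. (S \<omega> - \<mu>)\<^sup>2 + 2 * \<mu> * S \<omega> - \<mu>\<^sup>2)"
    using var_S S by (auto simp: has_bochner_integral_iff)
  then show "integrable M (\<lambda>\<omega>. (S \<omega>)\<^sup>2)"
    by (simp add: power2_diff)
  have "variance S = (\<Sum>i=1..N. expectation (\<lambda>\<omega>. (U i \<omega>)\<^sup>2)) / (real N)\<^sup>2"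
    using var_S S by (simp add: has_bochner_integral_iff)
  also have "\<dots> \<le> (\<Sum>i=1..N. LINT \<omega>|Q. (g (\<Phi> \<omega>))\<^sup>2) / (real N)\<^sup>2"
    using U(4) by (intro divide_right_mono sum_mono) auto
  also have "\<dots> = (LINT \<omega>|Q. (g (\<Phi> \<omega>))\<^sup>2) / real N"
    using N by (simp add: power2_eq_square)
  finally show "variance S \<le> (LINT \<omega>|Q. (g (\<Phi> \<omega>))\<^sup>2) / real N" .
qed

end

text \<open>All limiting statements in h are merged here into one threshold \<open>hmax\<close>,
  valid for every pair of \<open>h\<close> and \<open>m\<close> with \<open>m * h = T\<close>. The
  second moment of the coupled difference is of order h^2 for two reasons: the error of (b) for the
  test function \<open>?\<psi>\<close>, and the distance of the two modified solutions times the
  squared Lipschitz constant.\<close>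

lemma (in brownian_setting) level_bounds:
  fixes f f\<^sub>1 f\<^sub>2 :: "real ^ 'd \<Rightarrow> real ^ 'd" and G G\<^sub>1 G\<^sub>2 :: "real ^ 'd \<Rightarrow> real ^ 'm ^ 'd"
    and X\<^sub>h Y\<^sub>h :: "real \<Rightarrow> real \<Rightarrow> 'a \<Rightarrow> real ^ 'd" and X\<^sub>n Y\<^sub>n :: "real \<Rightarrow> nat \<Rightarrow> 'b \<Rightarrow> real ^ 'd"
    and \<phi> :: "real ^ 'd \<Rightarrow> real"
  assumes Xh: "\<And>h. 0 < h \<Longrightarrow> sde_solution M F W (\<lambda>x. f x + h *\<^sub>R f\<^sub>1 x) (\<lambda>x. G x + h *\<^sub>R G\<^sub>1 x) x\<^sub>0 (X\<^sub>h h)"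
    and Yh: "\<And>h. 0 < h \<Longrightarrow> sde_solution M F W (\<lambda>x. f x + h *\<^sub>R f\<^sub>2 x) (\<lambda>x. G x + h *\<^sub>R G\<^sub>2 x) x\<^sub>0 (Y\<^sub>h h)"
    and T: "0 < T" and \<phi>: "\<phi> \<in> C_inf_poly" "globally_lipschitz \<phi>"
    and weak_X: "weak_approximation \<alpha> Q X\<^sub>n M (\<lambda>h. X)" and weak_Y: "weak_approximation \<alpha> Q Y\<^sub>n M (\<lambda>h. X)"
    and weak_Z: "weak_approximation 2 Q (\<lambda>h n \<omega>. (X\<^sub>n h n \<omega>, Y\<^sub>n h n \<omega>)) M (\<lambda>h t \<omega>. (X\<^sub>h h t \<omega>, Y\<^sub>h h t \<omega>))"
    and lip: "globally_lipschitz f" "globally_lipschitz G"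
    and moments: "\<exists>C\<^sub>1>0. \<forall>\<^sub>F h in at_right 0. \<forall>s\<in>{0..T}.
           integrable M (\<lambda>\<omega>. (norm (f\<^sub>1 (X\<^sub>h h s \<omega>)))\<^sup>2) \<and> (LINT \<omega>|M. (norm (f\<^sub>1 (X\<^sub>h h s \<omega>)))\<^sup>2) \<le> C\<^sub>1 \<and>
           integrable M (\<lambda>\<omega>. (norm (G\<^sub>1 (X\<^sub>h h s \<omega>)))\<^sup>2) \<and> (LINT \<omega>|M. (norm (G\<^sub>1 (X\<^sub>h h s \<omega>)))\<^sup>2) \<le> C\<^sub>1 \<and>
           integrable M (\<lambda>\<omega>. (norm (f\<^sub>2 (Y\<^sub>h h s \<omega>)))\<^sup>2) \<and> (LINT \<omega>|M. (norm (f\<^sub>2 (Y\<^sub>h h s \<omega>)))\<^sup>2) \<le> C\<^sub>1 \<and>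
           integrable M (\<lambda>\<omega>. (norm (G\<^sub>2 (Y\<^sub>h h s \<omega>)))\<^sup>2) \<and> (LINT \<omega>|M. (norm (G\<^sub>2 (Y\<^sub>h h s \<omega>)))\<^sup>2) \<le> C\<^sub>1"
  shows "\<exists>hmax>0. \<exists>K\<^sub>1>0. \<exists>K\<^sub>2>0. \<forall>h m. 0 < h \<longrightarrow> h < hmax \<longrightarrow> real m * h = T \<longrightarrow>
    integrable M (\<lambda>\<omega>. \<phi> (X T \<omega>)) \<and> integrable (Q h) (\<lambda>\<omega>. \<phi> (X\<^sub>n h m \<omega>)) \<and> integrable (Q h) (\<lambda>\<omega>. \<phi> (Y\<^sub>n h m \<omega>)) \<and>
    integrable (Q h) (\<lambda>\<omega>. (\<phi> (X\<^sub>n h m \<omega>))\<^sup>2) \<and> integrable (Q h) (\<lambda>\<omega>. (\<phi> (X\<^sub>n h m \<omega>) - \<phi> (Y\<^sub>n h m \<omega>))\<^sup>2) \<and>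
    \<bar>(LINT \<omega>|M. \<phi> (X T \<omega>)) - (LINT \<omega>|Q h. \<phi> (X\<^sub>n h m \<omega>))\<bar> \<le> K\<^sub>1 * h powr \<alpha> \<and>
    (LINT \<omega>|Q h. (\<phi> (X\<^sub>n h m \<omega>) - \<phi> (Y\<^sub>n h m \<omega>))\<^sup>2) \<le> K\<^sub>2 * h\<^sup>2"
proof -
  let ?\<psi> = "\<lambda>z :: (real ^ 'd) \<times> (real ^ 'd). (\<phi> (fst z) - \<phi> (snd z))\<^sup>2"
  have \<phi>_fst: "(\<lambda>z :: (real ^ 'd) \<times> (real ^ 'd). \<phi> (fst z)) \<in> C_inf_poly" and \<phi>_snd: "(\<lambda>z :: (real ^ 'd) \<times> (real ^ 'd). \<phi> (snd z)) \<in> C_inf_poly"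
    using \<phi>(1) by (rule C_inf_poly_compose_fst, rule C_inf_poly_compose_snd)
  have \<psi>: "?\<psi> \<in> C_inf_poly" and square: "(\<lambda>z :: (real ^ 'd) \<times> (real ^ 'd). (\<phi> (fst z))\<^sup>2) \<in> C_inf_poly"
    unfolding power2_eq_square by (intro C_inf_poly_mult C_inf_poly_diff \<phi>_fst \<phi>_snd)+
  obtain L where L: "L-lipschitz_on UNIV \<phi>"
    using \<phi>(2) by (auto simp: globally_lipschitz_def)
  have \<psi>_le: "?\<psi> z \<le> L\<^sup>2 * (norm (fst z - snd z))\<^sup>2" for z
  proof -
    have "\<bar>\<phi> (fst z) - \<phi> (snd z)\<bar> \<le> L * norm (fst z - snd z)"
      using lipschitz_onD[OF L, of "fst z" "snd z"] by (simp add: dist_norm)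
    then have "\<bar>\<phi> (fst z) - \<phi> (snd z)\<bar>\<^sup>2 \<le> (L * norm (fst z - snd z))\<^sup>2"
      by (intro power_mono) auto
    then show ?thesis by (simp add: power_mult_distrib)
  qed
  obtain K\<^sub>1 where K1: "0 < K\<^sub>1" and ev1: "\<forall>\<^sub>F h in at_right 0. \<forall>m::nat. real m * h = T \<longrightarrow>
      integrable M (\<lambda>\<omega>. \<phi> (X T \<omega>)) \<and> integrable (Q h) (\<lambda>\<omega>. \<phi> (X\<^sub>n h m \<omega>)) \<and>
      \<bar>(LINT \<omega>|M. \<phi> (X T \<omega>)) - (LINT \<omega>|Q h. \<phi> (X\<^sub>n h m \<omega>))\<bar> \<le> K\<^sub>1 * h powr \<alpha>"
    using weak_X[unfolded weak_approximation_def, rule_format, OF \<phi>(1) T] by blast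
  have ev2: "\<forall>\<^sub>F h in at_right 0. \<forall>m::nat. real m * h = T \<longrightarrow> integrable (Q h) (\<lambda>\<omega>. \<phi> (Y\<^sub>n h m \<omega>))"
    using weak_Y[unfolded weak_approximation_def, rule_format, OF \<phi>(1) T] by (auto elim!: eventually_mono)
  \<comment> \<open>This square integrability is for level zero, where the estimator averages single
    samples and not differences.\<close>
  have ev3: "\<forall>\<^sub>F h in at_right 0. \<forall>m::nat. real m * h = T \<longrightarrow> integrable (Q h) (\<lambda>\<omega>. (\<phi> (X\<^sub>n h m \<omega>))\<^sup>2)"
    using weak_Z[unfolded weak_approximation_def, rule_format, OF square T] by (auto elim!: eventually_mono)
  obtain K where K: "0 < K" and ev4: "\<forall>\<^sub>F h in at_right 0. \<forall>m::nat. real m * h = T \<longrightarrow>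
      integrable M (\<lambda>\<omega>. ?\<psi> (X\<^sub>h h T \<omega>, Y\<^sub>h h T \<omega>)) \<and> integrable (Q h) (\<lambda>\<omega>. ?\<psi> (X\<^sub>n h m \<omega>, Y\<^sub>n h m \<omega>)) \<and>
      \<bar>(LINT \<omega>|M. ?\<psi> (X\<^sub>h h T \<omega>, Y\<^sub>h h T \<omega>)) - (LINT \<omega>|Q h. ?\<psi> (X\<^sub>n h m \<omega>, Y\<^sub>n h m \<omega>))\<bar> \<le> K * h powr 2"
    using weak_Z[unfolded weak_approximation_def, rule_format, OF \<psi> T] by blast
  obtain C\<^sub>1 where C1: "0 < C\<^sub>1" and ev5: "\<forall>\<^sub>F h in at_right 0. \<forall>s\<in>{0..T}.
           integrable M (\<lambda>\<omega>. (norm (f\<^sub>1 (X\<^sub>h h s \<omega>)))\<^sup>2) \<and> (LINT \<omega>|M. (norm (f\<^sub>1 (X\<^sub>h h s \<omega>)))\<^sup>2) \<le> C\<^sub>1 \<and>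
           integrable M (\<lambda>\<omega>. (norm (G\<^sub>1 (X\<^sub>h h s \<omega>)))\<^sup>2) \<and> (LINT \<omega>|M. (norm (G\<^sub>1 (X\<^sub>h h s \<omega>)))\<^sup>2) \<le> C\<^sub>1 \<and>
           integrable M (\<lambda>\<omega>. (norm (f\<^sub>2 (Y\<^sub>h h s \<omega>)))\<^sup>2) \<and> (LINT \<omega>|M. (norm (f\<^sub>2 (Y\<^sub>h h s \<omega>)))\<^sup>2) \<le> C\<^sub>1 \<and>
           integrable M (\<lambda>\<omega>. (norm (G\<^sub>2 (Y\<^sub>h h s \<omega>)))\<^sup>2) \<and> (LINT \<omega>|M. (norm (G\<^sub>2 (Y\<^sub>h h s \<omega>)))\<^sup>2) \<le> C\<^sub>1"
    using moments by blast
  obtain C where C: "0 \<le> C" and L2: "\<forall>h>0. (\<forall>s\<in>{0..T}.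
           integrable M (\<lambda>\<omega>. (norm (f\<^sub>1 (X\<^sub>h h s \<omega>)))\<^sup>2) \<and> (LINT \<omega>|M. (norm (f\<^sub>1 (X\<^sub>h h s \<omega>)))\<^sup>2) \<le> C\<^sub>1 \<and>
           integrable M (\<lambda>\<omega>. (norm (G\<^sub>1 (X\<^sub>h h s \<omega>)))\<^sup>2) \<and> (LINT \<omega>|M. (norm (G\<^sub>1 (X\<^sub>h h s \<omega>)))\<^sup>2) \<le> C\<^sub>1 \<and>
           integrable M (\<lambda>\<omega>. (norm (f\<^sub>2 (Y\<^sub>h h s \<omega>)))\<^sup>2) \<and> (LINT \<omega>|M. (norm (f\<^sub>2 (Y\<^sub>h h s \<omega>)))\<^sup>2) \<le> C\<^sub>1 \<and>
           integrable M (\<lambda>\<omega>. (norm (G\<^sub>2 (Y\<^sub>h h s \<omega>)))\<^sup>2) \<and> (LINT \<omega>|M. (norm (G\<^sub>2 (Y\<^sub>h h s \<omega>)))\<^sup>2) \<le> C\<^sub>1) \<longrightarrow>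
         (\<integral>\<^sup>+\<omega>. ennreal ((norm (X\<^sub>h h T \<omega> - Y\<^sub>h h T \<omega>))\<^sup>2) \<partial>M) \<le> ennreal (C * h\<^sup>2)"
    using modified_equations_L2[OF Xh Yh lip T less_imp_le[OF C1]] by blast
  have "\<forall>\<^sub>F h in at_right 0. \<forall>m::nat. real m * h = T \<longrightarrow>
    integrable M (\<lambda>\<omega>. \<phi> (X T \<omega>)) \<and> integrable (Q h) (\<lambda>\<omega>. \<phi> (X\<^sub>n h m \<omega>)) \<and> integrable (Q h) (\<lambda>\<omega>. \<phi> (Y\<^sub>n h m \<omega>)) \<and>
    integrable (Q h) (\<lambda>\<omega>. (\<phi> (X\<^sub>n h m \<omega>))\<^sup>2) \<and> integrable (Q h) (\<lambda>\<omega>. (\<phi> (X\<^sub>n h m \<omega>) - \<phi> (Y\<^sub>n h m \<omega>))\<^sup>2) \<and>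
    \<bar>(LINT \<omega>|M. \<phi> (X T \<omega>)) - (LINT \<omega>|Q h. \<phi> (X\<^sub>n h m \<omega>))\<bar> \<le> K\<^sub>1 * h powr \<alpha> \<and>
    (LINT \<omega>|Q h. (\<phi> (X\<^sub>n h m \<omega>) - \<phi> (Y\<^sub>n h m \<omega>))\<^sup>2) \<le> (L\<^sup>2 * C + K) * h\<^sup>2"
    using ev1 ev2 ev3 ev4 ev5 eventually_at_right_less[of "0::real"]
  proof eventually_elim
    case (elim h)
    have D_le: "(\<integral>\<^sup>+\<omega>. ennreal ((norm (X\<^sub>h h T \<omega> - Y\<^sub>h h T \<omega>))\<^sup>2) \<partial>M) \<le> ennreal (C * h\<^sup>2)"
      using L2[rule_format, OF elim(6)] elim(5) by blast
    have "X\<^sub>h h T \<in> borel_measurable M" "Y\<^sub>h h T \<in> borel_measurable M"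
      using Xh[OF elim(6)] Yh[OF elim(6)] T
      by (auto intro!: measurable_F_M[of T] simp: sde_solution_def measurable_adapted_def)
    note [measurable] = this
    have second_moment: "(LINT \<omega>|Q h. (\<phi> (X\<^sub>n h m \<omega>) - \<phi> (Y\<^sub>n h m \<omega>))\<^sup>2) \<le> (L\<^sup>2 * C + K) * h\<^sup>2" if m: "real m * h = T" for m
    proof -
      have 4: "integrable M (\<lambda>\<omega>. ?\<psi> (X\<^sub>h h T \<omega>, Y\<^sub>h h T \<omega>))"
        "\<bar>(LINT \<omega>|M. ?\<psi> (X\<^sub>h h T \<omega>, Y\<^sub>h h T \<omega>)) - (LINT \<omega>|Q h. ?\<psi> (X\<^sub>n h m \<omega>, Y\<^sub>n h m \<omega>))\<bar> \<le> K * h powr 2"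
        using elim(4) m by blast+
      have "ennreal (LINT \<omega>|M. ?\<psi> (X\<^sub>h h T \<omega>, Y\<^sub>h h T \<omega>)) = (\<integral>\<^sup>+\<omega>. ennreal (?\<psi> (X\<^sub>h h T \<omega>, Y\<^sub>h h T \<omega>)) \<partial>M)"
        using 4(1) by (intro nn_integral_eq_integral[symmetric]) auto
      also have "\<dots> \<le> (\<integral>\<^sup>+\<omega>. ennreal (L\<^sup>2) * ennreal ((norm (X\<^sub>h h T \<omega> - Y\<^sub>h h T \<omega>))\<^sup>2) \<partial>M)"
        using \<psi>_le[of "(X\<^sub>h h T _, Y\<^sub>h h T _)"] by (intro nn_integral_mono) (auto simp: ennreal_mult[symmetric] intro!: ennreal_leI)
      also have "\<dots> = ennreal (L\<^sup>2) * (\<integral>\<^sup>+\<omega>. ennreal ((norm (X\<^sub>h h T \<omega> - Y\<^sub>h h T \<omega>))\<^sup>2) \<partial>M)"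
        by (rule nn_integral_cmult) measurable
      also have "\<dots> \<le> ennreal (L\<^sup>2) * ennreal (C * h\<^sup>2)"
        using D_le by (rule mult_left_mono) simp
      also have "\<dots> = ennreal (L\<^sup>2 * (C * h\<^sup>2))"
        using C by (intro ennreal_mult[symmetric]) auto
      finally have "(LINT \<omega>|M. ?\<psi> (X\<^sub>h h T \<omega>, Y\<^sub>h h T \<omega>)) \<le> L\<^sup>2 * (C * h\<^sup>2)"
        using C by (subst (asm) ennreal_le_iff) auto
      moreover have "h powr 2 = h\<^sup>2"
        using elim(6) by (simp add: powr_numeral)
      ultimately show ?thesis
        using 4(2) by (simp add: algebra_simps abs_le_iff)
    qed
    show ?case
      using elim(1-4) second_moment by simp
  qed
  then obtain hmax :: real where "0 < hmax" and "\<And>h. 0 < h \<Longrightarrow> h < hmax \<Longrightarrow> \<forall>m::nat. real m * h = T \<longrightarrow>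
    integrable M (\<lambda>\<omega>. \<phi> (X T \<omega>)) \<and> integrable (Q h) (\<lambda>\<omega>. \<phi> (X\<^sub>n h m \<omega>)) \<and> integrable (Q h) (\<lambda>\<omega>. \<phi> (Y\<^sub>n h m \<omega>)) \<and>
    integrable (Q h) (\<lambda>\<omega>. (\<phi> (X\<^sub>n h m \<omega>))\<^sup>2) \<and> integrable (Q h) (\<lambda>\<omega>. (\<phi> (X\<^sub>n h m \<omega>) - \<phi> (Y\<^sub>n h m \<omega>))\<^sup>2) \<and>
    \<bar>(LINT \<omega>|M. \<phi> (X T \<omega>)) - (LINT \<omega>|Q h. \<phi> (X\<^sub>n h m \<omega>))\<bar> \<le> K\<^sub>1 * h powr \<alpha> \<and>
    (LINT \<omega>|Q h. (\<phi> (X\<^sub>n h m \<omega>) - \<phi> (Y\<^sub>n h m \<omega>))\<^sup>2) \<le> (L\<^sup>2 * C + K) * h\<^sup>2"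
    by (auto simp: eventually_at_right[of 0 1])
  \<comment> \<open>Positivity rests on \<open>K\<close>; the first summand may vanish, for instance
    for constant \<open>\<phi>\<close>.\<close>
  moreover have "0 < L\<^sup>2 * C + K"
    using C K by (simp add: add_nonneg_pos)
  ultimately show ?thesis
    using K1 by blast
qed

theorem theorem3p4:
  fixes M :: "'a measure" and F :: "real \<Rightarrow> 'a measure" and W :: "real \<Rightarrow> 'a \<Rightarrow> real ^ 'm"
    and f f\<^sub>1 f\<^sub>2 :: "real ^ 'd \<Rightarrow> real ^ 'd" and G G\<^sub>1 G\<^sub>2 :: "real ^ 'd \<Rightarrow> real ^ 'm ^ 'd"
    and x\<^sub>0 :: "real ^ 'd" and X :: "real \<Rightarrow> 'a \<Rightarrow> real ^ 'd"
    and X\<^sub>h Y\<^sub>h :: "real \<Rightarrow> real \<Rightarrow> 'a \<Rightarrow> real ^ 'd"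
    and Q :: "real \<Rightarrow> 'b measure" and X\<^sub>n Y\<^sub>n :: "real \<Rightarrow> nat \<Rightarrow> 'b \<Rightarrow> real ^ 'd"
    and T \<alpha> :: real and \<phi> :: "real ^ 'd \<Rightarrow> real"
  assumes "prob_space M"
    and "brownian_vector M W"
    and "brownian_filtration M F W"
    and "sde_solution M F W f G x\<^sub>0 X"
    and "\<forall>h>0. sde_solution M F W (\<lambda>x. f x + h *\<^sub>R f\<^sub>1 x) (\<lambda>x. G x + h *\<^sub>R G\<^sub>1 x) x\<^sub>0 (X\<^sub>h h)"
    and "\<forall>h>0. sde_solution M F W (\<lambda>x. f x + h *\<^sub>R f\<^sub>2 x) (\<lambda>x. G x + h *\<^sub>R G\<^sub>2 x) x\<^sub>0 (Y\<^sub>h h)"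
    and "\<forall>h>0. prob_space (Q h)"
    and "\<forall>h>0. \<forall>n. X\<^sub>n h n \<in> borel_measurable (Q h) \<and> Y\<^sub>n h n \<in> borel_measurable (Q h)"
    and "T > 0"
    and "\<phi> \<in> C_inf_poly"
    and "globally_lipschitz \<phi>"
    (* (a) *)
    and "\<alpha> > 1 / 2"
    and "weak_approximation \<alpha> Q X\<^sub>n M (\<lambda>h. X)"
    and "weak_approximation \<alpha> Q Y\<^sub>n M (\<lambda>h. X)"
    (* (b) *)
    and "weak_approximation 2 Q (\<lambda>h n \<omega>. (X\<^sub>n h n \<omega>, Y\<^sub>n h n \<omega>)) M (\<lambda>h t \<omega>. (X\<^sub>h h t \<omega>, Y\<^sub>h h t \<omega>))"
    (* (c) *)
    and "globally_lipschitz f"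
    and "globally_lipschitz G"
    and "\<exists>C\<^sub>1>0. \<forall>\<^sub>F h in at_right 0. \<forall>s\<in>{0..T}.
           integrable M (\<lambda>\<omega>. (norm (f\<^sub>1 (X\<^sub>h h s \<omega>)))\<^sup>2) \<and> (LINT \<omega>|M. (norm (f\<^sub>1 (X\<^sub>h h s \<omega>)))\<^sup>2) \<le> C\<^sub>1 \<and>
           integrable M (\<lambda>\<omega>. (norm (G\<^sub>1 (X\<^sub>h h s \<omega>)))\<^sup>2) \<and> (LINT \<omega>|M. (norm (G\<^sub>1 (X\<^sub>h h s \<omega>)))\<^sup>2) \<le> C\<^sub>1 \<and>
           integrable M (\<lambda>\<omega>. (norm (f\<^sub>2 (Y\<^sub>h h s \<omega>)))\<^sup>2) \<and> (LINT \<omega>|M. (norm (f\<^sub>2 (Y\<^sub>h h s \<omega>)))\<^sup>2) \<le> C\<^sub>1 \<and>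
           integrable M (\<lambda>\<omega>. (norm (G\<^sub>2 (Y\<^sub>h h s \<omega>)))\<^sup>2) \<and> (LINT \<omega>|M. (norm (G\<^sub>2 (Y\<^sub>h h s \<omega>)))\<^sup>2) \<le> C\<^sub>1"
  shows "\<exists>hmax>0. \<forall>M\<^sub>0>0.
    (\<forall>l. level_h T M\<^sub>0 l < hmax) \<longrightarrow>
    (\<forall>l\<ge>1. distr (Q (level_h T M\<^sub>0 l)) borel
               (\<lambda>\<omega>. \<phi> (Y\<^sub>n (level_h T M\<^sub>0 l) (level_steps M\<^sub>0 l) \<omega>)) =
            distr (Q (level_h T M\<^sub>0 (l - 1))) borel
               (\<lambda>\<omega>. \<phi> (X\<^sub>n (level_h T M\<^sub>0 (l - 1)) (level_steps M\<^sub>0 (l - 1)) \<omega>))) \<longrightarrow>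
    (\<exists>c\<^sub>1>0. \<exists>c\<^sub>2>0. \<forall>(N :: nat \<Rightarrow> nat) (Pf :: nat \<Rightarrow> nat \<Rightarrow> 'a \<Rightarrow> real) (Pc :: nat \<Rightarrow> nat \<Rightarrow> 'a \<Rightarrow> real).
       (\<forall>l. N l > 0) \<and>
       (\<forall>l\<ge>1. iid_samples M (N l) (\<lambda>i \<omega>. (Pf l i \<omega>, Pc l i \<omega>))
          (distr (Q (level_h T M\<^sub>0 l)) borel
             (\<lambda>\<omega>. (\<phi> (X\<^sub>n (level_h T M\<^sub>0 l) (level_steps M\<^sub>0 l) \<omega>),
                   \<phi> (Y\<^sub>n (level_h T M\<^sub>0 l) (level_steps M\<^sub>0 l) \<omega>))))) \<and>
       iid_samples M (N 0) (Pf 0)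
          (distr (Q (level_h T M\<^sub>0 0)) borel
             (\<lambda>\<omega>. \<phi> (X\<^sub>n (level_h T M\<^sub>0 0) (level_steps M\<^sub>0 0) \<omega>))) \<longrightarrow>
       (\<forall>l.
          integrable M (\<lambda>\<omega>. \<phi> (X T \<omega>)) \<and>
          integrable M (level_estimator N Pf l) \<and>
          integrable M (correction_estimator N Pf Pc l) \<and>
          integrable M (\<lambda>\<omega>. (correction_estimator N Pf Pc l \<omega>)\<^sup>2) \<and>
          \<bar>LINT \<omega>|M. (level_estimator N Pf l \<omega> - \<phi> (X T \<omega>))\<bar> \<le> c\<^sub>1 * (level_h T M\<^sub>0 l) powr \<alpha> \<and>
          (LINT \<omega>|M. correction_estimator N Pf Pc l \<omega>) =
            (if l = 0 then (LINT \<omega>|M. level_estimator N Pf 0 \<omega>)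
             else (LINT \<omega>|M. (level_estimator N Pf l \<omega> - level_estimator N Pf (l - 1) \<omega>))) \<and>
          prob_space.variance M (correction_estimator N Pf Pc l)
            \<le> c\<^sub>2 * (level_h T M\<^sub>0 l)\<^sup>2 / real (N l)))"
proof -
  interpret brownian_setting M F W
    using assms(1-3) by (intro brownian_setting.intro brownian_setting_axioms.intro)
  have Xh: "\<And>h. 0 < h \<Longrightarrow> sde_solution M F W (\<lambda>x. f x + h *\<^sub>R f\<^sub>1 x) (\<lambda>x. G x + h *\<^sub>R G\<^sub>1 x) x\<^sub>0 (X\<^sub>h h)"
    and Yh: "\<And>h. 0 < h \<Longrightarrow> sde_solution M F W (\<lambda>x. f x + h *\<^sub>R f\<^sub>2 x) (\<lambda>x. G x + h *\<^sub>R G\<^sub>2 x) x\<^sub>0 (Y\<^sub>h h)"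
    and XY_meas: "\<And>h n. 0 < h \<Longrightarrow> X\<^sub>n h n \<in> borel_measurable (Q h)" "\<And>h n. 0 < h \<Longrightarrow> Y\<^sub>n h n \<in> borel_measurable (Q h)"
    using assms(5,6,8) by auto
  obtain hmax K\<^sub>1 K\<^sub>2 where K: "0 < hmax" "0 < K\<^sub>1" "0 < K\<^sub>2" and bounds: "\<And>h m. 0 < h \<Longrightarrow> h < hmax \<Longrightarrow> real m * h = T \<Longrightarrow>
    integrable M (\<lambda>\<omega>. \<phi> (X T \<omega>)) \<and> integrable (Q h) (\<lambda>\<omega>. \<phi> (X\<^sub>n h m \<omega>)) \<and> integrable (Q h) (\<lambda>\<omega>. \<phi> (Y\<^sub>n h m \<omega>)) \<and>
    integrable (Q h) (\<lambda>\<omega>. (\<phi> (X\<^sub>n h m \<omega>))\<^sup>2) \<and> integrable (Q h) (\<lambda>\<omega>. (\<phi> (X\<^sub>n h m \<omega>) - \<phi> (Y\<^sub>n h m \<omega>))\<^sup>2) \<and>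
    \<bar>(LINT \<omega>|M. \<phi> (X T \<omega>)) - (LINT \<omega>|Q h. \<phi> (X\<^sub>n h m \<omega>))\<bar> \<le> K\<^sub>1 * h powr \<alpha> \<and>
    (LINT \<omega>|Q h. (\<phi> (X\<^sub>n h m \<omega>) - \<phi> (Y\<^sub>n h m \<omega>))\<^sup>2) \<le> K\<^sub>2 * h\<^sup>2"
    using level_bounds[OF Xh Yh assms(9-11,13-18)] by blast
  have \<phi>_borel [measurable]: "\<phi> \<in> borel_measurable borel"
    using \<open>globally_lipschitz \<phi>\<close> unfolding globally_lipschitz_def by (blast intro: borel_measurable_continuous_onI lipschitz_on_continuous_on)
  have id_borel: "(\<lambda>u :: real. u) \<in> borel_measurable borel"
    by simp
  have fst_borel: "(fst :: real \<times> real \<Rightarrow> real) \<in> borel_measurable borel"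
    and diff_borel: "(\<lambda>z :: real \<times> real. fst z - snd z) \<in> borel_measurable borel"
    by (intro borel_measurable_continuous_onI continuous_intros)+
  show ?thesis
  proof (rule exI[of _ hmax], intro conjI allI impI, rule K(1))
    fix M\<^sub>0 :: nat
    assume M0: "0 < M\<^sub>0" and small: "\<forall>l. level_h T M\<^sub>0 l < hmax"
      and same_law: "\<forall>l\<ge>1. distr (Q (level_h T M\<^sub>0 l)) borel (\<lambda>\<omega>. \<phi> (Y\<^sub>n (level_h T M\<^sub>0 l) (level_steps M\<^sub>0 l) \<omega>)) =
            distr (Q (level_h T M\<^sub>0 (l - 1))) borel (\<lambda>\<omega>. \<phi> (X\<^sub>n (level_h T M\<^sub>0 (l - 1)) (level_steps M\<^sub>0 (l - 1)) \<omega>))"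
    define h where "h l = level_h T M\<^sub>0 l" for l
    define x where "x l \<omega> = \<phi> (X\<^sub>n (h l) (level_steps M\<^sub>0 l) \<omega>)" for l \<omega>
    define y where "y l \<omega> = \<phi> (Y\<^sub>n (h l) (level_steps M\<^sub>0 l) \<omega>)" for l \<omega>
    have h: "0 < h l" "h l < hmax" "real (level_steps M\<^sub>0 l) * h l = T" for l
      using M0 \<open>T > 0\<close> small by (auto simp: h_def level_h_def level_steps_def)
    have xy_meas [measurable]: "x l \<in> borel_measurable (Q (h l))" "y l \<in> borel_measurable (Q (h l))" for l
      unfolding x_def y_def using XY_meas[OF h(1)] by measurable
    have level: "integrable M (\<lambda>\<omega>. \<phi> (X T \<omega>))" "integrable (Q (h l)) (x l)" "integrable (Q (h l)) (y l)"
      "integrable (Q (h l)) (\<lambda>\<omega>. (x l \<omega>)\<^sup>2)" "integrable (Q (h l)) (\<lambda>\<omega>. (x l \<omega> - y l \<omega>)\<^sup>2)"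
      "\<bar>(LINT \<omega>|M. \<phi> (X T \<omega>)) - (LINT \<omega>|Q (h l). x l \<omega>)\<bar> \<le> K\<^sub>1 * h l powr \<alpha>"
      "(LINT \<omega>|Q (h l). (x l \<omega> - y l \<omega>)\<^sup>2) \<le> K\<^sub>2 * (h l)\<^sup>2" for l
      using bounds[OF h] by (auto simp: x_def[abs_def] y_def[abs_def])
    \<comment> \<open>The assumption that an approximation has the same law on both levels where it
      appears enters the claim about expectations only through this equality of means.\<close>
    have same_mean: "(LINT \<omega>|Q (h l). y l \<omega>) = (LINT \<omega>|Q (h (l - 1)). x (l - 1) \<omega>)" if "1 \<le> l" for l
    proof -
      have "distr (Q (h l)) borel (y l) = distr (Q (h (l - 1))) borel (x (l - 1))"
        using same_law that by (simp add: h_def x_def[abs_def] y_def[abs_def])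
      moreover have "(LINT u|distr (Q (h l)) borel (y l). u) = (LINT \<omega>|Q (h l). y l \<omega>)"
        by (rule integral_distr) auto
      moreover have "(LINT u|distr (Q (h (l - 1))) borel (x (l - 1)). u) = (LINT \<omega>|Q (h (l - 1)). x (l - 1) \<omega>)"
        by (rule integral_distr) auto
      ultimately show ?thesis by metis
    qed
    \<comment> \<open>On level zero there is no cancellation, and the variance is bounded by the
      plain second moment. Dividing it by \<open>(h 0)\<^sup>2\<close> casts this bound in the
      required form; hence the constant depends on \<open>M\<^sub>0\<close>, but not on the sample
      numbers.\<close>
    define c\<^sub>2 where "c\<^sub>2 = K\<^sub>2 + (LINT \<omega>|Q (h 0). (x 0 \<omega>)\<^sup>2) / (h 0)\<^sup>2"
    have c2: "K\<^sub>2 \<le> c\<^sub>2" "(LINT \<omega>|Q (h 0). (x 0 \<omega>)\<^sup>2) \<le> c\<^sub>2 * (h 0)\<^sup>2" "0 < c\<^sub>2"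
      using K(3) h(1)[of 0] by (auto simp: c\<^sub>2_def distrib_right intro!: add_pos_nonneg divide_nonneg_nonneg)
    show "\<exists>c\<^sub>1>0. \<exists>c\<^sub>2>0. \<forall>(N :: nat \<Rightarrow> nat) (Pf :: nat \<Rightarrow> nat \<Rightarrow> 'a \<Rightarrow> real) (Pc :: nat \<Rightarrow> nat \<Rightarrow> 'a \<Rightarrow> real).
       (\<forall>l. N l > 0) \<and>
       (\<forall>l\<ge>1. iid_samples M (N l) (\<lambda>i \<omega>. (Pf l i \<omega>, Pc l i \<omega>))
          (distr (Q (level_h T M\<^sub>0 l)) borel
             (\<lambda>\<omega>. (\<phi> (X\<^sub>n (level_h T M\<^sub>0 l) (level_steps M\<^sub>0 l) \<omega>),
                   \<phi> (Y\<^sub>n (level_h T M\<^sub>0 l) (level_steps M\<^sub>0 l) \<omega>))))) \<and>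
       iid_samples M (N 0) (Pf 0)
          (distr (Q (level_h T M\<^sub>0 0)) borel
             (\<lambda>\<omega>. \<phi> (X\<^sub>n (level_h T M\<^sub>0 0) (level_steps M\<^sub>0 0) \<omega>))) \<longrightarrow>
       (\<forall>l.
          integrable M (\<lambda>\<omega>. \<phi> (X T \<omega>)) \<and>
          integrable M (level_estimator N Pf l) \<and>
          integrable M (correction_estimator N Pf Pc l) \<and>
          integrable M (\<lambda>\<omega>. (correction_estimator N Pf Pc l \<omega>)\<^sup>2) \<and>
          \<bar>LINT \<omega>|M. (level_estimator N Pf l \<omega> - \<phi> (X T \<omega>))\<bar> \<le> c\<^sub>1 * (level_h T M\<^sub>0 l) powr \<alpha> \<and>
          (LINT \<omega>|M. correction_estimator N Pf Pc l \<omega>) =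
            (if l = 0 then (LINT \<omega>|M. level_estimator N Pf 0 \<omega>)
             else (LINT \<omega>|M. (level_estimator N Pf l \<omega> - level_estimator N Pf (l - 1) \<omega>))) \<and>
          prob_space.variance M (correction_estimator N Pf Pc l)
            \<le> c\<^sub>2 * (level_h T M\<^sub>0 l)\<^sup>2 / real (N l))"
    proof (rule exI[of _ K\<^sub>1], rule conjI[OF K(2)], rule exI[of _ c\<^sub>2], rule conjI[OF c2(3)], intro allI impI, elim conjE)
      fix N :: "nat \<Rightarrow> nat" and Pf Pc :: "nat \<Rightarrow> nat \<Rightarrow> 'a \<Rightarrow> real" and l :: nat
      assume N: "\<forall>l. N l > 0"
        and coupled: "\<forall>l\<ge>1. iid_samples M (N l) (\<lambda>i \<omega>. (Pf l i \<omega>, Pc l i \<omega>))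
          (distr (Q (level_h T M\<^sub>0 l)) borel
             (\<lambda>\<omega>. (\<phi> (X\<^sub>n (level_h T M\<^sub>0 l) (level_steps M\<^sub>0 l) \<omega>),
                   \<phi> (Y\<^sub>n (level_h T M\<^sub>0 l) (level_steps M\<^sub>0 l) \<omega>))))"
        and coarsest: "iid_samples M (N 0) (Pf 0)
          (distr (Q (level_h T M\<^sub>0 0)) borel
             (\<lambda>\<omega>. \<phi> (X\<^sub>n (level_h T M\<^sub>0 0) (level_steps M\<^sub>0 0) \<omega>)))"
      have iid: "iid_samples M (N l) (\<lambda>i \<omega>. (Pf l i \<omega>, Pc l i \<omega>)) (distr (Q (h l)) borel (\<lambda>\<omega>. (x l \<omega>, y l \<omega>)))" if "1 \<le> l" for l
        using coupled that by (simp add: h_def x_def y_def)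
      have iid0: "iid_samples M (N 0) (Pf 0) (distr (Q (h 0)) borel (x 0))"
        using coarsest by (simp add: h_def x_def[abs_def])
      have N_pos: "0 < N l" for l
        using N by simp
      note mean0 = iid_sample_mean[where g = "\<lambda>u. u", OF iid0 N_pos xy_meas(1) id_borel level(2)]
      have pair_meas: "(\<lambda>\<omega>. (x l \<omega>, y l \<omega>)) \<in> borel_measurable (Q (h l))" for l
        by measurable
      \<comment> \<open>For \<open>l > 0\<close> the fine sample is the first coordinate of a
        coupled pair, so its mean is read off the joint law by \<open>fst\<close>; level zero has a
        law of its own.\<close>
      have fine: "has_bochner_integral M (level_estimator N Pf l) (LINT \<omega>|Q (h l). x l \<omega>)" for l
      proof (cases "l = 0")
        case True
        then show ?thesis
          using mean0(1) by (simp add: level_estimator_def)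
      next
        case False
        then show ?thesis
          using iid_sample_mean(1)[OF iid N_pos pair_meas fst_borel, of l] level(2)[of l] by (simp add: level_estimator_def)
      qed
      have correction: "has_bochner_integral M (correction_estimator N Pf Pc l) (LINT \<omega>|Q (h l). x l \<omega> - y l \<omega>)"
        "integrable M (\<lambda>\<omega>. (correction_estimator N Pf Pc l \<omega>)\<^sup>2)"
        "variance (correction_estimator N Pf Pc l) \<le> (LINT \<omega>|Q (h l). (x l \<omega> - y l \<omega>)\<^sup>2) / real (N l)" if l: "1 \<le> l"
      proof -
        have eq: "correction_estimator N Pf Pc l = sample_mean (N l) (\<lambda>i \<omega>. fst (Pf l i \<omega>, Pc l i \<omega>) - snd (Pf l i \<omega>, Pc l i \<omega>))"
          using l by (simp add: correction_estimator_def[abs_def] fun_eq_iff)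
        have int: "integrable (Q (h l)) (\<lambda>\<omega>. fst (x l \<omega>, y l \<omega>) - snd (x l \<omega>, y l \<omega>))"
          "integrable (Q (h l)) (\<lambda>\<omega>. (fst (x l \<omega>, y l \<omega>) - snd (x l \<omega>, y l \<omega>))\<^sup>2)"
          using level(2,3,5)[of l] by auto
        note mean = iid_sample_mean[OF iid[OF l] N_pos pair_meas diff_borel int(1), folded eq]
        show "has_bochner_integral M (correction_estimator N Pf Pc l) (LINT \<omega>|Q (h l). x l \<omega> - y l \<omega>)"
          "integrable M (\<lambda>\<omega>. (correction_estimator N Pf Pc l \<omega>)\<^sup>2)"
          "variance (correction_estimator N Pf Pc l) \<le> (LINT \<omega>|Q (h l). (x l \<omega> - y l \<omega>)\<^sup>2) / real (N l)"
          using mean(1) mean(2,3)[OF int(2)] by simp_all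
      qed
      have bias: "\<bar>LINT \<omega>|M. (level_estimator N Pf l \<omega> - \<phi> (X T \<omega>))\<bar> \<le> K\<^sub>1 * h l powr \<alpha>"
        using fine[of l] level(1) level(6)[of l] by (simp add: has_bochner_integral_iff abs_minus_commute)
      show "integrable M (\<lambda>\<omega>. \<phi> (X T \<omega>)) \<and>
          integrable M (level_estimator N Pf l) \<and>
          integrable M (correction_estimator N Pf Pc l) \<and>
          integrable M (\<lambda>\<omega>. (correction_estimator N Pf Pc l \<omega>)\<^sup>2) \<and>
          \<bar>LINT \<omega>|M. (level_estimator N Pf l \<omega> - \<phi> (X T \<omega>))\<bar> \<le> K\<^sub>1 * (level_h T M\<^sub>0 l) powr \<alpha> \<and>
          (LINT \<omega>|M. correction_estimator N Pf Pc l \<omega>) =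
            (if l = 0 then (LINT \<omega>|M. level_estimator N Pf 0 \<omega>)
             else (LINT \<omega>|M. (level_estimator N Pf l \<omega> - level_estimator N Pf (l - 1) \<omega>))) \<and>
          prob_space.variance M (correction_estimator N Pf Pc l)
            \<le> c\<^sub>2 * (level_h T M\<^sub>0 l)\<^sup>2 / real (N l)"
      proof (cases "l = 0")
        case True
        have eq: "correction_estimator N Pf Pc 0 = sample_mean (N 0) (Pf 0)" "level_estimator N Pf 0 = sample_mean (N 0) (Pf 0)"
          by (simp_all add: correction_estimator_def[abs_def] level_estimator_def)
        have "variance (sample_mean (N 0) (Pf 0)) \<le> c\<^sub>2 * (h 0)\<^sup>2 / real (N 0)"
          using order_trans[OF mean0(3)[OF level(4)] divide_right_mono[OF c2(2)]] by simp
        then show ?thesis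
          using True bias level(1) fine[of 0] mean0(2)[OF level(4)]
          by (simp add: eq h_def has_bochner_integral_iff)
      next
        case False
        then have l: "1 \<le> l" by simp
        have "(LINT \<omega>|Q (h l). (x l \<omega> - y l \<omega>)\<^sup>2) \<le> c\<^sub>2 * (h l)\<^sup>2"
          using level(7)[of l] mult_right_mono[OF c2(1), of "(h l)\<^sup>2"] by simp
        then have "variance (correction_estimator N Pf Pc l) \<le> c\<^sub>2 * (h l)\<^sup>2 / real (N l)"
          using correction(3)[OF l] divide_right_mono[of _ "c\<^sub>2 * (h l)\<^sup>2" "real (N l)"] by (meson of_nat_0_le_iff order_trans)
        \<comment> \<open>The correction has the mean of \<open>x l\<close> minus that of
          \<open>y l\<close>, and \<open>same_mean\<close> turns the latter into the mean of the
          fine estimator one level below, although that estimator uses different samples.\<close>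
        moreover have "(LINT \<omega>|M. correction_estimator N Pf Pc l \<omega>) = (LINT \<omega>|M. (level_estimator N Pf l \<omega> - level_estimator N Pf (l - 1) \<omega>))"
          using correction(1)[OF l] fine[of l] fine[of "l - 1"] same_mean[OF l] level(2,3)[of l] by (simp add: has_bochner_integral_iff)
        ultimately show ?thesis
          using False bias level(1) fine[of l] correction(1,2)[OF l]
          by (simp add: h_def has_bochner_integral_iff)
      qed
    qed
  qed
qed

end
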